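(* Let $\mathcal{A}$ be a unital Banach algebra over $\mathbb{C}$ and $\varphi:\mathcal{A}\to\mathbb{C}$ a continuous linear functional with $\varphi(1)=1$. Let $(a_1,b_1)$ and $(a_2,b_2)$ be two-faced pairs of non-commutative random variables in $(\mathcal{A},\varphi)$ which are bi-free, and assume $\varphi(b_1)\neq 0$, $\varphi(b_2)\neq 0$. Then for all $(z,w)\in(\mathbb{C}\setminus\{0\})^2$ sufficiently close to $(0,0)$, $$T_{a_1,b_1}(z,w)\,T_{a_2,b_2}(z,w)=T_{a_1+a_2,\,b_1b_2}(z,w).$$
   Context: A two-faced pair $(a,b)$ in $(\mathcal{A},\varphi)$ is an ordered pair of elements of $\mathcal{A}$, with $a$ regarded as the left variable and $b$ as the right variable. Transforms. For $a\in\mathcal{A}$ let $G_a(z)=\varphi((z1-a)^{-1})$ for $|z|$ large, and let $K_a$ be the inverse of $G_a$ (a holomorphic map near $\infty$ with $G_a(\infty)=0$) defined near $0$, so $G_a(K_a(z))=z$ for small $z\ne0$ and $K_a(z)\to\infty$ as $z\to0$. For $b\in\mathcal{A}$ with $\varphi(b)\ne0$ let $\psi_b(s)=\varphi((1-sb)^{-1})-1$ for $s$ near $0$; then $\psi_b(0)=0$, $\psi_b'(0)=\varphi(b)\ne0$ and $\mathcal{X}_b$ denotes the holomorphic inverse function of $\psi_b$ near $0$ (with $\mathcal{X}_b(0)=0$). Let $F_{a,b}(t,s)=\varphi((t1-a)^{-1}(1-sb)^{-1})$. If $\varphi(b)\ne0$, the $2$-variables partial bi-free $T$-transform is, for $(z,w)\in(\mathbb{C}\setminus\{0\})^2$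 near $(0,0)$, $$T_{a,b}(z,w)=\frac{w+1}{w}\left(1-\frac{z}{F_{a,b}(K_a(z),\mathcal{X}_b(w))}\right).$$ Bi-freeness. A vector space with specified state vector is a triple $(X,X^\circ,\xi)$ with $X$ a complex vector space, $X=\mathbb{C}\xi\oplus X^\circ$, $\xi\ne 0$. Let $p:X\to\mathbb{C}$ be linear with $p(\xi)=1$, $\ker p=X^\circ$, and for a linear operator $T\in\mathcal{L}(X)$ let $\varphi_\xi(T)=p(T\xi)$. The free product of $(X_k,X_k^\circ,\xi_k)$, $k=1,2$, is $(X,X^\circ,\xi)$ with $X^\circ=\bigoplus_{n\ge1}\bigoplus_{k_1\ne k_2\neq\cdots\ne k_n}X_{k_1}^\circ\otimes\cdots\otimes X_{k_n}^\circ$ and $X=\mathbb{C}\xi\oplus X^\circ$. Let $X(\ell,k)$ (resp. $X(r,k)$) be the direct sum of $\mathbb{C}\xi$ and those summands with $k_1\ne k$ (resp. $k_n\neq k$). There are natural isomorphisms $V_k:X_k\otimes X(\ell,k)\to X$ and $W_k:X(r,k)\otimes X_k\to X$, given by concatenation of tensors with $\xi_k$ and $\xi$ treated as empty tensors ($\xi_k\otimes\xi\mapsto\xi$, etc.). For $T\in\mathcal{L}(X_k)$ put $\lambda_k(T)=V_k(T\otimes I)V_k^{-1}$ and $\rho_k(T)=W_k(I\otimes T)W_k^{-1}$. The two-faced pairs $(a_1,b_1)$, $(a_2,b_2)$ in $(\mathcal{A},\varphi)$ are bi-free if there exist vector spaces with specified state vectors $(X_k,X_k^\circ,\xi_k)$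 and operators $L_k,R_k\in\mathcal{L}(X_k)$, $k=1,2$, such that the joint distribution (all non-commutative moments) of $(a_1,b_1,a_2,b_2)$ with respect to $\varphi$ equals the joint distribution of $(\lambda_1(L_1),\rho_1(R_1),\lambda_2(L_2),\rho_2(R_2))$ with respect to $\varphi_\xi$ on the free product. *)

theory Defs
  imports "HOL-Analysis.Analysis" "HOL-Library.Poly_Mapping"
begin

section \<open>Complex vector spaces and complex Banach algebras\<close>

class scaleC =
  fixes scaleC :: "complex \<Rightarrow> 'a \<Rightarrow> 'a" (infixr "*\<^sub>C" 75)

class complex_vector = scaleC + ab_group_add +
  assumes scaleC_add_right: "c *\<^sub>C (x + y) = c *\<^sub>C x + c *\<^sub>C y"
    and scaleC_add_left: "(c + d) *\<^sub>C x = c *\<^sub>C x + d *\<^sub>C x"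
    and scaleC_scaleC: "c *\<^sub>C d *\<^sub>C x = (c * d) *\<^sub>C x"
    and scaleC_one: "1 *\<^sub>C x = x"

abbreviation clinear :: "('a::complex_vector \<Rightarrow> 'b::complex_vector) \<Rightarrow> bool"
  where "clinear \<equiv> Vector_Spaces.linear scaleC scaleC"

global_interpretation complex_vector: vector_space "scaleC :: complex \<Rightarrow> 'a \<Rightarrow> 'a::complex_vector"
  defines csubspace = complex_vector.subspace
    and cspan = complex_vector.span
  by unfold_locales (simp_all add: scaleC_add_right scaleC_add_left scaleC_scaleC scaleC_one)

text \<open>The norm of the unit is not required to be 1.\<close>

class complex_banach_algebra = complex_vector + real_normed_algebra + ring_1 + banach +
  assumes scaleR_eq_scaleC: "r *\<^sub>R x = complex_of_real r *\<^sub>C x"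
    and norm_scaleC: "norm (c *\<^sub>C x) = cmod c * norm x"
    and mult_scaleC_left: "(c *\<^sub>C x) * y = c *\<^sub>C (x * y)"
    and mult_scaleC_right: "x * (c *\<^sub>C y) = c *\<^sub>C (x * y)"

instantiation complex :: complex_vector
begin
definition scaleC_complex :: "complex \<Rightarrow> complex \<Rightarrow> complex"
  where "scaleC_complex c x = c * x"
instance
  by standard (simp_all add: scaleC_complex_def algebra_simps)
end

section \<open>Transforms\<close>

text \<open>Meaningful for invertible \<open>x\<close> only.\<close>

definition alg_inv :: "'a::ring_1 \<Rightarrow> 'a"
  where "alg_inv x = (THE y. x * y = 1 \<and> y * x = 1)"

definition G_transform :: "('a::complex_banach_algebra \<Rightarrow> complex) \<Rightarrow> 'a \<Rightarrow> complex \<Rightarrow> complex"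
  where "G_transform \<phi> a z = \<phi> (alg_inv (z *\<^sub>C 1 - a))"

text \<open>\<open>K\<^sub>a\<close> and \<open>\<X>\<^sub>b\<close> are germs at \<open>0\<close>: the conditions below determine the function on a
  (punctured) neighbourhood of \<open>0\<close>, and a representative is chosen.\<close>

definition K_transform :: "('a::complex_banach_algebra \<Rightarrow> complex) \<Rightarrow> 'a \<Rightarrow> complex \<Rightarrow> complex"
  where "K_transform \<phi> a = (SOME K. (\<forall>\<^sub>F z in at 0. G_transform \<phi> a (K z) = z) \<and>
                                    filterlim K at_infinity (at 0))"

definition psi_transform :: "('a::complex_banach_algebra \<Rightarrow> complex) \<Rightarrow> 'a \<Rightarrow> complex \<Rightarrow> complex"
  where "psi_transform \<phi> b s = \<phi> (alg_inv (1 - s *\<^sub>C b)) - 1"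

definition X_transform :: "('a::complex_banach_algebra \<Rightarrow> complex) \<Rightarrow> 'a \<Rightarrow> complex \<Rightarrow> complex"
  where "X_transform \<phi> b = (SOME X. X analytic_on {0} \<and> X 0 = 0 \<and>
                                    (\<forall>\<^sub>F w in nhds 0. psi_transform \<phi> b (X w) = w))"

definition F_transform ::
  "('a::complex_banach_algebra \<Rightarrow> complex) \<Rightarrow> 'a \<Rightarrow> 'a \<Rightarrow> complex \<Rightarrow> complex \<Rightarrow> complex"
  where "F_transform \<phi> a b t s = \<phi> (alg_inv (t *\<^sub>C 1 - a) * alg_inv (1 - s *\<^sub>C b))"

definition T_transform ::
  "('a::complex_banach_algebra \<Rightarrow> complex) \<Rightarrow> 'a \<Rightarrow> 'a \<Rightarrow> complex \<Rightarrow> complex \<Rightarrow> complex"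
  where "T_transform \<phi> a b z w =
    (w + 1) / w * (1 - z / F_transform \<phi> a b (K_transform \<phi> a z) (X_transform \<phi> b w))"

section \<open>Vector spaces with specified state vector\<close>

text \<open>The whole type \<open>'x\<close> is the vector space \<open>X\<close>.\<close>

definition state_space :: "'x::complex_vector set \<Rightarrow> 'x \<Rightarrow> bool"
  where "state_space X0 \<xi> \<longleftrightarrow> csubspace X0 \<and> \<xi> \<noteq> 0 \<and>
    cspan {\<xi>} \<inter> X0 = {0} \<and> (\<forall>x. \<exists>u\<in>cspan {\<xi>}. \<exists>v\<in>X0. x = u + v)"

text \<open>The projection \<open>p\<close>: the coefficient \<open>c\<close> in \<open>x = c \<xi> + x\<^sup>\<circ>\<close> with \<open>x\<^sup>\<circ> \<in> X\<^sup>\<circ>\<close>. It is also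
  used for the free product, which is a proper subspace of its type.\<close>

definition state_coeff :: "'x::complex_vector set \<Rightarrow> 'x \<Rightarrow> 'x \<Rightarrow> complex"
  where "state_coeff X0 \<xi> x = (THE c. x - c *\<^sub>C \<xi> \<in> X0)"

definition vector_state :: "'x::complex_vector set \<Rightarrow> 'x \<Rightarrow> ('x \<Rightarrow> 'x) \<Rightarrow> complex"
  where "vector_state X0 \<xi> T = state_coeff X0 \<xi> (T \<xi>)"

section \<open>Tensor products\<close>

instantiation poly_mapping :: (type, complex_vector) complex_vector
begin
lift_definition scaleC_poly_mapping :: "complex \<Rightarrow> ('a \<Rightarrow>\<^sub>0 'b) \<Rightarrow> ('a \<Rightarrow>\<^sub>0 'b)"
  is "\<lambda>c p k. c *\<^sub>C p k"
  by (erule finite_subset[rotated]) auto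
instance
  by standard (transfer; simp add: scaleC_add_right scaleC_add_left scaleC_scaleC scaleC_one)+
end

text \<open>The type \<open>('x, 'y) word_tensor\<close> is the direct sum of \<open>X\<^bsub>k\<^sub>1\<^esub> \<otimes> \<dots> \<otimes> X\<^bsub>k\<^sub>n\<^esub>\<close> over
  all words \<open>k\<^sub>1 \<dots> k\<^sub>n\<close> in \<open>{1,2}\<close>, \<open>n \<ge> 0\<close>, where \<open>X\<^sub>1 = 'x\<close> and \<open>X\<^sub>2 = 'y\<close>. It is the free
  vector space on the words of letters \<open>Inl x\<close>, \<open>Inr y\<close>, modulo linearity in each letter.\<close>

definition multilinearity_relations ::
    "(('x::complex_vector + 'y::complex_vector) list \<Rightarrow>\<^sub>0 complex) set"
  where "multilinearity_relations =
    {Poly_Mapping.single (u @ Inl (x + x') # v) 1 - Poly_Mapping.single (u @ Inl x # v) 1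
       - Poly_Mapping.single (u @ Inl x' # v) 1 | u v x x'. True} \<union>
    {Poly_Mapping.single (u @ Inl (c *\<^sub>C x) # v) 1
       - c *\<^sub>C Poly_Mapping.single (u @ Inl x # v) 1 | u v c x. True} \<union>
    {Poly_Mapping.single (u @ Inr (y + y') # v) 1 - Poly_Mapping.single (u @ Inr y # v) 1
       - Poly_Mapping.single (u @ Inr y' # v) 1 | u v y y'. True} \<union>
    {Poly_Mapping.single (u @ Inr (c *\<^sub>C y) # v) 1
       - c *\<^sub>C Poly_Mapping.single (u @ Inr y # v) 1 | u v c y. True}"

definition tensor_eq ::
    "(('x::complex_vector + 'y::complex_vector) list \<Rightarrow>\<^sub>0 complex) \<Rightarrow> (('x + 'y) list \<Rightarrow>\<^sub>0 complex) \<Rightarrow> bool"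
  where "tensor_eq p q \<longleftrightarrow> p - q \<in> cspan multilinearity_relations"

lemma equivp_tensor_eq: "equivp tensor_eq"
proof (rule equivpI)
  show "reflp tensor_eq"
    by (simp add: reflp_def tensor_eq_def complex_vector.span_zero)
  show "symp tensor_eq"
    unfolding tensor_eq_def by (rule sympI) (drule complex_vector.span_neg, simp)
  show "transp tensor_eq"
    unfolding tensor_eq_def by (rule transpI) (drule (1) complex_vector.span_add, simp)
qed

quotient_type (overloaded) ('x, 'y) word_tensor =
    "('x::complex_vector + 'y::complex_vector) list \<Rightarrow>\<^sub>0 complex" / tensor_eq
  by (rule equivp_tensor_eq)

instantiation word_tensor :: (complex_vector, complex_vector) complex_vector
begin
lift_definition zero_word_tensor :: "('a, 'b) word_tensor" is 0 .
lift_definition plus_word_tensor ::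
  "('a, 'b) word_tensor \<Rightarrow> ('a, 'b) word_tensor \<Rightarrow> ('a, 'b) word_tensor" is "(+)"
  unfolding tensor_eq_def by (drule (1) complex_vector.span_add) (simp add: algebra_simps)
lift_definition minus_word_tensor ::
  "('a, 'b) word_tensor \<Rightarrow> ('a, 'b) word_tensor \<Rightarrow> ('a, 'b) word_tensor" is "(-)"
  unfolding tensor_eq_def by (drule (1) complex_vector.span_diff) (simp add: algebra_simps)
lift_definition uminus_word_tensor :: "('a, 'b) word_tensor \<Rightarrow> ('a, 'b) word_tensor" is uminus
  unfolding tensor_eq_def by (drule complex_vector.span_neg) simp
lift_definition scaleC_word_tensor ::
  "complex \<Rightarrow> ('a, 'b) word_tensor \<Rightarrow> ('a, 'b) word_tensor" is scaleC
  unfolding tensor_eq_def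
  by (drule complex_vector.span_scale) (simp add: complex_vector.scale_right_diff_distrib)
instance
  by standard (transfer; simp add: tensor_eq_def complex_vector.span_zero algebra_simps
     scaleC_add_right scaleC_add_left scaleC_scaleC scaleC_one)+
end

text \<open>The elementary tensor of a word; the empty word gives the state vector \<open>\<xi>\<close>.\<close>

lift_definition tensor ::
    "('x::complex_vector + 'y::complex_vector) list \<Rightarrow> ('x, 'y) word_tensor"
  is "\<lambda>w. Poly_Mapping.single w 1" .

section \<open>The free product\<close>

text \<open>In the following \<open>X0\<close> and \<open>Y0\<close> stand for \<open>X\<^sub>1\<^sup>\<circ>\<close> and \<open>X\<^sub>2\<^sup>\<circ>\<close>. As tensor products over a field
  preserve inclusions, the summand \<open>X\<^bsub>k\<^sub>1\<^esub>\<^sup>\<circ> \<otimes> \<dots> \<otimes> X\<^bsub>k\<^sub>n\<^esub>\<^sup>\<circ>\<close> of the free product is the span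
  of the corresponding elementary tensors in \<^typ>\<open>('x, 'y) word_tensor\<close>.\<close>

definition free_words ::
    "'x::complex_vector set \<Rightarrow> 'y::complex_vector set \<Rightarrow> ('x + 'y) list set"
  where "free_words X0 Y0 =
    {w. set w \<subseteq> Inl ` X0 \<union> Inr ` Y0 \<and> successively (\<lambda>l m. isl l \<noteq> isl m) w}"

definition free_product ::
    "'x::complex_vector set \<Rightarrow> 'y::complex_vector set \<Rightarrow> ('x, 'y) word_tensor set"
  where "free_product X0 Y0 = cspan (tensor ` free_words X0 Y0)"

definition free_product0 ::
    "'x::complex_vector set \<Rightarrow> 'y::complex_vector set \<Rightarrow> ('x, 'y) word_tensor set"
  where "free_product0 X0 Y0 = cspan (tensor ` (free_words X0 Y0 - {[]}))"

definition free_state ::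
    "'x::complex_vector set \<Rightarrow> 'y::complex_vector set \<Rightarrow>
     (('x, 'y) word_tensor \<Rightarrow> ('x, 'y) word_tensor) \<Rightarrow> complex"
  where "free_state X0 Y0 = vector_state (free_product0 X0 Y0) (tensor [])"

text \<open>Left and right operators. The parameter \<open>\<iota>\<close> selects the factor: it is \<open>Inl\<close> for \<open>k = 1\<close> and
  \<open>Inr\<close> for \<open>k = 2\<close>; \<open>U0\<close> and \<open>\<xi>\<close> belong to the space \<open>X\<^sub>k = 'u\<close>. The spaces \<open>X(\<ell>,k)\<close> and \<open>X(r,k)\<close>
  are spanned by the tensors of \<open>left_words\<close> and \<open>right_words\<close>; so \<open>X\<^sub>k \<otimes> X(\<ell>,k)\<close> and
  \<open>X(r,k) \<otimes> X\<^sub>k\<close> are again subspaces of \<^typ>\<open>('x, 'y) word_tensor\<close>.\<close>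

definition left_words ::
    "('u \<Rightarrow> 'x + 'y) \<Rightarrow> 'x::complex_vector set \<Rightarrow> 'y::complex_vector set \<Rightarrow> ('x + 'y) list set"
  where "left_words \<iota> X0 Y0 = {w \<in> free_words X0 Y0. w = [] \<or> hd w \<notin> range \<iota>}"

definition right_words ::
    "('u \<Rightarrow> 'x + 'y) \<Rightarrow> 'x::complex_vector set \<Rightarrow> 'y::complex_vector set \<Rightarrow> ('x + 'y) list set"
  where "right_words \<iota> X0 Y0 = {w \<in> free_words X0 Y0. w = [] \<or> last w \<notin> range \<iota>}"

definition left_tensor_space ::
    "('u \<Rightarrow> 'x + 'y) \<Rightarrow> 'x::complex_vector set \<Rightarrow> 'y::complex_vector set \<Rightarrow> ('x, 'y) word_tensor set"
  where "left_tensor_space \<iota> X0 Y0 = cspan {tensor (\<iota> u # w) | u w. w \<in> left_words \<iota> X0 Y0}"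

definition right_tensor_space ::
    "('u \<Rightarrow> 'x + 'y) \<Rightarrow> 'x::complex_vector set \<Rightarrow> 'y::complex_vector set \<Rightarrow> ('x, 'y) word_tensor set"
  where "right_tensor_space \<iota> X0 Y0 = cspan {tensor (w @ [\<iota> u]) | u w. w \<in> right_words \<iota> X0 Y0}"

text \<open>The maps \<open>V\<^sub>k\<close>, \<open>W\<^sub>k\<close>, \<open>T \<otimes> I\<close> and \<open>I \<otimes> T\<close> are given on elementary tensors and extended
  linearly; the choice concerns only their values outside of \<open>X\<^sub>k \<otimes> X(\<ell>,k)\<close> and \<open>X(r,k) \<otimes> X\<^sub>k\<close>.
  Treating \<open>\<xi>\<^sub>k\<close> as the empty tensor means
  \<open>V\<^sub>k (u \<otimes> w) = p(u) w + (u - p(u) \<xi>\<^sub>k) \<otimes> w\<close>.\<close>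

definition V_map ::
    "('u \<Rightarrow> 'x + 'y) \<Rightarrow> 'u::complex_vector set \<Rightarrow> 'u \<Rightarrow>
     ('x::complex_vector, 'y::complex_vector) word_tensor \<Rightarrow> ('x, 'y) word_tensor"
  where "V_map \<iota> U0 \<xi> = (SOME V. clinear V \<and> (\<forall>u w. V (tensor (\<iota> u # w)) =
    state_coeff U0 \<xi> u *\<^sub>C tensor w + tensor (\<iota> (u - state_coeff U0 \<xi> u *\<^sub>C \<xi>) # w)))"

definition W_map ::
    "('u \<Rightarrow> 'x + 'y) \<Rightarrow> 'u::complex_vector set \<Rightarrow> 'u \<Rightarrow>
     ('x::complex_vector, 'y::complex_vector) word_tensor \<Rightarrow> ('x, 'y) word_tensor"
  where "W_map \<iota> U0 \<xi> = (SOME W. clinear W \<and> (\<forall>u w. W (tensor (w @ [\<iota> u])) =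
    state_coeff U0 \<xi> u *\<^sub>C tensor w + tensor (w @ [\<iota> (u - state_coeff U0 \<xi> u *\<^sub>C \<xi>)])))"

definition tensor_op_left ::
    "('u \<Rightarrow> 'x + 'y) \<Rightarrow> ('u::complex_vector \<Rightarrow> 'u) \<Rightarrow>
     ('x::complex_vector, 'y::complex_vector) word_tensor \<Rightarrow> ('x, 'y) word_tensor"
  where "tensor_op_left \<iota> T =
    (SOME S. clinear S \<and> (\<forall>u w. S (tensor (\<iota> u # w)) = tensor (\<iota> (T u) # w)))"

definition tensor_op_right ::
    "('u \<Rightarrow> 'x + 'y) \<Rightarrow> ('u::complex_vector \<Rightarrow> 'u) \<Rightarrow>
     ('x::complex_vector, 'y::complex_vector) word_tensor \<Rightarrow> ('x, 'y) word_tensor"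
  where "tensor_op_right \<iota> T =
    (SOME S. clinear S \<and> (\<forall>u w. S (tensor (w @ [\<iota> u])) = tensor (w @ [\<iota> (T u)])))"

text \<open>\<open>\<lambda>\<^sub>k(T) = V\<^sub>k (T \<otimes> I) V\<^sub>k\<inverse>\<close> and \<open>\<rho>\<^sub>k(T) = W\<^sub>k (I \<otimes> T) W\<^sub>k\<inverse>\<close>; only their restrictions to
  \<^term>\<open>free_product X0 Y0\<close> are meaningful.\<close>

definition left_op ::
    "('u \<Rightarrow> 'x + 'y) \<Rightarrow> 'x::complex_vector set \<Rightarrow> 'y::complex_vector set \<Rightarrow>
     'u::complex_vector set \<Rightarrow> 'u \<Rightarrow> ('u \<Rightarrow> 'u) \<Rightarrow> ('x, 'y) word_tensor \<Rightarrow> ('x, 'y) word_tensor"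
  where "left_op \<iota> X0 Y0 U0 \<xi> T =
    V_map \<iota> U0 \<xi> \<circ> tensor_op_left \<iota> T \<circ> inv_into (left_tensor_space \<iota> X0 Y0) (V_map \<iota> U0 \<xi>)"

definition right_op ::
    "('u \<Rightarrow> 'x + 'y) \<Rightarrow> 'x::complex_vector set \<Rightarrow> 'y::complex_vector set \<Rightarrow>
     'u::complex_vector set \<Rightarrow> 'u \<Rightarrow> ('u \<Rightarrow> 'u) \<Rightarrow> ('x, 'y) word_tensor \<Rightarrow> ('x, 'y) word_tensor"
  where "right_op \<iota> X0 Y0 U0 \<xi> T =
    W_map \<iota> U0 \<xi> \<circ> tensor_op_right \<iota> T \<circ> inv_into (right_tensor_space \<iota> X0 Y0) (W_map \<iota> U0 \<xi>)"

section \<open>Bi-freeness\<close>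

text \<open>A formula cannot quantify over the vector spaces \<open>X\<^sub>1\<close> and \<open>X\<^sub>2\<close>, so their types are parameters.
  Bi-freeness means \<open>bi_free TYPE('x) TYPE('y) \<phi> a\<^sub>1 b\<^sub>1 a\<^sub>2 b\<^sub>2\<close> for some types \<open>'x\<close>, \<open>'y\<close>;
  in a premise, free type variables \<open>'x\<close>, \<open>'y\<close> express exactly this.\<close>

definition bi_free ::
    "'x::complex_vector itself \<Rightarrow> 'y::complex_vector itself \<Rightarrow>
     ('a::complex_banach_algebra \<Rightarrow> complex) \<Rightarrow> 'a \<Rightarrow> 'a \<Rightarrow> 'a \<Rightarrow> 'a \<Rightarrow> bool"
  where "bi_free _ _ \<phi> a1 b1 a2 b2 \<longleftrightarrow>
    (\<exists>(X0 :: 'x set) \<xi>1 L1 R1 (Y0 :: 'y set) \<xi>2 L2 R2.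
       state_space X0 \<xi>1 \<and> state_space Y0 \<xi>2 \<and>
       clinear L1 \<and> clinear R1 \<and> clinear L2 \<and> clinear R2 \<and>
       (\<forall>is. set is \<subseteq> {..<4} \<longrightarrow>
          \<phi> (prod_list (map ((!) [a1, b1, a2, b2]) is)) =
          free_state X0 Y0
            (foldr (\<circ>) (map ((!) [left_op Inl X0 Y0 X0 \<xi>1 L1, right_op Inl X0 Y0 X0 \<xi>1 R1,
                                   left_op Inr X0 Y0 Y0 \<xi>2 L2, right_op Inr X0 Y0 Y0 \<xi>2 R2]) is) id)))"

end

theory Submission
  imports Defs "HOL-Complex_Analysis.Complex_Analysis"
begin

text \<open>Let \<open>u\<^sub>k = (K\<^sub>k(z) - a\<^sub>k)\<inverse> / z\<close> and \<open>v\<^sub>k = (1 - \<X>\<^sub>k(w) b\<^sub>k)\<inverse> / (1 + w)\<close>; these have expectation 1, and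
  we write \<open>u\<^sub>k = 1 + x\<^sub>k\<close>, \<open>v\<^sub>k = 1 + y\<^sub>k\<close>, \<open>c = (w + 1) / w\<close>. With \<open>K = K\<^sub>1 + K\<^sub>2 - 1 / z\<close> and
  \<open>\<X> = c \<X>\<^sub>1 \<X>\<^sub>2\<close> one has
  \<open>(K - a\<^sub>1 - a\<^sub>2)\<inverse> = z u\<^sub>2 (1 - x\<^sub>1 x\<^sub>2)\<inverse> u\<^sub>1\<close> and
  \<open>(1 - \<X> b\<^sub>1 b\<^sub>2)\<inverse> = (1 + w) v\<^sub>2 (1 - c y\<^sub>1 y\<^sub>2)\<inverse> v\<^sub>1\<close>.
  Expanding the two geometric series gives all alternating words in the centred \<open>x\<^sub>k\<close> and in the
  centred \<open>y\<^sub>k\<close>. In the free product the right word builds up a tensor from the vacuum, and the left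
  word can only return to the vacuum by removing its letters one by one; hence the expectation of
  a left word times a right word vanishes unless both have the same indices, when it is the product
  of the \<open>p\<^sub>k = \<phi>(x\<^sub>k y\<^sub>k)\<close>. Thus \<open>K\<close> and \<open>\<X>\<close> belong to the sum and the product, and
  \<open>F = z (1 + w) (1 + p\<^sub>1) (1 + p\<^sub>2) / (1 - c p\<^sub>1 p\<^sub>2)\<close>, \<open>F\<^sub>k = z (1 + w) (1 + p\<^sub>k)\<close>, so
  \<open>T\<^sub>k = (1 + c p\<^sub>k) / (1 + p\<^sub>k)\<close> and \<open>T = T\<^sub>1 T\<^sub>2\<close>.\<close>

section \<open>Complex linear maps\<close>

text \<open>Bi-freeness speaks only of moments of words, whereas the transforms contain resolvents,
  and the free product carries no topology in which a resolvent could be expanded. So the moment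
  formula is proved for centred polynomials by means of operators and then carried to centred
  resolvents by norm limits in the algebra. Left and right variables are not assumed to commute;
  only a left word followed by a right word is ever evaluated, which is the order of factors in
  \<open>F_transform\<close>. The outer factors \<open>1 + x_2\<close> and \<open>1 + x_1\<close>
  around the powers of \<open>x_1 x_2\<close> are exactly what makes every alternating word occur
  once. The constant c has a pole at w = 0, but \<open>y_1\<close> and \<open>y_2\<close> vanish
  there and \<open>y_1 / w\<close> stays bounded, so \<open>c y_1 y_2\<close> still tends to 0.
  Finally, \<open>K_transform\<close> and \<open>X_transform\<close> are chosen germs: the formulas
  for the sum and the product become equalities only through uniqueness of local inverses. The
  defining equations of these germs are the same moment series with all \<open>v_k = 1\<close> or
  all \<open>u_k = 1\<close>, where only one term survives.\<close>

lemma clinear_iff: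
  "clinear f \<longleftrightarrow> (\<forall>x y. f (x + y) = f x + f y) \<and> (\<forall>c x. f (c *\<^sub>C x) = c *\<^sub>C f x)"
  unfolding Vector_Spaces.linear_def module_hom_def module_hom_axioms_def
  by (simp add: complex_vector.vector_space_axioms complex_vector.module_axioms)

lemma clinear_add: "clinear f \<Longrightarrow> f (x + y) = f x + f y"
  and clinear_scaleC: "clinear f \<Longrightarrow> f (c *\<^sub>C x) = c *\<^sub>C f x"
  by (simp_all add: clinear_iff)

lemma clinear_zero: "clinear f \<Longrightarrow> f 0 = 0"
  using clinear_add[of f 0 0] by simp

lemma clinear_diff: "clinear f \<Longrightarrow> f (x - y) = f x - f y"
  using clinear_add[of f "x - y" y] by (simp add: algebra_simps)

lemma clinear_sum: "clinear f \<Longrightarrow> f (sum g A) = (\<Sum>i\<in>A. f (g i))"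
  by (induction A rule: infinite_finite_induct) (auto simp: clinear_zero clinear_add)

lemma clinear_compose: "clinear f \<Longrightarrow> clinear g \<Longrightarrow> clinear (\<lambda>x. f (g x))"
  by (simp add: clinear_iff)

lemma clinear_eq_on_cspan:
  assumes "clinear f" "clinear g" "\<And>x. x \<in> B \<Longrightarrow> f x = g x" "x \<in> cspan B"
  shows "f x = g x"
  using assms(4)
  by (induction rule: complex_vector.span_induct_alt)
     (simp_all add: clinear_zero clinear_add clinear_scaleC assms(1,2,3))

lemma clinear_image_cspan:
  assumes "clinear f" "\<And>x. x \<in> B \<Longrightarrow> f x \<in> cspan C" "x \<in> cspan B"
  shows "f x \<in> cspan C"
  using assms(3)
  by (induction rule: complex_vector.span_induct_alt)
     (simp_all add: clinear_zero clinear_add clinear_scaleC assms(1,2)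
       complex_vector.span_zero complex_vector.span_add complex_vector.span_scale)

section \<open>Linear maps on word tensors\<close>

definition letter_linear ::
    "('x::complex_vector + 'y::complex_vector \<Rightarrow> 'v::complex_vector) \<Rightarrow> bool"
  where "letter_linear g \<longleftrightarrow> clinear (\<lambda>x. g (Inl x)) \<and> clinear (\<lambda>y. g (Inr y))"

definition word_multilinear ::
    "(('x::complex_vector + 'y::complex_vector) list \<Rightarrow> 'v::complex_vector) \<Rightarrow> bool"
  where "word_multilinear f \<longleftrightarrow> (\<forall>u v. letter_linear (\<lambda>l. f (u @ l # v)))"

lemma lookup_scaleC [simp]: "Poly_Mapping.lookup (c *\<^sub>C p) k = c *\<^sub>C Poly_Mapping.lookup p k"
  by transfer simp

lemma clinear_poly_mapping_extension:
  fixes f :: "'k \<Rightarrow> 'v::complex_vector"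
  shows "\<exists>E. clinear E \<and> (\<forall>w. E (Poly_Mapping.single w (1::complex)) = f w)"
proof -
  define E where "E p = (\<Sum>w\<in>Poly_Mapping.keys p. Poly_Mapping.lookup p w *\<^sub>C f w)" for p :: "'k \<Rightarrow>\<^sub>0 complex"
  have E: "E p = (\<Sum>w\<in>S. Poly_Mapping.lookup p w *\<^sub>C f w)"
    if "finite S" "Poly_Mapping.keys p \<subseteq> S" for S p
    unfolding E_def using that
    by (intro sum.mono_neutral_left) (auto simp: in_keys_iff)
  have "E (p + q) = E p + E q" for p q
  proof -
    let ?S = "Poly_Mapping.keys p \<union> Poly_Mapping.keys q"
    have "Poly_Mapping.keys (p + q) \<subseteq> ?S" by (rule Poly_Mapping.keys_add)
    then show ?thesis
      by (simp add: E[of ?S] lookup_add scaleC_add_left sum.distrib)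
  qed
  moreover have "E (c *\<^sub>C p) = c *\<^sub>C E p" for c p
  proof -
    have "Poly_Mapping.keys (c *\<^sub>C p) \<subseteq> Poly_Mapping.keys p"
      by (auto simp: in_keys_iff scaleC_complex_def)
    then show ?thesis
      by (simp add: E[of "Poly_Mapping.keys p"] scaleC_complex_def
          complex_vector.scale_sum_right scaleC_scaleC)
  qed
  ultimately have "clinear E" by (simp add: clinear_iff)
  moreover have "E (Poly_Mapping.single w 1) = f w" for w
    by (simp add: E_def scaleC_one)
  ultimately show ?thesis by (intro exI conjI allI)
qed

lemma clinear_abs_word_tensor: "clinear abs_word_tensor"
  by (simp add: clinear_iff plus_word_tensor.abs_eq scaleC_word_tensor.abs_eq)

lemma word_multilinear_tensor:
  "word_multilinear (tensor :: ('x::complex_vector + 'y::complex_vector) list \<Rightarrow> _)"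
proof -
  let ?R = "multilinearity_relations :: (('x + 'y) list \<Rightarrow>\<^sub>0 complex) set"
  have in_span: "abs_word_tensor p = 0" if "p \<in> ?R" for p
    using that complex_vector.span_base[of p ?R]
    unfolding zero_word_tensor_def by (simp add: word_tensor.abs_eq_iff tensor_eq_def)
  have 1: "abs_word_tensor (Poly_Mapping.single (u @ Inl (x + x') # v) 1
      - Poly_Mapping.single (u @ Inl x # v) 1 - Poly_Mapping.single (u @ Inl x' # v) 1) = (0 :: ('x, 'y) word_tensor)"
    for u v x x'
    by (rule in_span, unfold multilinearity_relations_def, rule UnI1, rule UnI1, rule UnI1)
       (intro CollectI exI conjI, rule refl, rule TrueI)
  have 2: "abs_word_tensor (Poly_Mapping.single (u @ Inl (c *\<^sub>C x) # v) 1
      - c *\<^sub>C Poly_Mapping.single (u @ Inl x # v) 1) = (0 :: ('x, 'y) word_tensor)" for u v x c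
    by (rule in_span, unfold multilinearity_relations_def, rule UnI1, rule UnI1, rule UnI2)
       (intro CollectI exI conjI, rule refl, rule TrueI)
  have 3: "abs_word_tensor (Poly_Mapping.single (u @ Inr (y + y') # v) 1
      - Poly_Mapping.single (u @ Inr y # v) 1 - Poly_Mapping.single (u @ Inr y' # v) 1) = (0 :: ('x, 'y) word_tensor)"
    for u v y y'
    by (rule in_span, unfold multilinearity_relations_def, rule UnI1, rule UnI2)
       (intro CollectI exI conjI, rule refl, rule TrueI)
  have 4: "abs_word_tensor (Poly_Mapping.single (u @ Inr (c *\<^sub>C y) # v) 1
      - c *\<^sub>C Poly_Mapping.single (u @ Inr y # v) 1) = (0 :: ('x, 'y) word_tensor)" for u v y c
    by (rule in_span, unfold multilinearity_relations_def, rule UnI2)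
       (intro CollectI exI conjI, rule refl, rule TrueI)
  \<comment> \<open>Moving the subtracted terms to the other side turns the relations into
    additivity and homogeneity in one slot.\<close>
  note rels = 1 2 3 4
  show ?thesis
    unfolding word_multilinear_def letter_linear_def clinear_iff tensor.abs_eq
    using rels[unfolded clinear_diff[OF clinear_abs_word_tensor]
        clinear_scaleC[OF clinear_abs_word_tensor] diff_diff_eq, unfolded right_minus_eq clinear_add[OF clinear_abs_word_tensor]]
    by blast
qed

text \<open>Universal property of the word tensors: the linear extension of \<open>f\<close> to the
  free vector space kills the multilinearity relations and so descends to the quotient. The
  existence of all linear maps chosen below rests on it.\<close>

lemma tensor_extension:
  fixes f :: "('x::complex_vector + 'y::complex_vector) list \<Rightarrow> 'v::complex_vector"
  assumes "word_multilinear f"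
  obtains F where "clinear F" "\<And>w. F (tensor w) = f w"
proof -
  obtain E where E: "clinear E" and E_single: "\<And>w. E (Poly_Mapping.single w (1::complex)) = f w"
    using clinear_poly_mapping_extension[of f] by blast
  have f: "f (u @ Inl (x + x') # v) = f (u @ Inl x # v) + f (u @ Inl x' # v)"
      "f (u @ Inl (c *\<^sub>C x) # v) = c *\<^sub>C f (u @ Inl x # v)"
      "f (u @ Inr (y + y') # v) = f (u @ Inr y # v) + f (u @ Inr y' # v)"
      "f (u @ Inr (c *\<^sub>C y) # v) = c *\<^sub>C f (u @ Inr y # v)" for u v x x' y y' c
    using assms unfolding word_multilinear_def letter_linear_def clinear_iff by blast+
  have rel: "E p = 0" if "p \<in> multilinearity_relations" for p
    using that unfolding multilinearity_relations_def Un_iff mem_Collect_eq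
    by (elim disjE exE conjE) (simp_all only: clinear_diff[OF E] clinear_scaleC[OF E] E_single f, simp_all)
  have "E p = 0" if "p \<in> cspan multilinearity_relations" for p
    using that
    by (induction rule: complex_vector.span_induct_alt)
       (simp_all add: clinear_zero[OF E] clinear_add[OF E] clinear_scaleC[OF E] rel)
  then have E_cong: "E p = E q" if "tensor_eq p q" for p q
    using that clinear_diff[OF E, of p q] by (simp add: tensor_eq_def)
  define F where "F t = E (rep_word_tensor t)" for t
  have F_abs: "F (abs_word_tensor p) = E p" for p
    unfolding F_def
    by (rule E_cong) (rule Quotient3_rep_abs[OF Quotient3_word_tensor], rule equivp_reflp[OF equivp_tensor_eq])
  have ex: "\<exists>p. t = abs_word_tensor p" for t :: "('x, 'y) word_tensor"
    by (metis Quotient3_abs_rep Quotient3_word_tensor)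
  have "clinear F"
    unfolding clinear_iff
  proof (intro conjI allI)
    fix s t :: "('x, 'y) word_tensor" and c
    obtain p q where "s = abs_word_tensor p" "t = abs_word_tensor q" using ex by metis
    then show "F (s + t) = F s + F t" "F (c *\<^sub>C s) = c *\<^sub>C F s"
      by (simp_all add: plus_word_tensor.abs_eq scaleC_word_tensor.abs_eq F_abs
          clinear_add[OF E] clinear_scaleC[OF E])
  qed
  moreover have "F (tensor w) = f w" for w
    by (simp add: tensor.abs_eq F_abs E_single)
  ultimately show thesis by (rule that)
qed

text \<open>Every slot is the first one or lies in the tail. With the mirror image below, this
  permits definitions by cases on the letter at one end.\<close>

lemma word_multilinear_Cons:
  assumes "\<And>w. letter_linear (\<lambda>l. f (l # w))" "\<And>l. word_multilinear (\<lambda>w. f (l # w))"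
  shows "word_multilinear f"
  unfolding word_multilinear_def
proof (intro allI)
  fix u v
  show "letter_linear (\<lambda>l. f (u @ l # v))"
    using assms by (cases u) (auto simp: word_multilinear_def)
qed

lemma word_multilinear_snoc:
  assumes "\<And>w. letter_linear (\<lambda>l. f (w @ [l]))" "\<And>l. word_multilinear (\<lambda>w. f (w @ [l]))"
  shows "word_multilinear f"
  unfolding word_multilinear_def
proof (intro allI)
  fix u v
  show "letter_linear (\<lambda>l. f (u @ l # v))"
    using assms by (cases v rule: rev_cases) (auto simp: word_multilinear_def)
qed

section \<open>State vectors\<close>

lemma state_space_decomposition:
  assumes "state_space U0 \<xi>"
  shows "\<exists>!c. x - c *\<^sub>C \<xi> \<in> U0"
proof (rule ex_ex1I)
  obtain u v where "u \<in> cspan {\<xi>}" "v \<in> U0" "x = u + v"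
    using assms unfolding state_space_def by meson
  moreover from this obtain c where "u = c *\<^sub>C \<xi>"
    by (auto simp: complex_vector.span_singleton)
  ultimately have "x - c *\<^sub>C \<xi> \<in> U0" by simp
  then show "\<exists>c. x - c *\<^sub>C \<xi> \<in> U0" ..
next
  fix c d assume "x - c *\<^sub>C \<xi> \<in> U0" "x - d *\<^sub>C \<xi> \<in> U0"
  then have "(x - c *\<^sub>C \<xi>) - (x - d *\<^sub>C \<xi>) \<in> U0"
    using assms complex_vector.subspace_diff unfolding state_space_def by blast
  then have "(d - c) *\<^sub>C \<xi> \<in> U0"
    by (simp add: complex_vector.scale_left_diff_distrib)
  moreover have "(d - c) *\<^sub>C \<xi> \<in> cspan {\<xi>}"
    by (simp add: complex_vector.span_base complex_vector.span_scale)
  ultimately have "(d - c) *\<^sub>C \<xi> \<in> cspan {\<xi>} \<inter> U0" by (rule IntI[rotated])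
  then have "(d - c) *\<^sub>C \<xi> = 0" "\<xi> \<noteq> 0"
    using assms unfolding state_space_def by simp_all
  then show "c = d" by simp
qed

lemma state_coeff_eqI:
  "state_space U0 \<xi> \<Longrightarrow> x - c *\<^sub>C \<xi> \<in> U0 \<Longrightarrow> state_coeff U0 \<xi> x = c"
  unfolding state_coeff_def by (rule the1_equality[OF state_space_decomposition])

lemma diff_state_coeff: "state_space U0 \<xi> \<Longrightarrow> x - state_coeff U0 \<xi> x *\<^sub>C \<xi> \<in> U0"
  unfolding state_coeff_def by (rule theI'[OF state_space_decomposition])

lemma state_coeff_0: "state_space U0 \<xi> \<Longrightarrow> x \<in> U0 \<Longrightarrow> state_coeff U0 \<xi> x = 0"
  by (rule state_coeff_eqI) simp_all

lemma state_coeff_state: "state_space U0 \<xi> \<Longrightarrow> state_coeff U0 \<xi> \<xi> = 1"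
  by (rule state_coeff_eqI) (simp_all add: state_space_def complex_vector.subspace_0 scaleC_one)

lemma clinear_state_coeff:
  assumes U: "state_space U0 \<xi>"
  shows "clinear (state_coeff U0 \<xi>)"
  unfolding clinear_iff
proof (intro conjI allI)
  have sub: "csubspace U0" using U by (simp add: state_space_def)
  fix x y and c
  show "state_coeff U0 \<xi> (x + y) = state_coeff U0 \<xi> x + state_coeff U0 \<xi> y"
    using complex_vector.subspace_add[OF sub diff_state_coeff[OF U, of x] diff_state_coeff[OF U, of y]]
    by (intro state_coeff_eqI[OF U]) (simp add: scaleC_add_left algebra_simps)
  show "state_coeff U0 \<xi> (c *\<^sub>C x) = c *\<^sub>C state_coeff U0 \<xi> x"
    using complex_vector.subspace_scale[OF sub diff_state_coeff[OF U, of x], of c]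
    by (intro state_coeff_eqI[OF U])
       (simp add: scaleC_complex_def complex_vector.scale_right_diff_distrib scaleC_scaleC)
qed

section \<open>Left and right operators\<close>

text \<open>Left and right operators for both factors are treated at once: \<open>ins\<close> adds a letter at the
  end of a word on which the operator acts (the front for left operators), \<open>endl\<close> and \<open>rest\<close>
  are the letter at this end and the remaining word, and \<open>side\<close> tells which of \<^const>\<open>Inl\<close> and \<^const>\<open>Inr\<close>
  the embedding \<open>\<iota>\<close> is.\<close>

locale factor =
  fixes \<iota> :: "'u::complex_vector \<Rightarrow> 'x::complex_vector + 'y::complex_vector" and side :: bool
    and X0 :: "'x set" and Y0 :: "'y set" and U0 :: "'u set" and \<xi> :: 'u
    and ins :: "'x + 'y \<Rightarrow> ('x + 'y) list \<Rightarrow> ('x + 'y) list"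
    and endl :: "('x + 'y) list \<Rightarrow> 'x + 'y" and rest :: "('x + 'y) list \<Rightarrow> ('x + 'y) list"
  assumes state: "state_space U0 \<xi>"
    and inj_\<iota>: "inj \<iota>"
    and range_\<iota>: "l \<in> range \<iota> \<longleftrightarrow> isl l = side"
    and \<iota>_mem: "\<iota> u \<in> Inl ` X0 \<union> Inr ` Y0 \<longleftrightarrow> u \<in> U0"
    and clinear_\<iota>: "\<And>g :: 'x + 'y \<Rightarrow> ('x, 'y) word_tensor. letter_linear g \<Longrightarrow> clinear (\<lambda>u. g (\<iota> u))"
    and letter_linear_if: "\<And>(h :: 'u \<Rightarrow> ('x, 'y) word_tensor) k. clinear h \<Longrightarrow> letter_linear k \<Longrightarrow>
      letter_linear (\<lambda>l. if isl l = side then h (inv \<iota> l) else k l)"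
    and ins_neq [simp]: "ins l w \<noteq> []" and endl_ins [simp]: "endl (ins l w) = l"
    and rest_ins [simp]: "rest (ins l w) = w"
    and ins_endl_rest: "w \<noteq> [] \<Longrightarrow> ins (endl w) (rest w) = w"
    and ins_free_words: "ins l w \<in> free_words X0 Y0 \<longleftrightarrow> w \<in> free_words X0 Y0 \<and>
      l \<in> Inl ` X0 \<union> Inr ` Y0 \<and> (w = [] \<or> isl (endl w) \<noteq> isl l)"
    and word_multilinear_insI: "\<And>f :: ('x + 'y) list \<Rightarrow> ('x, 'y) word_tensor. 
      (\<And>w. letter_linear (\<lambda>l. f (ins l w))) \<Longrightarrow>
      (\<And>l. word_multilinear (\<lambda>w. f (ins l w))) \<Longrightarrow> word_multilinear f"
    and letter_linear_ins: "\<And>f :: ('x + 'y) list \<Rightarrow> ('x, 'y) word_tensor. 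
      word_multilinear f \<Longrightarrow> letter_linear (\<lambda>l. f (ins l w))"
    and word_multilinear_ins: "\<And>f :: ('x + 'y) list \<Rightarrow> ('x, 'y) word_tensor. 
      word_multilinear f \<Longrightarrow> word_multilinear (\<lambda>w. f (ins l w))"
begin

abbreviation p :: "'u \<Rightarrow> complex" where "p \<equiv> state_coeff U0 \<xi>"
abbreviation cen :: "'u \<Rightarrow> 'u" where "cen u \<equiv> u - p u *\<^sub>C \<xi>"
abbreviation FP :: "('x, 'y) word_tensor set" where "FP \<equiv> free_product X0 Y0"

definition fac_words :: "('x + 'y) list set"
  where "fac_words = {w \<in> free_words X0 Y0. w = [] \<or> endl w \<notin> range \<iota>}"

definition fac_space :: "('x, 'y) word_tensor set"
  where "fac_space = cspan {tensor (ins (\<iota> u) w) | u w. w \<in> fac_words}"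

definition fac_V :: "('x, 'y) word_tensor \<Rightarrow> ('x, 'y) word_tensor"
  where "fac_V = (SOME V. clinear V \<and> (\<forall>u w. V (tensor (ins (\<iota> u) w)) =
    p u *\<^sub>C tensor w + tensor (ins (\<iota> (cen u)) w)))"

definition fac_S :: "('u \<Rightarrow> 'u) \<Rightarrow> ('x, 'y) word_tensor \<Rightarrow> ('x, 'y) word_tensor"
  where "fac_S T = (SOME S. clinear S \<and> (\<forall>u w. S (tensor (ins (\<iota> u) w)) = tensor (ins (\<iota> (T u)) w)))"

definition fac_op :: "('u \<Rightarrow> 'u) \<Rightarrow> ('x, 'y) word_tensor \<Rightarrow> ('x, 'y) word_tensor"
  where "fac_op T = fac_V \<circ> fac_S T \<circ> inv_into fac_space fac_V"

lemma isl_\<iota> [simp]: "isl (\<iota> u) = side"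
  using range_\<iota> by blast

lemma inv_\<iota> [simp]: "inv \<iota> (\<iota> u) = u"
  by (simp add: inj_\<iota>)

lemma clinear_ins_\<iota>: "clinear (\<lambda>u. tensor (ins (\<iota> u) w))"
  by (rule clinear_\<iota>[OF letter_linear_ins[OF word_multilinear_tensor]])

lemma clinear_p: "clinear p"
  by (rule clinear_state_coeff[OF state])

text \<open>Words whose end letters belong to different factors, and the empty word, lie in
  different direct summands, so the values on the three kinds can be prescribed
  independently.\<close>

lemma tensor_extension_ins:
  fixes h :: "'u \<Rightarrow> ('x + 'y) list \<Rightarrow> ('x, 'y) word_tensor"
  assumes "\<And>w. clinear (\<lambda>u. h u w)" "\<And>u. word_multilinear (h u)"
    and "\<And>w. letter_linear (\<lambda>l. k l w)" "\<And>l. word_multilinear (k l)"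
  obtains F where "clinear F" "\<And>u w. F (tensor (ins (\<iota> u) w)) = h u w"
    "\<And>l w. isl l \<noteq> side \<Longrightarrow> F (tensor (ins l w)) = k l w" "F (tensor []) = t"
proof -
  define f where "f v = (if v = [] then t else if isl (endl v) = side
    then h (inv \<iota> (endl v)) (rest v) else k (endl v) (rest v))" for v
  have "word_multilinear f"
  proof (rule word_multilinear_insI)
    fix w
    have "(\<lambda>l. f (ins l w)) = (\<lambda>l. if isl l = side then h (inv \<iota> l) w else k l w)"
      by (simp add: f_def fun_eq_iff)
    then show "letter_linear (\<lambda>l. f (ins l w))"
      using letter_linear_if[OF assms(1) assms(3)] by simp
  next
    show "word_multilinear (\<lambda>w. f (ins l w))" for l
      by (cases "isl l = side") (simp_all add: f_def assms)
  qed
  then obtain F where "clinear F" "\<And>w. F (tensor w) = f w"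
    using tensor_extension[of f] by blast
  then show thesis
    by (intro that[of F]) (auto simp: f_def)
qed

lemma word_multilinear_add:
  "word_multilinear f \<Longrightarrow> word_multilinear g \<Longrightarrow> word_multilinear (\<lambda>w. f w + g w)"
  by (simp add: word_multilinear_def letter_linear_def clinear_iff scaleC_add_right algebra_simps)

lemma word_multilinear_scaleC:
  "word_multilinear f \<Longrightarrow> word_multilinear (\<lambda>w. c *\<^sub>C f w)"
  by (simp add: word_multilinear_def letter_linear_def clinear_iff scaleC_add_right scaleC_scaleC
     mult.commute)

lemma letter_linear_0: "letter_linear (\<lambda>l. 0)" and word_multilinear_0: "word_multilinear (\<lambda>w. 0)"
  by (simp_all add: word_multilinear_def letter_linear_def clinear_iff)

lemma fac_V: "clinear fac_V"
    "fac_V (tensor (ins (\<iota> u) w)) = p u *\<^sub>C tensor w + tensor (ins (\<iota> (cen u)) w)"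
proof -
  let ?h = "\<lambda>u w. p u *\<^sub>C tensor w + tensor (ins (\<iota> (cen u)) w)"
  have "clinear (\<lambda>u. ?h u w)" for w
    using clinear_p clinear_ins_\<iota>[of w] unfolding clinear_iff
    by (auto simp: scaleC_add_left scaleC_scaleC scaleC_complex_def
        clinear_diff[OF clinear_ins_\<iota>[of w]] algebra_simps scaleC_add_right
        complex_vector.scale_right_diff_distrib)
  moreover have "word_multilinear (?h u)" for u
    by (intro word_multilinear_add word_multilinear_scaleC word_multilinear_ins word_multilinear_tensor)
  \<comment> \<open>The specification of V is silent about words with a letter of the other factor
    at the end; they are sent to 0.\<close>
  ultimately obtain F where "clinear F" "\<And>u w. F (tensor (ins (\<iota> u) w)) = ?h u w"
    by (rule tensor_extension_ins[of ?h "\<lambda>_ _. 0"]) (simp_all add: letter_linear_0 word_multilinear_0)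
  then have "\<exists>V. clinear V \<and> (\<forall>u w. V (tensor (ins (\<iota> u) w)) = ?h u w)" by blast
  from someI_ex[OF this, folded fac_V_def]
  show "clinear fac_V" "fac_V (tensor (ins (\<iota> u) w)) = ?h u w" by simp_all
qed

lemma fac_S:
  assumes "clinear T"
  shows "clinear (fac_S T)" "fac_S T (tensor (ins (\<iota> u) w)) = tensor (ins (\<iota> (T u)) w)"
proof -
  let ?h = "\<lambda>u w. tensor (ins (\<iota> (T u)) w)"
  have "clinear (\<lambda>u. ?h u w)" for w
    by (rule clinear_compose[OF clinear_ins_\<iota> assms])
  moreover have "word_multilinear (?h u)" for u
    by (intro word_multilinear_ins word_multilinear_tensor)
  ultimately obtain F where "clinear F" "\<And>u w. F (tensor (ins (\<iota> u) w)) = ?h u w"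
    by (rule tensor_extension_ins[of ?h "\<lambda>_ _. 0"]) (simp_all add: letter_linear_0 word_multilinear_0)
  then have "\<exists>S. clinear S \<and> (\<forall>u w. S (tensor (ins (\<iota> u) w)) = ?h u w)" by blast
  from someI_ex[OF this, folded fac_S_def]
  show "clinear (fac_S T)" "fac_S T (tensor (ins (\<iota> u) w)) = ?h u w" by simp_all
qed

text \<open>The combinatorial form of the isomorphism \<open>V_k\<close>: the two cases are the
  images of \<open>\<xi> \<otimes> v\<close> and of \<open>u \<otimes> w\<close> with centred
  \<open>u\<close>.\<close>

lemma free_words_cases [consumes 1, case_names other same]:
  assumes "v \<in> free_words X0 Y0"
  obtains "v \<in> fac_words" | u w where "v = ins (\<iota> u) w" "u \<in> U0" "w \<in> fac_words"
proof (cases "v \<in> fac_words")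
  case False
  then have v: "v \<noteq> []" "endl v \<in> range \<iota>" using assms by (auto simp: fac_words_def)
  then obtain u where u: "endl v = \<iota> u" by blast
  then have *: "v = ins (\<iota> u) (rest v)" using ins_endl_rest[OF v(1)] by simp
  with assms have "ins (\<iota> u) (rest v) \<in> free_words X0 Y0" by simp
  then have "u \<in> U0" "rest v \<in> fac_words"
    unfolding ins_free_words \<iota>_mem by (auto simp: fac_words_def range_\<iota>)
  with * show thesis using that(2) by blast
qed (use that in blast)

lemma fac_words_ins: "w \<in> fac_words \<Longrightarrow> u \<in> U0 \<Longrightarrow> ins (\<iota> u) w \<in> free_words X0 Y0"
  using \<iota>_mem[of u] by (auto simp: fac_words_def ins_free_words range_\<iota>)

lemma fac_words_free: "w \<in> fac_words \<Longrightarrow> w \<in> free_words X0 Y0"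
  by (simp add: fac_words_def)

lemma tensor_FP: "w \<in> free_words X0 Y0 \<Longrightarrow> tensor w \<in> FP"
  by (simp add: free_product_def complex_vector.span_base)

text \<open>The inverse of \<open>V\<close> inserts \<open>\<xi>\<close> into the words that do not have a letter of \<open>X\<^sub>k\<close> at the end.\<close>

definition fac_inv :: "('x, 'y) word_tensor \<Rightarrow> ('x, 'y) word_tensor"
  where "fac_inv = (SOME V'. clinear V' \<and>
    (\<forall>u w. V' (tensor (ins (\<iota> u) w)) = tensor (ins (\<iota> u) w)) \<and>
    (\<forall>l w. isl l \<noteq> side \<longrightarrow> V' (tensor (ins l w)) = tensor (ins (\<iota> \<xi>) (ins l w))) \<and>
    V' (tensor []) = tensor (ins (\<iota> \<xi>) []))"

lemma fac_inv: "clinear fac_inv" "fac_inv (tensor (ins (\<iota> u) w)) = tensor (ins (\<iota> u) w)"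
    "w \<in> fac_words \<Longrightarrow> fac_inv (tensor w) = tensor (ins (\<iota> \<xi>) w)"
proof -
  obtain V' where "clinear V'" "\<And>u w. V' (tensor (ins (\<iota> u) w)) = tensor (ins (\<iota> u) w)"
    "\<And>l w. isl l \<noteq> side \<Longrightarrow> V' (tensor (ins l w)) = tensor (ins (\<iota> \<xi>) (ins l w))"
    "V' (tensor []) = tensor (ins (\<iota> \<xi>) [])"
  proof (rule tensor_extension_ins[of "\<lambda>u w. tensor (ins (\<iota> u) w)"
        "\<lambda>l w. tensor (ins (\<iota> \<xi>) (ins l w))" "tensor (ins (\<iota> \<xi>) [])"])
    show "clinear (\<lambda>u. tensor (ins (\<iota> u) w))" for w by (rule clinear_ins_\<iota>)
    show "word_multilinear (\<lambda>w. tensor (ins (\<iota> u) w))" for u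
      by (intro word_multilinear_ins word_multilinear_tensor)
    show "letter_linear (\<lambda>l. tensor (ins (\<iota> \<xi>) (ins l w)))" for w
      by (rule letter_linear_ins[OF word_multilinear_ins[OF word_multilinear_tensor]])
    show "word_multilinear (\<lambda>w. tensor (ins (\<iota> \<xi>) (ins l w)))" for l
      by (rule word_multilinear_ins[OF word_multilinear_ins[OF word_multilinear_tensor]])
  qed blast
  then have "\<exists>V'. clinear V' \<and>
    (\<forall>u w. V' (tensor (ins (\<iota> u) w)) = tensor (ins (\<iota> u) w)) \<and>
    (\<forall>l w. isl l \<noteq> side \<longrightarrow> V' (tensor (ins l w)) = tensor (ins (\<iota> \<xi>) (ins l w))) \<and>
    V' (tensor []) = tensor (ins (\<iota> \<xi>) [])" by blast
  from someI_ex[OF this, folded fac_inv_def]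
  have lin: "clinear fac_inv" and same: "\<And>u w. fac_inv (tensor (ins (\<iota> u) w)) = tensor (ins (\<iota> u) w)"
    and other: "\<And>l w. isl l \<noteq> side \<Longrightarrow> fac_inv (tensor (ins l w)) = tensor (ins (\<iota> \<xi>) (ins l w))"
    and nil: "fac_inv (tensor []) = tensor (ins (\<iota> \<xi>) [])"
    by simp_all
  show "clinear fac_inv" "fac_inv (tensor (ins (\<iota> u) w)) = tensor (ins (\<iota> u) w)"
    by (fact lin same)+
  show "fac_inv (tensor w) = tensor (ins (\<iota> \<xi>) w)" if "w \<in> fac_words"
  proof (cases "w = []")
    case False
    then have "isl (endl w) \<noteq> side" using that by (simp add: fac_words_def range_\<iota>)
    then show ?thesis using other[of "endl w" "rest w"] ins_endl_rest[OF False] by simp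
  qed (simp add: nil)
qed

lemma clinear_ident: "clinear (\<lambda>v :: 'v::complex_vector. v)"
  by (simp add: clinear_iff)

lemma fac_space_base: "w \<in> fac_words \<Longrightarrow> tensor (ins (\<iota> u) w) \<in> fac_space"
  unfolding fac_space_def by (intro complex_vector.span_base) blast

lemma fac_inv_space:
  assumes "v \<in> FP"
  shows "fac_inv v \<in> fac_space"
  using fac_inv(1) _ assms unfolding free_product_def fac_space_def
proof (rule clinear_image_cspan[of fac_inv])
  fix x assume "x \<in> tensor ` free_words X0 Y0"
  then obtain w where w: "w \<in> free_words X0 Y0" "x = tensor w" by blast
  from w(1) have "fac_inv x \<in> fac_space"
    by (cases rule: free_words_cases) (simp_all add: w(2) fac_inv fac_space_base)
  then show "fac_inv x \<in> cspan {tensor (ins (\<iota> u) w) |u w. w \<in> fac_words}"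
    by (simp add: fac_space_def)
qed

text \<open>An inserted \<open>\<xi>\<close> is absorbed again, since \<open>p \<xi> = 1\<close> and
  its centred part is 0; a letter from \<open>U0\<close> is left alone, since \<open>p\<close>
  vanishes on it.\<close>

lemma fac_V_inv:
  assumes "v \<in> FP"
  shows "fac_V (fac_inv v) = v"
proof (rule clinear_eq_on_cspan[of "\<lambda>v. fac_V (fac_inv v)" "\<lambda>v. v"])
  show "clinear (\<lambda>v. fac_V (fac_inv v))" by (rule clinear_compose[OF fac_V(1) fac_inv(1)])
  show "v \<in> cspan (tensor ` free_words X0 Y0)" using assms by (simp add: free_product_def)
  fix x assume "x \<in> tensor ` free_words X0 Y0"
  then obtain w where w: "w \<in> free_words X0 Y0" "x = tensor w" by blast
  from w(1) show "fac_V (fac_inv x) = x"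
    by (cases rule: free_words_cases)
       (simp_all add: w(2) fac_inv fac_V(2) state_coeff_state[OF state] state_coeff_0[OF state]
          scaleC_one clinear_zero[OF clinear_ins_\<iota>])
qed (rule clinear_ident)

text \<open>V splits the end letter \<open>u\<close> into \<open>p u\<close> times the shorter word
  and the centred part; inserting \<open>\<xi>\<close> into the shorter word lets the two parts
  recombine to \<open>u\<close>.\<close>

lemma fac_inv_V:
  assumes "v \<in> fac_space"
  shows "fac_inv (fac_V v) = v"
proof (rule clinear_eq_on_cspan[of "\<lambda>v. fac_inv (fac_V v)" "\<lambda>v. v"])
  show "clinear (\<lambda>v. fac_inv (fac_V v))" by (rule clinear_compose[OF fac_inv(1) fac_V(1)])
  show "v \<in> cspan {tensor (ins (\<iota> u) w) |u w. w \<in> fac_words}"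
    using assms by (simp add: fac_space_def)
  fix x assume "x \<in> {tensor (ins (\<iota> u) w) |u w. w \<in> fac_words}"
  then obtain u w where w: "w \<in> fac_words" "x = tensor (ins (\<iota> u) w)" by blast
  show "fac_inv (fac_V x) = x"
    unfolding w(2) fac_V(2) clinear_add[OF fac_inv(1)] clinear_scaleC[OF fac_inv(1)]
      fac_inv(2) fac_inv(3)[OF w(1)]
    by (simp add: clinear_diff[OF clinear_ins_\<iota>] clinear_scaleC[OF clinear_ins_\<iota>])
qed (rule clinear_ident)

lemma fac_V_FP: "v \<in> fac_space \<Longrightarrow> fac_V v \<in> FP"
  unfolding fac_space_def free_product_def
proof (rule clinear_image_cspan[OF fac_V(1)])
  fix x assume "x \<in> {tensor (ins (\<iota> u) w) |u w. w \<in> fac_words}"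
  then obtain u w where w: "w \<in> fac_words" "x = tensor (ins (\<iota> u) w)" by blast
  have "tensor w \<in> FP"
    by (rule tensor_FP[OF fac_words_free[OF w(1)]])
  moreover have "tensor (ins (\<iota> (cen u)) w) \<in> FP"
    by (rule tensor_FP[OF fac_words_ins[OF w(1) diff_state_coeff[OF state]]])
  ultimately show "fac_V x \<in> cspan (tensor ` free_words X0 Y0)"
    unfolding w(2) fac_V(2) free_product_def
    by (intro complex_vector.span_add complex_vector.span_scale)
qed

lemma fac_S_space:
  assumes "clinear T" "v \<in> fac_space"
  shows "fac_S T v \<in> fac_space"
  using fac_S(1)[OF assms(1)] _ assms(2) unfolding fac_space_def
proof (rule clinear_image_cspan[of "fac_S T"])
  fix x assume "x \<in> {tensor (ins (\<iota> u) w) |u w. w \<in> fac_words}"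
  then show "fac_S T x \<in> cspan {tensor (ins (\<iota> u) w) |u w. w \<in> fac_words}"
    using fac_space_base by (auto simp: fac_S(2)[OF assms(1)] fac_space_def)
qed

lemma clinear_eq_on_fac_space:
  assumes "clinear f" "clinear g" "\<And>u w. f (tensor (ins (\<iota> u) w)) = g (tensor (ins (\<iota> u) w))"
    "v \<in> fac_space"
  shows "f v = g v"
  by (rule clinear_eq_on_cspan[OF assms(1,2) _ assms(4)[unfolded fac_space_def]])
     (auto simp: assms(3))

text \<open>Replaces \<open>inv_into\<close> by a map that is linear on the whole type, so that
  linearity can be used freely.\<close>

lemma fac_op_eq:
  assumes "v \<in> FP"
  shows "fac_op T v = fac_V (fac_S T (fac_inv v))"
proof -
  have "inj_on fac_V fac_space"
    using fac_inv_V by (metis inj_onI)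
  then have "inv_into fac_space fac_V v = fac_inv v"
    using fac_V_inv[OF assms] fac_inv_space[OF assms] by (intro inv_into_f_eq) auto
  then show ?thesis by (simp add: fac_op_def)
qed

lemma fac_op_linear:
  assumes "clinear T"
  shows "v \<in> FP \<Longrightarrow> fac_op T v \<in> FP"
    "v \<in> FP \<Longrightarrow> v' \<in> FP \<Longrightarrow> fac_op T (v + v') = fac_op T v + fac_op T v'"
    "v \<in> FP \<Longrightarrow> fac_op T (c *\<^sub>C v) = c *\<^sub>C fac_op T v"
proof -
  note S = fac_S[OF assms]
  show "v \<in> FP \<Longrightarrow> fac_op T v \<in> FP"
    by (simp add: fac_op_eq fac_inv_space fac_inv_V fac_V_FP fac_S_space assms)
  show "v \<in> FP \<Longrightarrow> v' \<in> FP \<Longrightarrow> fac_op T (v + v') = fac_op T v + fac_op T v'"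
    by (simp add: fac_op_eq free_product_def complex_vector.span_add
        clinear_add[OF fac_inv(1)] clinear_add[OF S(1)] clinear_add[OF fac_V(1)])
  show "v \<in> FP \<Longrightarrow> fac_op T (c *\<^sub>C v) = c *\<^sub>C fac_op T v"
    by (simp add: fac_op_eq free_product_def complex_vector.span_scale
        clinear_scaleC[OF fac_inv(1)] clinear_scaleC[OF S(1)] clinear_scaleC[OF fac_V(1)])
qed

text \<open>The inner V and its inverse cancel. Together with the next three lemmas:
  \<open>fac_op\<close> is a unital algebra homomorphism on \<open>FP\<close>, so a polynomial in
  one variable is again given by a single operator on \<open>X_k\<close>.\<close>

lemma fac_op_compose:
  assumes "clinear T" "clinear T'" "v \<in> FP"
  shows "fac_op T (fac_op T' v) = fac_op (\<lambda>u. T (T' u)) v"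
proof -
  have "fac_S T (fac_S T' x) = fac_S (\<lambda>u. T (T' u)) x" if "x \<in> fac_space" for x
    by (rule clinear_eq_on_fac_space[OF clinear_compose[OF fac_S(1)[OF assms(1)] fac_S(1)[OF assms(2)]]
          fac_S(1)[OF clinear_compose[OF assms(1,2)]] _ that])
       (simp add: fac_S(2) assms fac_S(2)[OF clinear_compose[OF assms(1,2)]])
  then show ?thesis
    using assms by (simp add: fac_op_eq fac_inv_space fac_inv_V fac_V_FP fac_S_space)
qed

lemma fac_op_id: "v \<in> FP \<Longrightarrow> fac_op (\<lambda>u. u) v = v"
proof -
  assume v: "v \<in> FP"
  have "fac_S (\<lambda>u. u) x = x" if "x \<in> fac_space" for x
    by (rule clinear_eq_on_fac_space[OF fac_S(1)[OF clinear_ident] clinear_ident _ that])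
       (simp add: fac_S clinear_ident)
  then show ?thesis using v by (simp add: fac_op_eq fac_inv_space fac_V_inv)
qed

lemma fac_op_add:
  assumes "clinear T" "clinear T'" "v \<in> FP"
  shows "fac_op (\<lambda>u. T u + T' u) v = fac_op T v + fac_op T' v"
proof -
  have TT: "clinear (\<lambda>u. T u + T' u)"
    using assms by (simp add: clinear_iff scaleC_add_right algebra_simps)
  have "fac_S (\<lambda>u. T u + T' u) x = fac_S T x + fac_S T' x" if "x \<in> fac_space" for x
  proof (rule clinear_eq_on_fac_space[OF fac_S(1)[OF TT] _ _ that])
    show "clinear (\<lambda>x. fac_S T x + fac_S T' x)"
      using fac_S(1)[OF assms(1)] fac_S(1)[OF assms(2)]
      by (simp add: clinear_iff scaleC_add_right algebra_simps)
  qed (simp add: fac_S TT assms clinear_add[OF clinear_ins_\<iota>])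
  then show ?thesis
    using assms by (simp add: fac_op_eq fac_inv_space fac_V_inv clinear_add[OF fac_V(1)])
qed

lemma fac_op_scaleC:
  assumes "clinear T" "v \<in> FP"
  shows "fac_op (\<lambda>u. c *\<^sub>C T u) v = c *\<^sub>C fac_op T v"
proof -
  have TT: "clinear (\<lambda>u. c *\<^sub>C T u)"
    using assms by (simp add: clinear_iff scaleC_add_right scaleC_scaleC mult.commute)
  have "fac_S (\<lambda>u. c *\<^sub>C T u) x = c *\<^sub>C fac_S T x" if "x \<in> fac_space" for x
  proof (rule clinear_eq_on_fac_space[OF fac_S(1)[OF TT] _ _ that])
    show "clinear (\<lambda>x. c *\<^sub>C fac_S T x)"
      using fac_S(1)[OF assms(1)]
      by (simp add: clinear_iff scaleC_add_right scaleC_scaleC mult.commute)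
  qed (simp add: fac_S TT assms clinear_scaleC[OF clinear_ins_\<iota>])
  then show ?thesis
    using assms by (simp add: fac_op_eq fac_inv_space fac_V_inv clinear_scaleC[OF fac_V(1)])
qed

text \<open>The first summand removes the end letter, the second replaces it within the same factor.
  In \<open>fac_op_other\<close> the operator acts on an inserted \<open>\<xi>\<close>, and the
  second summand creates a letter.\<close>

lemma fac_op_same:
  assumes "clinear T" "ins (\<iota> u) w \<in> free_words X0 Y0"
  shows "fac_op T (tensor (ins (\<iota> u) w)) = p (T u) *\<^sub>C tensor w + tensor (ins (\<iota> (cen (T u))) w)"
  using assms by (simp add: fac_op_eq fac_inv tensor_FP fac_S(2) fac_V(2))

lemma fac_op_other:
  assumes "clinear T" "w \<in> fac_words"
  shows "fac_op T (tensor w) = p (T \<xi>) *\<^sub>C tensor w + tensor (ins (\<iota> (cen (T \<xi>))) w)"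
  using assms by (simp add: fac_op_eq fac_inv tensor_FP fac_words_free fac_S(2) fac_V(2))

end

section \<open>The four instances: left and right action of the two factors\<close>

lemma free_words_Cons: "l # w \<in> free_words X0 Y0 \<longleftrightarrow> w \<in> free_words X0 Y0 \<and>
      l \<in> Inl ` X0 \<union> Inr ` Y0 \<and> (w = [] \<or> isl (hd w) \<noteq> isl l)"
  by (cases w) (auto simp: free_words_def)

lemma free_words_snoc: "w @ [l] \<in> free_words X0 Y0 \<longleftrightarrow> w \<in> free_words X0 Y0 \<and>
      l \<in> Inl ` X0 \<union> Inr ` Y0 \<and> (w = [] \<or> isl (last w) \<noteq> isl l)"
  by (auto simp: free_words_def successively_append_iff)

lemma range_Inl: "l \<in> range Inl \<longleftrightarrow> isl l = True" and range_Inr: "l \<in> range Inr \<longleftrightarrow> isl l = False"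
  by (cases l; auto)+

lemma word_multilinearD: "word_multilinear f \<Longrightarrow> letter_linear (\<lambda>l. f (u @ l # v))"
  by (simp add: word_multilinear_def)

lemma word_multilinear_Cons': "word_multilinear f \<Longrightarrow> word_multilinear (\<lambda>w. f (l # w))"
  using word_multilinearD[of f "l # _"] by (simp add: word_multilinear_def[of "\<lambda>w. f (l # w)"])

lemma word_multilinear_snoc': "word_multilinear f \<Longrightarrow> word_multilinear (\<lambda>w. f (w @ [l]))"
  using word_multilinearD[of f _ "_ @ [l]"] by (simp add: word_multilinear_def[of "\<lambda>w. f (w @ [l])"])

lemma letter_linear_Cons: "word_multilinear f \<Longrightarrow> letter_linear (\<lambda>l. f (l # w))"
  using word_multilinearD[of f "[]"] by simp

lemma letter_linear_snoc: "word_multilinear f \<Longrightarrow> letter_linear (\<lambda>l. f (w @ [l]))"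
  using word_multilinearD[of f w "[]"] by simp

lemmas word_end_rules = free_words_Cons free_words_snoc range_Inl range_Inr

lemma factor_left_Inl: "state_space X0 \<xi> \<Longrightarrow> factor Inl True X0 Y0 X0 \<xi> (#) hd tl"
  by (rule factor.intro; (assumption | (simp add: letter_linear_def; fail) | (auto; fail) | rule word_end_rules |
      (rule word_multilinear_Cons; simp; fail) | (rule word_multilinear_snoc; simp; fail) |
      (erule word_multilinear_Cons') | (erule word_multilinear_snoc') |
      (erule letter_linear_Cons) | (erule letter_linear_snoc)))

lemma factor_left_Inr: "state_space Y0 \<xi> \<Longrightarrow> factor Inr False X0 Y0 Y0 \<xi> (#) hd tl"
  by (rule factor.intro; (assumption | (simp add: letter_linear_def; fail) | (auto; fail) | rule word_end_rules |
      (rule word_multilinear_Cons; simp; fail) | (rule word_multilinear_snoc; simp; fail) |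
      (erule word_multilinear_Cons') | (erule word_multilinear_snoc') |
      (erule letter_linear_Cons) | (erule letter_linear_snoc)))

lemma factor_right_Inl:
  "state_space X0 \<xi> \<Longrightarrow> factor Inl True X0 Y0 X0 \<xi> (\<lambda>l w. w @ [l]) last butlast"
  by (rule factor.intro; (assumption | (simp add: letter_linear_def; fail) | (auto; fail) | rule word_end_rules |
      (rule word_multilinear_Cons; simp; fail) | (rule word_multilinear_snoc; simp; fail) |
      (erule word_multilinear_Cons') | (erule word_multilinear_snoc') |
      (erule letter_linear_Cons) | (erule letter_linear_snoc)))

lemma factor_right_Inr:
  "state_space Y0 \<xi> \<Longrightarrow> factor Inr False X0 Y0 Y0 \<xi> (\<lambda>l w. w @ [l]) last butlast"
  by (rule factor.intro; (assumption | (simp add: letter_linear_def; fail) | (auto; fail) | rule word_end_rules |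
      (rule word_multilinear_Cons; simp; fail) | (rule word_multilinear_snoc; simp; fail) |
      (erule word_multilinear_Cons') | (erule word_multilinear_snoc') |
      (erule letter_linear_Cons) | (erule letter_linear_snoc)))

text \<open>Once the end of the word is fixed, both sides unfold to the same term, choice operators
  included.\<close>

lemma (in factor) left_op_eq:
  assumes "ins = (#)" "endl = hd"
  shows "left_op \<iota> X0 Y0 U0 \<xi> T = fac_op T"
  unfolding fac_op_def fac_V_def fac_S_def fac_space_def fac_words_def left_op_def V_map_def
      tensor_op_left_def left_tensor_space_def left_words_def
  unfolding assms by (rule refl)

lemma (in factor) right_op_eq:
  assumes "ins = (\<lambda>l w. w @ [l])" "endl = last"
  shows "right_op \<iota> X0 Y0 U0 \<xi> T = fac_op T"
  unfolding fac_op_def fac_V_def fac_S_def fac_space_def fac_words_def right_op_def W_map_def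
      tensor_op_right_def right_tensor_space_def right_words_def
  unfolding assms by (rule refl)

section \<open>The vacuum coefficient\<close>

text \<open>A word with a slot is nonempty, so the indicator of the empty word is 0 in every slot
  and hence multilinear.\<close>

lemma vacuum_functional:
  obtains \<epsilon> :: "('x::complex_vector, 'y::complex_vector) word_tensor \<Rightarrow> complex"
  where "clinear \<epsilon>" "\<And>w. \<epsilon> (tensor w) = (if w = [] then 1 else 0)"
proof -
  have "word_multilinear (\<lambda>w :: ('x + 'y) list. if w = [] then 1 else 0 :: complex)"
    by (simp add: word_multilinear_def letter_linear_def clinear_iff scaleC_complex_def)
  from tensor_extension[OF this] show thesis using that by blast
qed

text \<open>On the free product, subtracting \<open>\<epsilon> x\<close> times the vacuum leaves a
  combination of nonempty words, and \<open>\<epsilon>\<close> vanishes on these. This gives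
  existence and uniqueness for the coefficient in \<open>state_coeff\<close>.\<close>

lemma free_state_eq:
  assumes \<epsilon>: "clinear \<epsilon>" "\<And>w. \<epsilon> (tensor w) = (if w = [] then 1 else 0)"
    and T: "T (tensor []) \<in> free_product X0 Y0"
  shows "free_state X0 Y0 T = \<epsilon> (T (tensor []))"
proof -
  have nil: "[] \<in> free_words X0 Y0" by (simp add: free_words_def)
  have *: "x - \<epsilon> x *\<^sub>C tensor [] \<in> free_product0 X0 Y0" if "x \<in> free_product X0 Y0" for x
    using that[unfolded free_product_def]
  proof (induction rule: complex_vector.span_induct_alt)
    case base
    then show ?case
      by (simp add: clinear_zero[OF \<epsilon>(1)] free_product0_def complex_vector.span_zero)
  next
    case (step c x y)
    then obtain w where w: "w \<in> free_words X0 Y0" "x = tensor w" by blast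
    have "x - \<epsilon> x *\<^sub>C tensor [] \<in> free_product0 X0 Y0"
      using w by (auto simp: \<epsilon>(2) scaleC_one free_product0_def complex_vector.span_zero
          intro!: complex_vector.span_base)
    then have "c *\<^sub>C (x - \<epsilon> x *\<^sub>C tensor []) + (y - \<epsilon> y *\<^sub>C tensor []) \<in> free_product0 X0 Y0"
      using step(2) unfolding free_product0_def
      by (intro complex_vector.span_add complex_vector.span_scale)
    then show ?case
      by (simp add: clinear_add[OF \<epsilon>(1)] clinear_scaleC[OF \<epsilon>(1)] scaleC_add_left scaleC_complex_def
          complex_vector.scale_right_diff_distrib scaleC_scaleC algebra_simps)
  qed
  have \<epsilon>0: "\<epsilon> x = 0" if "x \<in> free_product0 X0 Y0" for x
    using that[unfolded free_product0_def]
    by (induction rule: complex_vector.span_induct_alt)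
       (auto simp: clinear_zero[OF \<epsilon>(1)] clinear_add[OF \<epsilon>(1)] clinear_scaleC[OF \<epsilon>(1)] \<epsilon>(2) scaleC_complex_def)
  show ?thesis
    unfolding free_state_def vector_state_def state_coeff_def
  proof (rule the_equality)
    fix c assume "T (tensor []) - c *\<^sub>C tensor [] \<in> free_product0 X0 Y0"
    from \<epsilon>0[OF this] show "c = \<epsilon> (T (tensor []))"
      by (simp add: clinear_diff[OF \<epsilon>(1)] clinear_scaleC[OF \<epsilon>(1)] \<epsilon>(2) scaleC_complex_def)
  qed (rule *[OF T])
qed

section \<open>Elements of an algebra modelled by operators\<close>

definition lin_on :: "'v::complex_vector set \<Rightarrow> ('v \<Rightarrow> 'v) \<Rightarrow> bool"
  where "lin_on V T \<longleftrightarrow> (\<forall>v\<in>V. T v \<in> V) \<and> (\<forall>v\<in>V. \<forall>w\<in>V. T (v + w) = T v + T w) \<and>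
    (\<forall>c. \<forall>v\<in>V. T (c *\<^sub>C v) = c *\<^sub>C T v)"

lemma lin_onD:
  assumes "lin_on V T" "v \<in> V"
  shows "T v \<in> V" "w \<in> V \<Longrightarrow> T (v + w) = T v + T w" "T (c *\<^sub>C v) = c *\<^sub>C T v"
  using assms by (auto simp: lin_on_def)

lemma lin_on_foldr: "(\<And>i. i \<in> set is \<Longrightarrow> lin_on V (M i)) \<Longrightarrow> lin_on V (foldr M is)"
  by (induction "is") (auto simp: lin_on_def)

lemma foldr_comp: "foldr (\<circ>) (map M is) id = foldr M is"
  by (induction "is") (auto simp: fun_eq_iff)

text \<open>\<open>T\<close> arises from operators \<open>M i\<close> as \<open>x\<close> arises from algebra elements \<open>a i\<close>.\<close>

inductive models :: "'v::complex_vector set \<Rightarrow> ('i \<Rightarrow> 'a::complex_banach_algebra) \<Rightarrow> ('i \<Rightarrow> 'v \<Rightarrow> 'v) \<Rightarrow>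
    'i set \<Rightarrow> 'a \<Rightarrow> ('v \<Rightarrow> 'v) \<Rightarrow> bool"
  for V a M I where
  word: "set is \<subseteq> I \<Longrightarrow> models V a M I (prod_list (map a is)) (foldr M is)"
| add: "models V a M I x T \<Longrightarrow> models V a M I y S \<Longrightarrow> models V a M I (x + y) (\<lambda>v. T v + S v)"
| scale: "models V a M I x T \<Longrightarrow> models V a M I (c *\<^sub>C x) (\<lambda>v. c *\<^sub>C T v)"
| ext: "models V a M I x T \<Longrightarrow> (\<And>v. v \<in> V \<Longrightarrow> T v = S v) \<Longrightarrow> models V a M I x S"

context
  fixes V :: "'v::complex_vector set" and a :: "'i \<Rightarrow> 'a::complex_banach_algebra"
    and M :: "'i \<Rightarrow> 'v \<Rightarrow> 'v" and I :: "'i set"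
  assumes V: "csubspace V" and M: "\<forall>i\<in>I. lin_on V (M i)"
begin

lemma models_lin_on: "models V a M I x T \<Longrightarrow> lin_on V T"
proof (induction rule: models.induct)
  case (word "is")
  then show ?case using M by (intro lin_on_foldr) auto
next
  case (add x T y S)
  then show ?case
    by (auto simp: lin_on_def scaleC_add_right algebra_simps intro: complex_vector.subspace_add[OF V])
next
  case (scale x T c)
  then show ?case
    by (auto simp: lin_on_def scaleC_add_right scaleC_scaleC mult.commute
        intro: complex_vector.subspace_scale[OF V])
next
  case (ext x T S)
  then show ?case
    by (auto simp: lin_on_def complex_vector.subspace_add[OF V] complex_vector.subspace_scale[OF V]
        simp flip: ext.hyps(2))
qed

lemma models_one: "models V a M I 1 id"
  using models.word[of "[]" I V a M] by (simp add: id_def)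

lemma models_generator: "i \<in> I \<Longrightarrow> models V a M I (a i) (M i)"
  using models.word[of "[i]" I V a M] by simp

text \<open>Induction on the first factor and, when that is a word, on the second; the word operator
  passes sums and multiples because it is linear on \<open>V\<close>.\<close>

lemma models_mult:
  assumes "models V a M I x T" "models V a M I y S"
  shows "models V a M I (x * y) (T \<circ> S)"
  using assms(1)
proof (induction rule: models.induct)
  case (word "is")
  from assms(2) show ?case
  proof (induction rule: models.induct)
    case (word js)
    have "foldr M (is @ js) = foldr M is \<circ> foldr M js"
      by (simp add: fun_eq_iff)
    then show ?case
      using models.word[of "is @ js" I V a M] \<open>set is \<subseteq> I\<close> word by (simp add: comp_def)
  next
    case (add x T y S)
    have l: "lin_on V (foldr M is)"
      using \<open>set is \<subseteq> I\<close> M by (intro lin_on_foldr) auto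
    show ?case
      using models.add[OF add.IH] unfolding distrib_left[symmetric]
      by (rule models.ext)
         (simp add: lin_onD(2)[OF l] lin_onD(1)[OF models_lin_on[OF add.hyps(1)]]
           lin_onD(1)[OF models_lin_on[OF add.hyps(2)]])
  next
    case (scale x T c)
    have l: "lin_on V (foldr M is)"
      using \<open>set is \<subseteq> I\<close> M by (intro lin_on_foldr) auto
    show ?case
      using models.scale[OF scale.IH, of c] unfolding mult_scaleC_right
      by (rule models.ext)
         (simp add: lin_onD(3)[OF l] lin_onD(1)[OF models_lin_on[OF scale.hyps(1)]])
  next
    case (ext x T S)
    from ext.IH show ?case by (rule models.ext) (simp add: ext.hyps)
  qed
next
  case (add x T y S)
  from models.add[OF add.IH] show ?case by (simp add: distrib_right comp_def)
next
  case (scale x T c)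
  from models.scale[OF scale.IH] show ?case by (simp add: mult_scaleC_left comp_def)
next
  case (ext x T S')
  from ext.IH show ?case
    by (rule models.ext) (simp add: ext.hyps lin_onD(1)[OF models_lin_on[OF assms(2)]])
qed

lemma models_foldr:
  "(\<And>k. k \<in> set ks \<Longrightarrow> models V a M I (x k) (T k)) \<Longrightarrow>
    models V a M I (prod_list (map x ks)) (foldr T ks)"
proof (induction ks)
  case Nil
  show ?case using models_one by (simp add: id_def)
next
  case (Cons k ks)
  show ?case
    using models_mult[OF Cons.prems[of k] Cons.IH[OF Cons.prems]] by (simp add: comp_def)
qed

text \<open>Both sides are linear in the pair \<open>(x, T)\<close>, so agreement on words suffices.
  A relation takes the place of a map from elements to operators, because identities among the
  \<open>a i\<close> need not hold among the \<open>M i\<close>; the expectations agree all the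
  same.\<close>

lemma models_functional:
  assumes "models V a M I x T" "clinear \<phi>" "clinear \<epsilon>" "\<eta> \<in> V"
    and "\<And>is. set is \<subseteq> I \<Longrightarrow> \<phi> (prod_list (map a is)) = \<epsilon> (foldr M is \<eta>)"
  shows "\<phi> x = \<epsilon> (T \<eta>)"
  using assms(1)
  by (induction rule: models.induct)
     (simp_all add: assms(4,5) clinear_add[OF assms(2)] clinear_add[OF assms(3)]
       clinear_scaleC[OF assms(2)] clinear_scaleC[OF assms(3)])

end

text \<open>The polynomials in \<open>a\<close>. Only multiplication by the generator is a rule, so
  that each induction step composes with one known operator.\<close>

inductive_set polys :: "'a::complex_banach_algebra \<Rightarrow> 'a set" for a where
  one: "1 \<in> polys a"
| mult: "x \<in> polys a \<Longrightarrow> a * x \<in> polys a"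
| add: "x \<in> polys a \<Longrightarrow> y \<in> polys a \<Longrightarrow> x + y \<in> polys a"
| scale: "x \<in> polys a \<Longrightarrow> c *\<^sub>C x \<in> polys a"

text \<open>\<open>fac_op\<close> respects identity, composition, sums and multiples on
  \<open>FP\<close>; the rule \<open>ext\<close> of \<open>models\<close> discards what happens
  outside \<open>FP\<close>.\<close>

lemma (in factor) polys_model:
  assumes x: "x \<in> polys (a i)" and i: "i \<in> I" and M: "\<forall>i\<in>I. lin_on FP (M i)"
    and L: "clinear L" "M i = fac_op L"
  shows "\<exists>T. clinear T \<and> models FP a M I x (fac_op T)"
  using x
proof (induction rule: polys.induct)
  have V: "csubspace FP" by (simp add: free_product_def)
  note facts = models_one[OF V M] models_mult[OF V M] models_generator[OF V M i]
  case one
  show ?case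
    using models.ext[OF facts(1), where S = "fac_op (\<lambda>u. u)"] clinear_ident fac_op_id by fastforce
next
  have V: "csubspace FP" by (simp add: free_product_def)
  case (mult x)
  then obtain T where T: "clinear T" "models FP a M I x (fac_op T)" by blast
  have "models FP a M I (a i) (fac_op L)"
    using models_generator[OF V M i] L(2) by simp
  from models_mult[OF V M this T(2)]
  have "models FP a M I (a i * x) (fac_op (\<lambda>u. L (T u)))"
    by (rule models.ext) (simp add: fac_op_compose L T)
  then show ?case using clinear_compose[OF L(1) T(1)] by blast
next
  case (add x y)
  then obtain T S where T: "clinear T" "models FP a M I x (fac_op T)"
    and S: "clinear S" "models FP a M I y (fac_op S)" by blast
  from models.add[OF T(2) S(2)] have "models FP a M I (x + y) (fac_op (\<lambda>u. T u + S u))"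
    by (rule models.ext) (simp add: fac_op_add T S)
  moreover have "clinear (\<lambda>u. T u + S u)"
    using T(1) S(1) by (simp add: clinear_iff scaleC_add_right algebra_simps)
  ultimately show ?case by blast
next
  case (scale x c)
  then obtain T where T: "clinear T" "models FP a M I x (fac_op T)" by blast
  from models.scale[OF T(2)] have "models FP a M I (c *\<^sub>C x) (fac_op (\<lambda>u. c *\<^sub>C T u))"
    by (rule models.ext) (simp add: fac_op_scaleC T)
  moreover have "clinear (\<lambda>u. c *\<^sub>C T u)"
    using T(1) by (simp add: clinear_iff scaleC_add_right scaleC_scaleC mult.commute)
  ultimately show ?case by blast
qed

section \<open>Alternating words of centred operators\<close>

abbreviation alternating :: "bool list \<Rightarrow> bool" where "alternating \<equiv> successively (\<noteq>)"

context
  fixes X0 :: "'x::complex_vector set" and Y0 :: "'y::complex_vector set"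
    and lop rop :: "bool \<Rightarrow> ('x, 'y) word_tensor \<Rightarrow> ('x, 'y) word_tensor"
    and e f :: "bool \<Rightarrow> 'x + 'y" and c :: "bool \<Rightarrow> 'x + 'y \<Rightarrow> complex"
    and h :: "bool \<Rightarrow> 'x + 'y \<Rightarrow> 'x + 'y"
    and \<epsilon> :: "('x, 'y) word_tensor \<Rightarrow> complex"
  assumes lin: "\<And>k. lin_on (free_product X0 Y0) (lop k)"
    and lop_other: "\<And>k w. w \<in> free_words X0 Y0 \<Longrightarrow> w = [] \<or> isl (hd w) \<noteq> k \<Longrightarrow>
      lop k (tensor w) = tensor (e k # w)"
    and lop_same: "\<And>k l w. l # w \<in> free_words X0 Y0 \<Longrightarrow> isl l = k \<Longrightarrow>
      lop k (tensor (l # w)) = c k l *\<^sub>C tensor w + tensor (h k l # w)"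
    and rop: "\<And>k w. w \<in> free_words X0 Y0 \<Longrightarrow> w = [] \<or> isl (last w) \<noteq> k \<Longrightarrow>
      rop k (tensor w) = tensor (w @ [f k])"
    and e: "\<And>k. isl (e k) = k" "\<And>k. e k \<in> Inl ` X0 \<union> Inr ` Y0"
    and f: "\<And>k. isl (f k) = k" "\<And>k. f k \<in> Inl ` X0 \<union> Inr ` Y0"
    and h: "\<And>l. isl (h (isl l) l) = isl l"
      "\<And>l. l \<in> Inl ` X0 \<union> Inr ` Y0 \<Longrightarrow> h (isl l) l \<in> Inl ` X0 \<union> Inr ` Y0"
    and \<epsilon>: "clinear \<epsilon>" "\<And>w. \<epsilon> (tensor w) = (if w = [] then 1 else 0)"
begin

text \<open>In this context \<open>e k\<close> and \<open>f k\<close> are the letters created by the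
  centred left and right operators, \<open>c k l\<close> is the coefficient with which a left
  operator removes the letter \<open>l\<close>, and \<open>h k l\<close> is the letter replacing it.
  Here each operator meets a front letter of the other factor, so only creation takes place.\<close>

lemma lop_word_other:
  assumes "alternating ks" "w \<in> free_words X0 Y0" "ks = [] \<or> w = [] \<or> last ks \<noteq> isl (hd w)"
  shows "foldr lop ks (tensor w) = tensor (map e ks @ w) \<and> map e ks @ w \<in> free_words X0 Y0"
  using assms
proof (induction ks)
  case (Cons k ks)
  have IH: "foldr lop ks (tensor w) = tensor (map e ks @ w)" "map e ks @ w \<in> free_words X0 Y0"
    using Cons by (cases ks; simp)+
  have "map e ks @ w = [] \<or> isl (hd (map e ks @ w)) \<noteq> k"
    using Cons.prems(1,3) by (cases ks) (auto simp: e(1))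
  then show ?case
    using IH lop_other[of "map e ks @ w" k] e by (auto simp: free_words_Cons)
qed (simp add: assms)

text \<open>\<open>foldr\<close> applies the last operator first and letters are appended at the
  right; hence the reversal, and the front letter belongs to the last index of
  \<open>js\<close>.\<close>

lemma rop_word:
  assumes "alternating ks"
  shows "foldr rop ks (tensor []) = tensor (rev (map f ks)) \<and>
    rev (map f ks) \<in> free_words X0 Y0"
  using assms
proof (induction ks)
  case Nil
  then show ?case by (simp add: free_words_def)
next
  case (Cons k ks)
  have IH: "foldr rop ks (tensor []) = tensor (rev (map f ks))"
    "rev (map f ks) \<in> free_words X0 Y0"
    using Cons by (auto simp: successively_Cons)
  have "rev (map f ks) = [] \<or> isl (last (rev (map f ks))) \<noteq> k"
    using Cons.prems by (cases ks) (auto simp: f(1))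
  then show ?case
    using IH rop[of "rev (map f ks)" k] f by (auto simp: free_words_snoc)
qed

text \<open>The left operator with the last index acts first, on the front letter. If the indices
  differ, or there is no letter, it and all later operators only create, and the vacuum is not
  reached. If they agree, the letter is removed, which leaves shorter words, or it is replaced by a
  letter of the same factor; then the next operator has the other index and the first case
  applies.\<close>

lemma lop_word_moment:
  assumes "alternating ks" "alternating js"
  shows "\<epsilon> (foldr lop ks (tensor (rev (map f js)))) =
    (if ks = js then prod_list (map (\<lambda>k. c k (f k)) ks) else 0)"
  using assms
proof (induction ks arbitrary: js rule: rev_induct)
  case Nil
  then show ?case by (simp add: \<epsilon>(2))
next
  case (snoc k ks)
  show ?case
  proof (cases "js = [] \<or> last js \<noteq> k")
    case True
    then have "foldr lop (ks @ [k]) (tensor (rev (map f js))) =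
        tensor (map e (ks @ [k]) @ rev (map f js))"
      using rop_word[OF snoc.prems(2)] lop_word_other[OF snoc.prems(1), of "rev (map f js)"]
      by (cases js rule: rev_cases) (auto simp: f(1))
    then show ?thesis using True by (auto simp: \<epsilon>(2))
  next
    case False
    then obtain js' where js: "js = js' @ [k]"
      by (cases js rule: rev_cases) auto
    have alt: "alternating ks" "ks = [] \<or> last ks \<noteq> k" "alternating js'"
      using snoc.prems unfolding js successively_append_iff by simp_all
    let ?w = "rev (map f js')" and ?T = "foldr lop ks"
    have free: "f k # ?w \<in> free_words X0 Y0"
      using rop_word[OF snoc.prems(2)] by (simp add: js)
    then have free': "h k (f k) # ?w \<in> free_words X0 Y0" "?w \<in> free_words X0 Y0"
      using h(1)[of "f k"] h(2)[OF f(2), of k] unfolding free_words_Cons f(1) by simp_all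
    have T: "lin_on (free_product X0 Y0) ?T" by (intro lin_on_foldr lin)
    have mem: "tensor w \<in> free_product X0 Y0" if "w \<in> free_words X0 Y0" for w
      using that by (simp add: free_product_def complex_vector.span_base)
    have "foldr lop (ks @ [k]) (tensor (rev (map f js))) =
        ?T (c k (f k) *\<^sub>C tensor ?w + tensor (h k (f k) # ?w))"
      using lop_same[OF free f(1)] by (simp add: js)
    also have "\<dots> = c k (f k) *\<^sub>C ?T (tensor ?w) + ?T (tensor (h k (f k) # ?w))"
      using lin_onD(2)[OF T, of "c k (f k) *\<^sub>C tensor ?w" "tensor (h k (f k) # ?w)"]
        lin_onD(3)[OF T mem[OF free'(2)]] mem[OF free'(1)] mem[OF free'(2)]
      by (simp add: free_product_def complex_vector.span_scale)
    finally have "\<epsilon> (foldr lop (ks @ [k]) (tensor (rev (map f js)))) =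
        c k (f k) * \<epsilon> (?T (tensor ?w)) + \<epsilon> (?T (tensor (h k (f k) # ?w)))"
      by (simp add: clinear_add[OF \<epsilon>(1)] clinear_scaleC[OF \<epsilon>(1)] scaleC_complex_def)
    moreover have "\<epsilon> (?T (tensor (h k (f k) # ?w))) = 0"
      using lop_word_other[OF alt(1) free'(1)] alt(2) h(1)[of "f k"] f(1)[of k] by (simp add: \<epsilon>(2))
    ultimately show ?thesis
      using snoc.IH[OF alt(1,3)] by (simp add: js)
  qed
qed

end

lemma (in factor) lin_on_fac_op: "clinear T \<Longrightarrow> lin_on FP (fac_op T)"
  by (simp add: lin_on_def fac_op_linear)

lemma (in factor) state_fac_op:
  assumes \<epsilon>: "clinear \<epsilon>" "\<And>w. \<epsilon> (tensor w) = (if w = [] then 1 else 0)" and T: "clinear T"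
  shows "\<epsilon> (fac_op T (tensor [])) = p (T \<xi>)"
proof -
  have "[] \<in> fac_words" by (simp add: fac_words_def free_words_def)
  from fac_op_other[OF T this] show ?thesis
    by (simp add: clinear_add[OF \<epsilon>(1)] clinear_scaleC[OF \<epsilon>(1)] \<epsilon>(2) scaleC_complex_def)
qed

lemma (in factor) fac_op_other_centred:
  assumes "clinear T" "p (T \<xi>) = 0" "w \<in> free_words X0 Y0" "w = [] \<or> isl (endl w) \<noteq> side"
  shows "fac_op T (tensor w) = tensor (ins (\<iota> (T \<xi>)) w)"
  using fac_op_other[OF assms(1), of w] assms by (simp add: fac_words_def range_\<iota>)

lemma (in factor) centred_mem: "p u = 0 \<Longrightarrow> \<iota> u \<in> Inl ` X0 \<union> Inr ` Y0"
  using diff_state_coeff[OF state, of u] \<iota>_mem[of u] by simp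

section \<open>Mixed moments of centred polynomials in bi-free pairs\<close>

lemma bi_free_model:
  fixes \<phi> :: "'a::complex_banach_algebra \<Rightarrow> complex"
  assumes "bi_free TYPE('x::complex_vector) TYPE('y::complex_vector) \<phi> a1 b1 a2 b2"
  obtains X0 :: "'x::complex_vector set" and Y0 :: "'y::complex_vector set" and \<xi>1 \<xi>2 L1 R1 L2 R2
  where "state_space X0 \<xi>1" "state_space Y0 \<xi>2" "clinear L1" "clinear R1" "clinear L2" "clinear R2"
    "\<And>is. set is \<subseteq> {..<4} \<Longrightarrow> \<phi> (prod_list (map ((!) [a1, b1, a2, b2]) is)) =
      free_state X0 Y0 (foldr ((!) [left_op Inl X0 Y0 X0 \<xi>1 L1, right_op Inl X0 Y0 X0 \<xi>1 R1,
        left_op Inr X0 Y0 Y0 \<xi>2 L2, right_op Inr X0 Y0 Y0 \<xi>2 R2]) is)"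
  using assms unfolding bi_free_def foldr_comp by blast

text \<open>Each \<open>x k\<close> is modelled by one left operator and each \<open>y k\<close> by
  one right operator of the factor \<open>k\<close>, so the word calculation on the free product
  applies.\<close>

lemma bi_free_moments:
  fixes \<phi> :: "'a::complex_banach_algebra \<Rightarrow> complex" and x y :: "bool \<Rightarrow> 'a"
  assumes \<phi>: "clinear \<phi>"
    and bf: "bi_free TYPE('x::complex_vector) TYPE('y::complex_vector) \<phi> a1 b1 a2 b2"
    and x: "\<And>k. x k \<in> polys (if k then a1 else a2)" "\<And>k. \<phi> (x k) = 0"
    and y: "\<And>k. y k \<in> polys (if k then b1 else b2)" "\<And>k. \<phi> (y k) = 0"
    and alt: "alternating ks" "alternating js"
  shows "\<phi> (prod_list (map x ks) * prod_list (map y js)) =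
    (if ks = js then prod_list (map (\<lambda>k. \<phi> (x k * y k)) ks) else 0)"
proof -
  obtain X0 :: "'x set" and Y0 :: "'y set" and \<xi>1 \<xi>2 L1 R1 L2 R2
    where st: "state_space X0 \<xi>1" "state_space Y0 \<xi>2"
      and cl: "clinear L1" "clinear R1" "clinear L2" "clinear R2"
      and mom: "\<And>is. set is \<subseteq> {..<4} \<Longrightarrow> \<phi> (prod_list (map ((!) [a1, b1, a2, b2]) is)) =
      free_state X0 Y0 (foldr ((!) [left_op Inl X0 Y0 X0 \<xi>1 L1, right_op Inl X0 Y0 X0 \<xi>1 R1,
        left_op Inr X0 Y0 Y0 \<xi>2 L2, right_op Inr X0 Y0 Y0 \<xi>2 R2]) is)"
    using bi_free_model[OF bf] by metis
  interpret l1: factor Inl True X0 Y0 X0 \<xi>1 "(#)" hd tl by (rule factor_left_Inl[OF st(1)])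
  interpret l2: factor Inr False X0 Y0 Y0 \<xi>2 "(#)" hd tl by (rule factor_left_Inr[OF st(2)])
  interpret r1: factor Inl True X0 Y0 X0 \<xi>1 "\<lambda>l w. w @ [l]" last butlast
    by (rule factor_right_Inl[OF st(1)])
  interpret r2: factor Inr False X0 Y0 Y0 \<xi>2 "\<lambda>l w. w @ [l]" last butlast
    by (rule factor_right_Inr[OF st(2)])
  let ?V = "free_product X0 Y0" and ?I = "{..<4} :: nat set"
  define A where "A = (!) [a1, b1, a2, b2]"
  define M where "M = (!) [l1.fac_op L1, r1.fac_op R1, l2.fac_op L2, r2.fac_op R2]"
  have A: "A 0 = a1" "A 1 = b1" "A 2 = a2" "A 3 = b2" by (simp_all add: A_def)
  have M: "M 0 = l1.fac_op L1" "M 1 = r1.fac_op R1" "M 2 = l2.fac_op L2" "M 3 = r2.fac_op R2"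
    by (simp_all add: M_def)
  obtain \<epsilon> :: "('x, 'y) word_tensor \<Rightarrow> complex"
    where \<epsilon>: "clinear \<epsilon>" "\<And>w. \<epsilon> (tensor w) = (if w = [] then 1 else 0)"
    using vacuum_functional by metis
  have V: "csubspace ?V" by (simp add: free_product_def)
  have nil: "[] \<in> free_words X0 Y0" by (simp add: free_words_def)
  then have vac: "tensor [] \<in> ?V" by (rule l1.tensor_FP)
  have M_lin: "\<forall>i\<in>?I. lin_on ?V (M i)"
  proof
    fix i :: nat assume "i \<in> ?I"
    then have "i = 0 \<or> i = 1 \<or> i = 2 \<or> i = 3" by auto
    then show "lin_on ?V (M i)"
      using M cl l1.lin_on_fac_op r1.lin_on_fac_op l2.lin_on_fac_op r2.lin_on_fac_op by metis
  qed
  have "\<phi> (prod_list (map A is)) = \<epsilon> (foldr M is (tensor []))" if "set is \<subseteq> ?I" for "is"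
  proof -
    have "lin_on ?V (foldr M is)" using that M_lin by (intro lin_on_foldr) auto
    then have mem: "foldr M is (tensor []) \<in> ?V" using lin_onD(1) vac by blast
    have "\<phi> (prod_list (map A is)) = free_state X0 Y0 (foldr M is)"
      using mom[OF that] unfolding A_def M_def l1.left_op_eq[OF refl refl] l2.left_op_eq[OF refl refl]
        r1.right_op_eq[OF refl refl] r2.right_op_eq[OF refl refl] .
    also have "\<dots> = \<epsilon> (foldr M is (tensor []))" by (rule free_state_eq[OF \<epsilon>, where T = "foldr M is", OF mem])
    finally show ?thesis .
  qed
  note state_models = models_functional[OF V M_lin _ \<phi> \<epsilon>(1) vac this]
  have xy: "x True \<in> polys (A 0)" "x False \<in> polys (A 2)" "y True \<in> polys (A 1)" "y False \<in> polys (A 3)"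
    using x(1)[of True] x(1)[of False] y(1)[of True] y(1)[of False] unfolding A by simp_all
  obtain T1 where T1: "clinear T1" "models ?V A M ?I (x True) (l1.fac_op T1)"
    using l1.polys_model[where a = A and i = 0 and M = M, OF xy(1) _ M_lin cl(1) M(1)] by auto
  obtain T2 where T2: "clinear T2" "models ?V A M ?I (x False) (l2.fac_op T2)"
    using l2.polys_model[where a = A and i = 2 and M = M, OF xy(2) _ M_lin cl(3) M(3)] by auto
  obtain S1 where S1: "clinear S1" "models ?V A M ?I (y True) (r1.fac_op S1)"
    using r1.polys_model[where a = A and i = 1 and M = M, OF xy(3) _ M_lin cl(2) M(2)] by auto
  obtain S2 where S2: "clinear S2" "models ?V A M ?I (y False) (r2.fac_op S2)"
    using r2.polys_model[where a = A and i = 3 and M = M, OF xy(4) _ M_lin cl(4) M(4)] by auto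
  \<comment> \<open>Centring passes from the algebra to the factors, because the vacuum expectation
    of \<open>fac_op T\<close> is \<open>p (T \<xi>)\<close>.\<close>
  have cen: "l1.p (T1 \<xi>1) = 0" "l2.p (T2 \<xi>2) = 0" "l1.p (S1 \<xi>1) = 0" "l2.p (S2 \<xi>2) = 0"
    using state_models[OF T1(2)] state_models[OF T2(2)] state_models[OF S1(2)] state_models[OF S2(2)]
      l1.state_fac_op[OF \<epsilon> T1(1)] l2.state_fac_op[OF \<epsilon> T2(1)]
      r1.state_fac_op[OF \<epsilon> S1(1)] r2.state_fac_op[OF \<epsilon> S2(1)] x(2) y(2) by simp_all
  define lop where "lop k = (if k then l1.fac_op T1 else l2.fac_op T2)" for k
  define rop where "rop k = (if k then r1.fac_op S1 else r2.fac_op S2)" for k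
  define e :: "bool \<Rightarrow> 'x + 'y" where "e k = (if k then Inl (T1 \<xi>1) else Inr (T2 \<xi>2))" for k
  define f :: "bool \<Rightarrow> 'x + 'y" where "f k = (if k then Inl (S1 \<xi>1) else Inr (S2 \<xi>2))" for k
  define c where "c k = case_sum (\<lambda>u. l1.p (T1 u)) (\<lambda>u. l2.p (T2 u))" for k :: bool
  define h :: "bool \<Rightarrow> 'x + 'y \<Rightarrow> 'x + 'y" where "h k = case_sum (\<lambda>u. Inl (l1.cen (T1 u))) (\<lambda>u. Inr (l2.cen (T2 u)))" for k
  have e: "isl (e k) = k" "e k \<in> Inl ` X0 \<union> Inr ` Y0" for k
    using l1.centred_mem[OF cen(1)] l2.centred_mem[OF cen(2)] by (auto simp: e_def)
  have f: "isl (f k) = k" "f k \<in> Inl ` X0 \<union> Inr ` Y0" for k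
    using l1.centred_mem[OF cen(3)] l2.centred_mem[OF cen(4)] by (auto simp: f_def)
  have h: "isl (h (isl l) l) = isl l" "h (isl l) l \<in> Inl ` X0 \<union> Inr ` Y0" for l
    using diff_state_coeff[OF st(1)] diff_state_coeff[OF st(2)] by (cases l; simp add: h_def)+
  have lop_lin: "lin_on ?V (lop k)" for k
    by (simp add: lop_def l1.lin_on_fac_op l2.lin_on_fac_op T1 T2)
  have lop_other: "lop k (tensor w) = tensor (e k # w)"
    if "w \<in> free_words X0 Y0" "w = [] \<or> isl (hd w) \<noteq> k" for k w
    using that l1.fac_op_other_centred[OF T1(1) cen(1), of w]
      l2.fac_op_other_centred[OF T2(1) cen(2), of w] by (auto simp: lop_def e_def)
  have rop: "rop k (tensor w) = tensor (w @ [f k])"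
    if "w \<in> free_words X0 Y0" "w = [] \<or> isl (last w) \<noteq> k" for k w
    using that r1.fac_op_other_centred[OF S1(1) cen(3), of w]
      r2.fac_op_other_centred[OF S2(1) cen(4), of w] by (auto simp: rop_def f_def)
  have lop_same: "lop k (tensor (l # w)) = c k l *\<^sub>C tensor w + tensor (h k l # w)"
    if "l # w \<in> free_words X0 Y0" "isl l = k" for k l w
    using that l1.fac_op_same[OF T1(1), of _ w] l2.fac_op_same[OF T2(1), of _ w]
    by (cases l) (auto simp: lop_def c_def h_def)
  have lop_models: "models ?V A M ?I (x k) (lop k)" and rop_models: "models ?V A M ?I (y k) (rop k)" for k
    using T1(2) T2(2) S1(2) S2(2) by (cases k; simp add: lop_def rop_def)+
  have moment: "\<phi> (prod_list (map x ks) * prod_list (map y js)) =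
    (if ks = js then prod_list (map (\<lambda>k. c k (f k)) ks) else 0)"
    if alt: "alternating ks" "alternating js" for ks js
  proof -
    have "models ?V A M ?I (prod_list (map x ks) * prod_list (map y js)) (foldr lop ks \<circ> foldr rop js)"
      by (intro models_mult[OF V M_lin] models_foldr[OF V M_lin] lop_models rop_models)
    from state_models[OF this]
    have "\<phi> (prod_list (map x ks) * prod_list (map y js)) = \<epsilon> (foldr lop ks (foldr rop js (tensor [])))"
      by simp
    also have "foldr rop js (tensor []) = tensor (rev (map f js))"
      using rop_word[where lop = lop and rop = rop and e = e and f = f and c = c and h = h and \<epsilon> = \<epsilon>,
          OF lop_lin lop_other lop_same rop e f h \<epsilon> alt(2)] by blast
    also have "\<epsilon> (foldr lop ks \<dots>) = (if ks = js then prod_list (map (\<lambda>k. c k (f k)) ks) else 0)"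
      by (rule lop_word_moment[where lop = lop and rop = rop and e = e and f = f and c = c and h = h
          and \<epsilon> = \<epsilon>, OF lop_lin lop_other lop_same rop e f h \<epsilon> alt])
    finally show ?thesis .
  qed
  \<comment> \<open>One-letter words identify the removal coefficient as a moment in the
    algebra.\<close>
  have "c k (f k) = \<phi> (x k * y k)" for k
    using moment[of "[k]" "[k]"] by simp
  then show ?thesis using moment[OF alt] by simp
qed

section \<open>Closures of polynomial algebras\<close>

lemma bounded_bilinear_scaleC:
  "bounded_bilinear ((*\<^sub>C) :: complex \<Rightarrow> 'a \<Rightarrow> 'a::complex_banach_algebra)"
proof
  fix c d :: complex and x y :: 'a and r :: real
  show "(c + d) *\<^sub>C x = c *\<^sub>C x + d *\<^sub>C x" by (rule scaleC_add_left)
  show "c *\<^sub>C (x + y) = c *\<^sub>C x + c *\<^sub>C y" by (rule scaleC_add_right)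
  show "(r *\<^sub>R c) *\<^sub>C x = r *\<^sub>R c *\<^sub>C x"
    by (simp add: scaleR_eq_scaleC scaleC_scaleC scaleR_conv_of_real)
  show "c *\<^sub>C r *\<^sub>R x = r *\<^sub>R c *\<^sub>C x"
    by (simp add: scaleR_eq_scaleC scaleC_scaleC mult.commute)
  show "\<exists>K. \<forall>c (x::'a). norm (c *\<^sub>C x) \<le> norm c * norm x * K"
    by (rule exI[of _ 1]) (simp add: norm_scaleC)
qed

lemmas tendsto_scaleC [tendsto_intros] = bounded_bilinear.tendsto[OF bounded_bilinear_scaleC]

lemma tendsto_functional:
  fixes \<phi> :: "'a::complex_banach_algebra \<Rightarrow> complex"
  assumes "continuous_on UNIV \<phi>" "(f \<longlongrightarrow> x) F"
  shows "((\<lambda>t. \<phi> (f t)) \<longlongrightarrow> \<phi> x) F"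
  using assms by (simp add: continuous_on_eq_continuous_at isCont_tendsto_compose)

lemma tendsto_prod_list:
  fixes x :: "'i \<Rightarrow> 'a::{topological_semigroup_mult, monoid_mult}"
  assumes "\<And>k. ((\<lambda>n. f n k) \<longlongrightarrow> x k) F"
  shows "((\<lambda>n. prod_list (map (f n) ks)) \<longlongrightarrow> prod_list (map x ks)) F"
  by (induction ks) (auto intro!: tendsto_mult assms)

lemma polys_self: "a \<in> polys a"
  using polys.mult[OF polys.one] by simp

lemma polys_diff: "x \<in> polys a \<Longrightarrow> y \<in> polys a \<Longrightarrow> x - y \<in> polys a"
  using polys.add[of x a "(-1) *\<^sub>C y"] polys.scale[of y a "-1"]
  by (simp add: complex_vector.scale_minus_left scaleC_one)

lemma polys_power: "a ^ n \<in> polys a"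
  by (induction n) (auto intro: polys.intros)

lemma zero_polys: "0 \<in> polys a"
  using polys_diff[OF polys.one polys.one] by simp

lemma polys_sum: "(\<And>i. i \<in> A \<Longrightarrow> f i \<in> polys a) \<Longrightarrow> sum f A \<in> polys a"
  by (induction A rule: infinite_finite_induct) (auto intro: polys.intros zero_polys)

lemma closure_polys_scale: "x \<in> closure (polys a) \<Longrightarrow> c *\<^sub>C x \<in> closure (polys a)"
proof -
  assume "x \<in> closure (polys a)"
  then obtain u where u: "\<And>n. u n \<in> polys a" "u \<longlonglongrightarrow> x"
    unfolding closure_sequential by blast
  have "(\<lambda>n. c *\<^sub>C u n) \<longlonglongrightarrow> c *\<^sub>C x"
    by (rule tendsto_scaleC[OF tendsto_const u(2)])
  moreover have "\<forall>n. c *\<^sub>C u n \<in> polys a"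
    using u(1) polys.scale by blast
  ultimately show ?thesis unfolding closure_sequential by (intro exI[of _ "\<lambda>n. c *\<^sub>C u n"] conjI)
qed

lemma closure_polys_diff:
  "x \<in> closure (polys a) \<Longrightarrow> y \<in> closure (polys a) \<Longrightarrow> x - y \<in> closure (polys a)"
proof -
  assume "x \<in> closure (polys a)" "y \<in> closure (polys a)"
  then obtain u v where u: "\<And>n. u n \<in> polys a" "u \<longlonglongrightarrow> x"
    and v: "\<And>n. v n \<in> polys a" "v \<longlonglongrightarrow> y"
    unfolding closure_sequential by blast
  have "(\<lambda>n. u n - v n) \<longlonglongrightarrow> x - y"
    by (rule tendsto_diff[OF u(2) v(2)])
  moreover have "\<forall>n. u n - v n \<in> polys a"
    using u(1) v(1) polys_diff by blast
  ultimately show ?thesis unfolding closure_sequential by (intro exI[of _ "\<lambda>n. u n - v n"] conjI)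
qed

text \<open>Subtracting from each approximant its own expectation centres it, and keeps the limit
  because these expectations tend to \<open>\<phi> x = 0\<close>.\<close>

lemma centred_approximation:
  fixes \<phi> :: "'a::complex_banach_algebra \<Rightarrow> complex"
  assumes \<phi>: "clinear \<phi>" "continuous_on UNIV \<phi>" "\<phi> 1 = 1"
    and x: "x \<in> closure (polys a)" "\<phi> x = 0"
  shows "\<exists>u. (\<forall>n. u n \<in> polys a \<and> \<phi> (u n) = 0) \<and> u \<longlonglongrightarrow> x"
proof -
  obtain u where u: "\<And>n. u n \<in> polys a" "u \<longlonglongrightarrow> x"
    using x(1) unfolding closure_sequential by blast
  define v where "v n = u n - \<phi> (u n) *\<^sub>C 1" for n
  have "v \<longlonglongrightarrow> x - \<phi> x *\<^sub>C 1"
    unfolding v_def by (intro tendsto_intros u tendsto_functional[OF \<phi>(2)])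
  moreover have "v n \<in> polys a" "\<phi> (v n) = 0" for n
    by (auto simp: v_def clinear_diff[OF \<phi>(1)] clinear_scaleC[OF \<phi>(1)] \<phi>(3) scaleC_complex_def
        intro!: polys_diff u polys.intros)
  ultimately show ?thesis using x(2) by auto
qed

text \<open>For fixed words both sides depend continuously on the letters, so centred polynomials
  can be replaced by their limits, in particular by centred resolvents.\<close>

lemma bi_free_closure_moments:
  fixes \<phi> :: "'a::complex_banach_algebra \<Rightarrow> complex" and x y :: "bool \<Rightarrow> 'a"
  assumes \<phi>: "clinear \<phi>" "continuous_on UNIV \<phi>" "\<phi> 1 = 1"
    and bf: "bi_free TYPE('x::complex_vector) TYPE('y::complex_vector) \<phi> a1 b1 a2 b2"
    and x: "\<And>k. x k \<in> closure (polys (if k then a1 else a2))" "\<And>k. \<phi> (x k) = 0"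
    and y: "\<And>k. y k \<in> closure (polys (if k then b1 else b2))" "\<And>k. \<phi> (y k) = 0"
    and alt: "alternating ks" "alternating js"
  shows "\<phi> (prod_list (map x ks) * prod_list (map y js)) =
    (if ks = js then prod_list (map (\<lambda>k. \<phi> (x k * y k)) ks) else 0)"
proof -
  have "\<exists>u. \<forall>k. (\<forall>n. u k n \<in> polys (if k then a1 else a2) \<and> \<phi> (u k n) = 0) \<and> u k \<longlonglongrightarrow> x k"
    by (rule choice) (use centred_approximation[OF \<phi> x] in blast)
  then obtain u where u: "\<And>k n. u k n \<in> polys (if k then a1 else a2)" "\<And>k n. \<phi> (u k n) = 0"
    and u_lim: "\<And>k. u k \<longlonglongrightarrow> x k" by blast
  have "\<exists>v. \<forall>k. (\<forall>n. v k n \<in> polys (if k then b1 else b2) \<and> \<phi> (v k n) = 0) \<and> v k \<longlonglongrightarrow> y k"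
    by (rule choice) (use centred_approximation[OF \<phi> y] in blast)
  then obtain v where v: "\<And>k n. v k n \<in> polys (if k then b1 else b2)" "\<And>k n. \<phi> (v k n) = 0"
    and v_lim: "\<And>k. v k \<longlonglongrightarrow> y k" by blast
  have "(\<lambda>n. \<phi> (prod_list (map (\<lambda>k. u k n) ks) * prod_list (map (\<lambda>k. v k n) js))) \<longlonglongrightarrow>
      \<phi> (prod_list (map x ks) * prod_list (map y js))"
    by (intro tendsto_functional[OF \<phi>(2)] tendsto_mult tendsto_prod_list u_lim v_lim)
  moreover have "\<phi> (prod_list (map (\<lambda>k. u k n) ks) * prod_list (map (\<lambda>k. v k n) js)) =
      (if ks = js then prod_list (map (\<lambda>k. \<phi> (u k n * v k n)) ks) else 0)" for n
    by (rule bi_free_moments[OF \<phi>(1) bf u(1) u(2) v(1) v(2) alt])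
  moreover have "(\<lambda>n. if ks = js then prod_list (map (\<lambda>k. \<phi> (u k n * v k n)) ks) else 0) \<longlonglongrightarrow>
      (if ks = js then prod_list (map (\<lambda>k. \<phi> (x k * y k)) ks) else 0)"
    by (auto intro!: tendsto_prod_list tendsto_functional[OF \<phi>(2)] tendsto_mult u_lim v_lim)
  ultimately show ?thesis by (simp add: LIMSEQ_unique)
qed

section \<open>Series of alternating words\<close>

fun alt_word :: "bool \<Rightarrow> nat \<Rightarrow> bool list" where
  "alt_word k 0 = []"
| "alt_word k (Suc n) = k # alt_word (\<not> k) n"

lemma alternating_alt_word: "alternating (alt_word k n)"
proof (induction n arbitrary: k)
  case (Suc n)
  from Suc.IH[of "\<not> k"] show ?case by (cases n) auto
qed simp

lemma alt_word_eq_iff: "alt_word k n = alt_word j m \<longleftrightarrow> n = m \<and> (n = 0 \<or> k = j)"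
proof (induction n arbitrary: k j m)
  case 0
  then show ?case by (cases m) auto
next
  case (Suc n)
  then show ?case by (cases m) auto
qed

lemma prod_alt_word:
  fixes x :: "bool \<Rightarrow> 'a::monoid_mult"
  shows "prod_list (map x (alt_word k (2 * n))) = (x k * x (\<not> k)) ^ n"
    and "prod_list (map x (alt_word k (Suc (2 * n)))) = (x k * x (\<not> k)) ^ n * x k"
proof -
  show 1: "prod_list (map x (alt_word k (2 * n))) = (x k * x (\<not> k)) ^ n" for n
    by (induction n) (auto simp: mult.assoc)
  show "prod_list (map x (alt_word k (Suc (2 * n)))) = (x k * x (\<not> k)) ^ n * x k"
  proof (induction n)
    case (Suc n)
    have "prod_list (map x (alt_word k (Suc (2 * Suc n)))) =
        x k * x (\<not> k) * prod_list (map x (alt_word k (Suc (2 * n))))"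
      by (simp add: mult.assoc)
    then show ?case unfolding Suc.IH by (simp add: mult.assoc)
  qed simp
qed

lemma power_mult_left_shift: "(a * b) ^ n * a = a * (b * a) ^ n" for a :: "'a::monoid_mult"
  by (induction n) (simp_all add: mult.assoc)

text \<open>The lengths are 2n, 2n + 1, 2n + 1 and 2n + 2. The shift in the last term matters: as n
  varies every alternating word occurs exactly once, the empty one only for n = 0.\<close>

lemma alt_word_sum:
  fixes x :: "bool \<Rightarrow> 'a::ring_1"
  shows "(1 + x False) * (x True * x False) ^ n * (1 + x True) =
    prod_list (map x (alt_word True (2 * n))) + prod_list (map x (alt_word False (Suc (2 * n)))) +
    prod_list (map x (alt_word True (Suc (2 * n)))) + prod_list (map x (alt_word False (2 * Suc n)))"
proof -
  have "(x False * x True) ^ Suc n = x False * (x True * x False) ^ n * x True"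
    using power_mult_left_shift[of "x False" "x True" n] by (simp add: power_commutes mult.assoc[symmetric] power_Suc2 del: power_Suc)
  then show ?thesis
    unfolding prod_alt_word using power_mult_left_shift[of "x False" "x True" n]
    by (simp add: algebra_simps del: power_Suc)
qed

text \<open>The expansions for different \<open>n\<close> and \<open>m\<close> share no word. For
  \<open>n = m\<close> the four diagonal terms form the expansion of the same product with the
  scalars \<open>p\<close>, and \<open>alt_word_sum\<close> sums them up again.\<close>

lemma alternating_series_moment:
  fixes \<phi> :: "'a::complex_banach_algebra \<Rightarrow> complex" and x y :: "bool \<Rightarrow> 'a"
  assumes \<phi>: "clinear \<phi>"
    and moment: "\<And>ks js. alternating ks \<Longrightarrow> alternating js \<Longrightarrow>
      \<phi> (prod_list (map x ks) * prod_list (map y js)) = (if ks = js then prod_list (map p ks) else 0)"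
  shows "\<phi> (((1 + x False) * (x True * x False) ^ n * (1 + x True)) *
      ((1 + y False) * (y True * y False) ^ m * (1 + y True))) =
    (if n = m then (p True * p False) ^ n * ((1 + p True) * (1 + p False)) else 0)"
proof -
  define X Y P where "X k i = prod_list (map x (alt_word k i))"
    and "Y k i = prod_list (map y (alt_word k i))" and "P k i = prod_list (map p (alt_word k i))" for k i
  have word: "\<phi> (X k i * Y j l) = (if i = l \<and> (i = 0 \<or> k = j) then P k i else 0)" for k i j l
    unfolding X_def Y_def P_def moment[OF alternating_alt_word alternating_alt_word] alt_word_eq_iff ..
  have neq: "2 * i \<noteq> Suc (2 * j)" "Suc (2 * i) \<noteq> 2 * j" for i j :: nat
    by presburger+
  have "(p True * p False) ^ n * ((1 + p True) * (1 + p False)) =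
      (1 + p False) * (p True * p False) ^ n * (1 + p True)"
    by (simp add: algebra_simps)
  also have "\<dots> = P True (2 * n) + P False (Suc (2 * n)) + P True (Suc (2 * n)) + P False (2 * Suc n)"
    unfolding alt_word_sum P_def ..
  finally have P: "(p True * p False) ^ n * ((1 + p True) * (1 + p False)) =
      P True (2 * n) + P False (Suc (2 * n)) + P True (Suc (2 * n)) + P False (2 * Suc n)" .
  show ?thesis
    unfolding P alt_word_sum X_def[symmetric] Y_def[symmetric]
    unfolding distrib_left distrib_right clinear_add[OF \<phi>] word
    by (auto simp: neq)
qed

section \<open>Inverses and the Neumann series\<close>

definition inverse_pair :: "'a::ring_1 \<Rightarrow> 'a \<Rightarrow> bool"
  where "inverse_pair x y \<longleftrightarrow> x * y = 1 \<and> y * x = 1"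

lemma alg_inv_eqI:
  assumes "inverse_pair x y"
  shows "alg_inv x = y"
proof -
  have y: "x * y = 1" "y * x = 1" using assms by (auto simp: inverse_pair_def)
  show ?thesis
    unfolding alg_inv_def
  proof (rule the_equality)
    fix z assume "x * z = 1 \<and> z * x = 1"
    then have "z = z * (x * y)" "z * x = 1" using y by auto
    then show "z = y" by (simp add: mult.assoc[symmetric])
  qed (use y in simp)
qed

lemma inverse_pair_mult:
  assumes "inverse_pair x u" "inverse_pair y v"
  shows "inverse_pair (x * y) (v * u)"
proof -
  have "x * y * (v * u) = x * (y * v) * u" "v * u * (x * y) = v * (u * x) * y"
    by (simp_all add: mult.assoc)
  then show ?thesis using assms by (simp add: inverse_pair_def)
qed

lemma inverse_pair_scaleC:
  fixes x y :: "'a::complex_banach_algebra"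
  assumes "inverse_pair x y" "c * d = 1"
  shows "inverse_pair (c *\<^sub>C x) (d *\<^sub>C y)"
  using assms by (simp add: inverse_pair_def mult_scaleC_left mult_scaleC_right scaleC_scaleC scaleC_one
    mult.commute)

lemma neumann_series:
  fixes x :: "'a::complex_banach_algebra"
  assumes "norm x < 1"
  shows "(\<lambda>n. x ^ n) sums alg_inv (1 - x)" and "inverse_pair (1 - x) (alg_inv (1 - x))"
proof -
  \<comment> \<open>The norm of \<open>1\<close> is arbitrary, so the bound starts at exponent
    1.\<close>
  have le: "norm (x ^ n) \<le> norm x ^ n" if "n \<ge> 1" for n
    using that
  proof (induction n rule: nat_induct_at_least)
    case (Suc n)
    have "norm (x ^ Suc n) \<le> norm x * norm (x ^ n)" using norm_mult_ineq by auto
    also have "\<dots> \<le> norm x * norm x ^ n" using Suc by (intro mult_left_mono) auto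
    finally show ?case by simp
  qed simp
  have "summable (\<lambda>n. norm x ^ n)" using assms by (intro summable_geometric) auto
  then have sm: "summable (\<lambda>n. x ^ n)"
    by (rule summable_comparison_test'[of _ 1]) (use le in auto)
  define S where "S = suminf (\<lambda>n. x ^ n)"
  have s: "(\<lambda>n. x ^ n) sums S" unfolding S_def using sm by (rule summable_sums)
  have "(\<lambda>n. x ^ n - x ^ Suc n) sums (x ^ 0 - 0)"
    by (rule telescope_sums'[OF summable_LIMSEQ_zero[OF sm]])
  moreover have "(\<lambda>n. (1 - x) * x ^ n) sums ((1 - x) * S)" "(\<lambda>n. x ^ n * (1 - x)) sums (S * (1 - x))"
    by (intro sums_mult sums_mult2 s)+
  ultimately have "(1 - x) * S = 1" "S * (1 - x) = 1"
    by (simp_all add: left_diff_distrib right_diff_distrib power_commutes sums_unique2)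
  then have i: "inverse_pair (1 - x) S" by (simp add: inverse_pair_def)
  with s show "(\<lambda>n. x ^ n) sums alg_inv (1 - x)" "inverse_pair (1 - x) (alg_inv (1 - x))"
    using alg_inv_eqI[OF i] by simp_all
qed

lemma tendsto_alg_inv_one_minus:
  fixes f :: "'t \<Rightarrow> 'a::complex_banach_algebra"
  assumes "(f \<longlongrightarrow> 0) F"
  shows "((\<lambda>t. alg_inv (1 - f t)) \<longlongrightarrow> 1) F"
proof -
  \<comment> \<open>With s the inverse, s = 1 + x s; as norm x is at most 1/2, half of norm s can be
    absorbed, and norm s is at most twice the norm of \<open>1\<close>.\<close>
  have bound: "norm (alg_inv (1 - x) - 1) \<le> 2 * norm (1::'a) * norm x" if x: "norm x \<le> 1 / 2" for x :: 'a
  proof -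
    let ?s = "alg_inv (1 - x)"
    have "inverse_pair (1 - x) ?s" using x by (intro neumann_series) auto
    then have s: "?s - 1 = x * ?s" by (simp add: inverse_pair_def algebra_simps)
    have n: "norm (x * ?s) \<le> norm x * norm ?s" by (rule norm_mult_ineq)
    also have "\<dots> \<le> 1 / 2 * norm ?s" using x by (intro mult_right_mono) auto
    finally have "norm ?s \<le> norm (1::'a) + 1 / 2 * norm ?s"
      using norm_triangle_ineq[of 1 "x * ?s"] by (simp add: s[symmetric])
    then have "norm x * norm ?s \<le> norm x * (2 * norm (1::'a))" by (intro mult_left_mono) auto
    then show ?thesis using n by (simp add: s mult.commute)
  qed
  have nf: "((\<lambda>t. norm (f t)) \<longlongrightarrow> 0) F" using assms by (rule tendsto_norm_zero)
  have "\<forall>\<^sub>F t in F. norm (f t) < 1 / 2"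
    using order_tendstoD(2)[OF nf, of "1 / 2"] by simp
  then have "\<forall>\<^sub>F t in F. norm (alg_inv (1 - f t) - 1) \<le> 2 * norm (1::'a) * norm (f t)"
    by eventually_elim (rule bound, simp)
  moreover have "((\<lambda>t. 2 * norm (1::'a) * norm (f t)) \<longlongrightarrow> 0) F"
    using tendsto_mult_right_zero[OF nf] by simp
  ultimately have "((\<lambda>t. alg_inv (1 - f t) - 1) \<longlongrightarrow> 0) F"
    by (rule Lim_null_comparison)
  then show ?thesis by (simp add: LIM_zero_iff)
qed

lemma scaleC_power:
  fixes x :: "'a::complex_banach_algebra"
  shows "(c *\<^sub>C x) ^ n = c ^ n *\<^sub>C x ^ n"
  by (induction n) (simp_all add: scaleC_one mult_scaleC_left mult_scaleC_right scaleC_scaleC mult.commute)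

lemma closure_polys_alg_inv:
  fixes a :: "'a::complex_banach_algebra"
  assumes "norm (s *\<^sub>C a) < 1"
  shows "alg_inv (1 - s *\<^sub>C a) \<in> closure (polys a)"
proof -
  have "(\<Sum>i<n. (s *\<^sub>C a) ^ i) \<in> polys a" for n
    unfolding scaleC_power by (intro polys_sum polys.scale polys_power)
  then show ?thesis
    using neumann_series(1)[OF assms] unfolding closure_sequential sums_def
    by (intro exI[of _ "\<lambda>n. \<Sum>i<n. (s *\<^sub>C a) ^ i"]) simp
qed

text \<open>With \<open>u\<^sub>k = 1 + x\<^sub>k\<close> and \<open>v\<^sub>k = 1 + y\<^sub>k\<close> normalized resolvents, the sum is the value
  of the functional on the product of the normalized resolvents of \<open>a\<^sub>1 + a\<^sub>2\<close> and \<open>b\<^sub>1 b\<^sub>2\<close>.\<close>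

lemma resolvent_moment_series:
  fixes \<phi> :: "'a::complex_banach_algebra \<Rightarrow> complex" and x y :: "bool \<Rightarrow> 'a"
  assumes \<phi>: "clinear \<phi>" "continuous_on UNIV \<phi>"
    and moment: "\<And>ks js. alternating ks \<Longrightarrow> alternating js \<Longrightarrow>
      \<phi> (prod_list (map x ks) * prod_list (map y js)) = (if ks = js then prod_list (map p ks) else 0)"
    and small: "norm (x True * x False) < 1" "norm (c *\<^sub>C (y True * y False)) < 1"
  shows "(\<lambda>n. (c * (p True * p False)) ^ n * ((1 + p True) * (1 + p False))) sums
    \<phi> (((1 + x False) * alg_inv (1 - x True * x False) * (1 + x True)) *
       ((1 + y False) * alg_inv (1 - c *\<^sub>C (y True * y False)) * (1 + y True)))"
proof -
  let ?X = "\<lambda>n. (1 + x False) * (x True * x False) ^ n * (1 + x True)"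
  let ?Y = "\<lambda>n. (1 + y False) * (y True * y False) ^ n * (1 + y True)"
  have "(\<lambda>n. (1 + y False) * (c *\<^sub>C (y True * y False)) ^ n * (1 + y True)) sums
      ((1 + y False) * alg_inv (1 - c *\<^sub>C (y True * y False)) * (1 + y True))"
    by (intro sums_mult sums_mult2 neumann_series small)
  then have Y: "(\<lambda>n. \<Sum>m<n. c ^ m *\<^sub>C ?Y m) \<longlonglongrightarrow>
      (1 + y False) * alg_inv (1 - c *\<^sub>C (y True * y False)) * (1 + y True)"
    unfolding scaleC_power mult_scaleC_left mult_scaleC_right sums_def .
  have "?X sums ((1 + x False) * alg_inv (1 - x True * x False) * (1 + x True))"
    by (intro sums_mult sums_mult2 neumann_series small)
  then have X: "(\<lambda>n. \<Sum>m<n. ?X m) \<longlonglongrightarrow> (1 + x False) * alg_inv (1 - x True * x False) * (1 + x True)"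
    unfolding sums_def .
  \<comment> \<open>Both partial sums stop at the same \<open>n\<close>: the square double sum
    reduces to its diagonal, and a single limit remains.\<close>
  have "\<phi> ((\<Sum>i<n. ?X i) * (\<Sum>m<n. c ^ m *\<^sub>C ?Y m)) =
      (\<Sum>i<n. (c * (p True * p False)) ^ i * ((1 + p True) * (1 + p False)))" for n
  proof -
    have "\<phi> ((\<Sum>i<n. ?X i) * (\<Sum>m<n. c ^ m *\<^sub>C ?Y m)) = (\<Sum>i<n. \<Sum>m<n. c ^ m * \<phi> (?X i * ?Y m))"
      unfolding sum_product clinear_sum[OF \<phi>(1)] mult_scaleC_right clinear_scaleC[OF \<phi>(1)] scaleC_complex_def ..
    also have "\<dots> = (\<Sum>i<n. \<Sum>m<n. if m = i then c ^ i * ((p True * p False) ^ i * ((1 + p True) * (1 + p False))) else 0)"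
      unfolding alternating_series_moment[where x = x and y = y and p = p, OF \<phi>(1) moment, simplified] by (intro sum.cong refl) simp
    finally show ?thesis by (simp add: power_mult_distrib mult.assoc)
  qed
  then show ?thesis
    using tendsto_functional[OF \<phi>(2) tendsto_mult[OF X Y]] unfolding sums_def by simp
qed

section \<open>Germs of inverse functions\<close>

lemma inverse_germ:
  fixes f :: "complex \<Rightarrow> complex"
  assumes f: "f holomorphic_on S" "open S" "0 \<in> S" "f 0 = 0" "deriv f 0 \<noteq> 0"
  obtains r g where "r > 0" "inj_on f (ball 0 r)" "g analytic_on {0}" "g 0 = 0" "\<forall>\<^sub>F w in nhds 0. f (g w) = w"
proof -
  obtain r where r: "r > 0" "ball 0 r \<subseteq> S" "open (f ` ball 0 r)" "inj_on f (ball 0 r)"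
    using has_complex_derivative_locally_invertible[OF f(1,3,2,5)] by blast
  have hol: "f holomorphic_on ball 0 r" using f(1) r(2) by (rule holomorphic_on_subset)
  obtain g where g: "g holomorphic_on f ` ball 0 r" "\<And>z. z \<in> ball 0 r \<Longrightarrow> g (f z) = z"
    using holomorphic_has_inverse[OF hol open_ball r(4)] by metis
  have 0: "0 \<in> f ` ball 0 r" using f(4) r(1) by (intro image_eqI[of _ _ 0]) auto
  show thesis
  proof (rule that[OF r(1,4)])
    show "g analytic_on {0}" using g(1) r(3) 0 by (auto simp: analytic_at)
    show "g 0 = 0" using g(2)[of 0] f(4) r(1) by simp
    show "\<forall>\<^sub>F w in nhds 0. f (g w) = w"
      using eventually_nhds_in_open[OF r(3) 0] by eventually_elim (auto simp: g(2))
  qed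
qed

text \<open>The source of uniqueness for \<open>K_transform\<close> and \<open>X_transform\<close>:
  near the limit both functions take values in the disc of injectivity.\<close>

lemma inj_on_eventually_eq:
  fixes f :: "complex \<Rightarrow> complex"
  assumes "r > 0" "inj_on f (ball 0 r)" "(u \<longlongrightarrow> 0) F" "(v \<longlongrightarrow> 0) F" "\<forall>\<^sub>F t in F. f (u t) = f (v t)"
  shows "\<forall>\<^sub>F t in F. u t = v t"
proof -
  have "\<forall>\<^sub>F t in F. u t \<in> ball 0 r" "\<forall>\<^sub>F t in F. v t \<in> ball 0 r"
    using tendstoD[OF assms(3,1)] tendstoD[OF assms(4,1)] by (simp_all add: dist_commute)
  then show ?thesis
    using assms(5) by eventually_elim (use assms(2) in \<open>auto dest: inj_onD\<close>)
qed

text \<open>The \<open>+ 1\<close> makes the radius positive also for \<open>a = 0\<close>.\<close>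

lemma norm_scaleC_ball:
  fixes a :: "'a::complex_banach_algebra"
  assumes "s \<in> ball 0 (1 / (norm a + 1))"
  shows "norm (s *\<^sub>C a) < 1"
proof -
  have "cmod s * (norm a + 1) < 1"
    using assms by (simp add: pos_less_divide_eq add_nonneg_pos)
  then show ?thesis
    by (simp add: norm_scaleC algebra_simps) (use norm_ge_zero[of s] in linarith)
qed

lemma resolvent_functional_holomorphic:
  fixes \<phi> :: "'a::complex_banach_algebra \<Rightarrow> complex"
  assumes \<phi>: "clinear \<phi>" "continuous_on UNIV \<phi>"
  shows "(\<lambda>s. \<phi> (x * alg_inv (1 - s *\<^sub>C b))) holomorphic_on ball 0 (1 / (norm b + 1))"
proof (rule power_series_holomorphic)
  fix s :: complex assume "s \<in> ball 0 (1 / (norm b + 1))"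
  then have "norm (s *\<^sub>C b) < 1" by (rule norm_scaleC_ball)
  from sums_mult[OF neumann_series(1)[OF this], of x]
  have "(\<lambda>n. \<phi> (\<Sum>i<n. x * (s *\<^sub>C b) ^ i)) \<longlonglongrightarrow> \<phi> (x * alg_inv (1 - s *\<^sub>C b))"
    unfolding sums_def by (rule tendsto_functional[OF \<phi>(2)])
  then show "(\<lambda>n. \<phi> (x * b ^ n) * (s - 0) ^ n) sums \<phi> (x * alg_inv (1 - s *\<^sub>C b))"
    by (simp add: sums_def scaleC_power clinear_sum[OF \<phi>(1)] mult_scaleC_right clinear_scaleC[OF \<phi>(1)]
        scaleC_complex_def mult.commute)
qed

lemma eventually_norm_scaleC_less:
  fixes a :: "'a::complex_banach_algebra"
  assumes "(s \<longlongrightarrow> 0) F"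
  shows "\<forall>\<^sub>F t in F. norm (s t *\<^sub>C a) < 1"
proof -
  have "((\<lambda>t. s t *\<^sub>C a) \<longlongrightarrow> 0 *\<^sub>C a) F" by (intro tendsto_scaleC assms tendsto_const)
  then have "((\<lambda>t. norm (s t *\<^sub>C a)) \<longlongrightarrow> 0) F" by (intro tendsto_norm_zero) simp
  then show ?thesis by (rule order_tendstoD) simp
qed

lemma tendsto_alg_inv_scaleC:
  fixes a :: "'a::complex_banach_algebra"
  assumes "(s \<longlongrightarrow> 0) F"
  shows "((\<lambda>t. alg_inv (1 - s t *\<^sub>C a)) \<longlongrightarrow> 1) F"
proof -
  have "((\<lambda>t. s t *\<^sub>C a) \<longlongrightarrow> 0 *\<^sub>C a) F" by (intro tendsto_scaleC assms tendsto_const)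
  then show ?thesis by (intro tendsto_alg_inv_one_minus) simp
qed

lemma alg_inv_one: "alg_inv (1 :: 'a::complex_banach_algebra) = 1"
  by (rule alg_inv_eqI) (simp add: inverse_pair_def)

text \<open>Used for \<open>s * \<phi> (b * alg_inv (1 - s *\<^sub>C b))\<close>, which is psi, and
  for \<open>s * \<phi> (alg_inv (1 - s *\<^sub>C a))\<close>, which is G at 1/s; the derivatives at
  0 are \<open>\<phi> b\<close> and 1.\<close>

lemma deriv_times_ident:
  fixes k :: "complex \<Rightarrow> complex"
  assumes "open S" "0 \<in> S" "k holomorphic_on S" "\<And>s. s \<in> S \<Longrightarrow> f s = s * k s"
  shows "deriv f 0 = k 0"
proof -
  have "(k has_field_derivative deriv k 0) (at 0)"
    by (rule holomorphic_derivI[OF assms(3,1,2)])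
  from DERIV_mult[OF DERIV_ident this] have "((\<lambda>s. s * k s) has_field_derivative k 0) (at 0)" by simp
  then have "(f has_field_derivative k 0) (at 0)"
    by (rule has_field_derivative_transform_within_open[OF _ assms(1,2)]) (simp add: assms(4))
  then show ?thesis by (rule DERIV_imp_deriv)
qed

section \<open>The function \<open>\<X>\<close>\<close>

context
  fixes \<phi> :: "'a::complex_banach_algebra \<Rightarrow> complex" and b :: 'a
  assumes \<phi>: "clinear \<phi>" "continuous_on UNIV \<phi>" "\<phi> 1 = 1"
begin

lemma psi_transform_holomorphic:
  "psi_transform \<phi> b holomorphic_on ball 0 (1 / (norm b + 1))" "psi_transform \<phi> b 0 = 0"
  "deriv (psi_transform \<phi> b) 0 = \<phi> b"
proof -
  let ?B = "ball 0 (1 / (norm b + 1)) :: complex set"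
  show "psi_transform \<phi> b holomorphic_on ?B"
    unfolding psi_transform_def using resolvent_functional_holomorphic[OF \<phi>(1,2), of 1 b]
    by (intro holomorphic_intros) simp
  show "psi_transform \<phi> b 0 = 0"
    by (simp add: psi_transform_def alg_inv_one \<phi>(3))
  have "psi_transform \<phi> b s = s * \<phi> (b * alg_inv (1 - s *\<^sub>C b))" if "s \<in> ?B" for s
  proof -
    have "inverse_pair (1 - s *\<^sub>C b) (alg_inv (1 - s *\<^sub>C b))"
      by (rule neumann_series(2)[OF norm_scaleC_ball[OF that]])
    then have "alg_inv (1 - s *\<^sub>C b) - 1 = s *\<^sub>C (b * alg_inv (1 - s *\<^sub>C b))"
      by (simp add: inverse_pair_def algebra_simps mult_scaleC_left)
    then have "\<phi> (alg_inv (1 - s *\<^sub>C b) - 1) = s * \<phi> (b * alg_inv (1 - s *\<^sub>C b))"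
      by (simp add: clinear_scaleC[OF \<phi>(1)] scaleC_complex_def)
    then show ?thesis by (simp add: psi_transform_def clinear_diff[OF \<phi>(1)] \<phi>(3))
  qed
  from deriv_times_ident[OF open_ball _ resolvent_functional_holomorphic[OF \<phi>(1,2)] this]
  show "deriv (psi_transform \<phi> b) 0 = \<phi> b"
    by (simp add: alg_inv_one add_nonneg_pos)
qed

text \<open>Psi has derivative \<open>\<phi> b\<close> at 0, so a local inverse exists and the
  choice is justified. For uniqueness a candidate is identified by its limit 0 and the functional
  equation alone.\<close>

lemma
  assumes b: "\<phi> b \<noteq> 0"
  shows X_transform: "X_transform \<phi> b analytic_on {0}" "X_transform \<phi> b 0 = 0"
      "\<forall>\<^sub>F w in nhds 0. psi_transform \<phi> b (X_transform \<phi> b w) = w"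
    and X_transform_unique: "\<And>u. (u \<longlongrightarrow> 0) (at 0) \<Longrightarrow>
      \<forall>\<^sub>F w in at 0. psi_transform \<phi> b (u w) = w \<Longrightarrow> \<forall>\<^sub>F w in at 0. u w = X_transform \<phi> b w"
proof -
  have 0: "0 \<in> ball (0::complex) (1 / (norm b + 1))" and d: "deriv (psi_transform \<phi> b) 0 \<noteq> 0"
    by (simp_all add: add_nonneg_pos psi_transform_holomorphic b)
  obtain r g where r: "r > 0" "inj_on (psi_transform \<phi> b) (ball 0 r)"
    and g: "g analytic_on {0}" "g 0 = 0" "\<forall>\<^sub>F w in nhds 0. psi_transform \<phi> b (g w) = w"
    by (rule inverse_germ[OF psi_transform_holomorphic(1) open_ball 0 psi_transform_holomorphic(2) d])
  have "\<exists>X. X analytic_on {0} \<and> X 0 = 0 \<and> (\<forall>\<^sub>F w in nhds 0. psi_transform \<phi> b (X w) = w)"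
    using g by blast
  from someI_ex[OF this, folded X_transform_def]
  show X: "X_transform \<phi> b analytic_on {0}" "X_transform \<phi> b 0 = 0"
      "\<forall>\<^sub>F w in nhds 0. psi_transform \<phi> b (X_transform \<phi> b w) = w" by simp_all
  fix u assume u: "(u \<longlongrightarrow> 0) (at 0)" "\<forall>\<^sub>F w in at 0. psi_transform \<phi> b (u w) = w"
  have "isCont (X_transform \<phi> b) 0"
    using X(1) by (simp add: analytic_at_imp_isCont)
  then have "(X_transform \<phi> b \<longlongrightarrow> 0) (at 0)" using X(2) by (simp add: isCont_def)
  moreover have "\<forall>\<^sub>F w in at 0. psi_transform \<phi> b (X_transform \<phi> b w) = w"
    using X(3) by (simp add: eventually_at_filter eventually_mono)
  then have "\<forall>\<^sub>F w in at 0. psi_transform \<phi> b (u w) = psi_transform \<phi> b (X_transform \<phi> b w)"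
    using u(2) by eventually_elim simp
  ultimately show "\<forall>\<^sub>F w in at 0. u w = X_transform \<phi> b w"
    by (intro inj_on_eventually_eq[OF r u(1)])
qed

definition norm_resolvent_X :: "complex \<Rightarrow> 'a"
  where "norm_resolvent_X w = (1 / (1 + w)) *\<^sub>C alg_inv (1 - X_transform \<phi> b w *\<^sub>C b)"

text \<open>The second and fourth limits come from differentiability of \<open>X_transform\<close>
  at 0. They compensate the pole of (w + 1) / w, in the candidate for the product and in its Neumann
  series respectively.\<close>

lemma norm_resolvent_X:
  assumes b: "\<phi> b \<noteq> 0"
  shows "(X_transform \<phi> b \<longlongrightarrow> 0) (at 0)"
    and "\<exists>D. ((\<lambda>w. X_transform \<phi> b w / w) \<longlongrightarrow> D) (at 0)"
    and "(norm_resolvent_X \<longlongrightarrow> 1) (at 0)"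
    and "\<exists>l. ((\<lambda>w. (1 / w) *\<^sub>C (norm_resolvent_X w - 1)) \<longlongrightarrow> l) (at 0)"
    and "\<forall>\<^sub>F w in at 0. w \<noteq> 0 \<and> 1 + w \<noteq> 0 \<and> norm_resolvent_X w \<in> closure (polys b) \<and>
      \<phi> (norm_resolvent_X w) = 1 \<and>
      inverse_pair ((1 + w) *\<^sub>C (1 - X_transform \<phi> b w *\<^sub>C b)) (norm_resolvent_X w)"
proof -
  let ?X = "X_transform \<phi> b"
  note X = X_transform[OF b]
  have "isCont ?X 0" using X(1) by (simp add: analytic_at_imp_isCont)
  then show X0: "(?X \<longlongrightarrow> 0) (at 0)" using X(2) by (simp add: isCont_def)
  have "?X field_differentiable at 0" using X(1) by (simp add: analytic_on_imp_differentiable_at)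
  then obtain D where "(?X has_field_derivative D) (at 0)" by (auto simp: field_differentiable_def)
  then have D: "((\<lambda>w. ?X w / w) \<longlongrightarrow> D) (at 0)" using X(2) by (simp add: DERIV_def)
  then show "\<exists>D. ((\<lambda>w. ?X w / w) \<longlongrightarrow> D) (at 0)" ..
  have R: "((\<lambda>w. alg_inv (1 - ?X w *\<^sub>C b)) \<longlongrightarrow> 1) (at 0)"
    by (rule tendsto_alg_inv_scaleC[OF X0])
  have w1: "((\<lambda>w. 1 / (1 + w)) \<longlongrightarrow> 1 / (1 + 0)) (at (0::complex))"
    by (intro tendsto_intros) simp
  from tendsto_scaleC[OF this R] show "(norm_resolvent_X \<longlongrightarrow> 1) (at 0)"
    by (simp add: norm_resolvent_X_def[abs_def] scaleC_one)
  have ne0: "\<forall>\<^sub>F w in at (0::complex). w \<noteq> 0" by (simp add: eventually_at_filter)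
  have "((\<lambda>w. 1 + w) \<longlongrightarrow> 1 + 0) (at (0::complex))" by (intro tendsto_intros)
  then have ne1: "\<forall>\<^sub>F w in at (0::complex). 1 + w \<noteq> 0"
    by (intro tendsto_imp_eventually_ne) auto
  have small: "\<forall>\<^sub>F w in at 0. norm (?X w *\<^sub>C b) < 1"
    by (rule eventually_norm_scaleC_less[OF X0])
  have psi: "\<forall>\<^sub>F w in at 0. psi_transform \<phi> b (?X w) = w"
    using X(3) by (simp add: eventually_at_filter eventually_mono)
  show "\<forall>\<^sub>F w in at 0. w \<noteq> 0 \<and> 1 + w \<noteq> 0 \<and> norm_resolvent_X w \<in> closure (polys b) \<and>
      \<phi> (norm_resolvent_X w) = 1 \<and> inverse_pair ((1 + w) *\<^sub>C (1 - ?X w *\<^sub>C b)) (norm_resolvent_X w)"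
    using ne0 ne1 small psi
  proof eventually_elim
    case (elim w)
    have "\<phi> (alg_inv (1 - ?X w *\<^sub>C b)) = 1 + w"
      using elim(4) by (simp add: psi_transform_def algebra_simps)
    then have "\<phi> (norm_resolvent_X w) = 1"
      using elim(2) by (simp add: norm_resolvent_X_def clinear_scaleC[OF \<phi>(1)] scaleC_complex_def)
    moreover have "inverse_pair ((1 + w) *\<^sub>C (1 - ?X w *\<^sub>C b)) (norm_resolvent_X w)"
      unfolding norm_resolvent_X_def using elim
      by (intro inverse_pair_scaleC neumann_series(2)) auto
    moreover have "norm_resolvent_X w \<in> closure (polys b)"
      unfolding norm_resolvent_X_def by (rule closure_polys_scale[OF closure_polys_alg_inv[OF elim(3)]])
    ultimately show ?case using elim by simp
  qed
  \<comment> \<open>With R the inverse of 1 - X b one has R - 1 = X b R, which expresses the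
    difference quotient through X / w, whose limit is known.\<close>
  have "\<forall>\<^sub>F w in at 0. (1 / (1 + w)) *\<^sub>C ((?X w / w) *\<^sub>C (b * alg_inv (1 - ?X w *\<^sub>C b)) - 1) =
      (1 / w) *\<^sub>C (norm_resolvent_X w - 1)"
    using ne0 ne1 small
  proof eventually_elim
    case (elim w)
    let ?R = "alg_inv (1 - ?X w *\<^sub>C b)"
    have "inverse_pair (1 - ?X w *\<^sub>C b) ?R" by (rule neumann_series(2)[OF elim(3)])
    then have R: "?X w *\<^sub>C (b * ?R) = ?R - 1"
      by (simp add: inverse_pair_def algebra_simps mult_scaleC_left)
    have "w *\<^sub>C ((?X w / w) *\<^sub>C (b * ?R) - 1) = (?R - 1) - w *\<^sub>C 1"
      using elim(1) R by (simp add: complex_vector.scale_right_diff_distrib scaleC_scaleC)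
    also have "\<dots> = ?R - (1 + w) *\<^sub>C 1"
      by (simp add: scaleC_add_left scaleC_one algebra_simps)
    finally have *: "w *\<^sub>C ((?X w / w) *\<^sub>C (b * ?R) - 1) = ?R - (1 + w) *\<^sub>C 1" .
    have "(1 / (1 + w)) *\<^sub>C ((?X w / w) *\<^sub>C (b * ?R) - 1) =
        (1 / w) *\<^sub>C (1 / (1 + w)) *\<^sub>C (w *\<^sub>C ((?X w / w) *\<^sub>C (b * ?R) - 1))"
      using elim(1) by (simp add: scaleC_scaleC)
    also have "\<dots> = (1 / w) *\<^sub>C (norm_resolvent_X w - 1)"
      unfolding * norm_resolvent_X_def using elim(2)
      by (simp add: complex_vector.scale_right_diff_distrib scaleC_scaleC scaleC_one)
    finally show ?case .
  qed
  moreover have "((\<lambda>w. (1 / (1 + w)) *\<^sub>C ((?X w / w) *\<^sub>C (b * alg_inv (1 - ?X w *\<^sub>C b)) - 1)) \<longlongrightarrow>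
      (1 / (1 + 0)) *\<^sub>C (D *\<^sub>C (b * 1) - 1)) (at 0)"
    by (intro tendsto_scaleC w1 tendsto_diff tendsto_const D tendsto_mult R)
  ultimately have "((\<lambda>w. (1 / w) *\<^sub>C (norm_resolvent_X w - 1)) \<longlongrightarrow>
      (1 / (1 + 0)) *\<^sub>C (D *\<^sub>C (b * 1) - 1)) (at 0)"
    by (rule Lim_transform_eventually[rotated])
  then show "\<exists>l. ((\<lambda>w. (1 / w) *\<^sub>C (norm_resolvent_X w - 1)) \<longlongrightarrow> l) (at 0)" ..
qed

end

section \<open>The function \<open>K\<close>\<close>

context
  fixes \<phi> :: "'a::complex_banach_algebra \<Rightarrow> complex" and a :: 'a
  assumes \<phi>: "clinear \<phi>" "continuous_on UNIV \<phi>" "\<phi> 1 = 1"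
begin

text \<open>The substitution t = 1 / s moves infinity to 0 and makes the resolvent a Neumann
  series.\<close>

lemma resolvent_at_inverse:
  assumes "s \<noteq> 0" "norm (s *\<^sub>C a) < 1"
  shows "inverse_pair ((1 / s) *\<^sub>C 1 - a) (s *\<^sub>C alg_inv (1 - s *\<^sub>C a))"
    and "G_transform \<phi> a (1 / s) = s * \<phi> (alg_inv (1 - s *\<^sub>C a))"
proof -
  have "(1 / s) *\<^sub>C 1 - a = (1 / s) *\<^sub>C (1 - s *\<^sub>C a)"
    using assms(1) by (simp add: complex_vector.scale_right_diff_distrib scaleC_scaleC scaleC_one)
  then show i: "inverse_pair ((1 / s) *\<^sub>C 1 - a) (s *\<^sub>C alg_inv (1 - s *\<^sub>C a))"
    using assms by (simp add: inverse_pair_scaleC neumann_series)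
  show "G_transform \<phi> a (1 / s) = s * \<phi> (alg_inv (1 - s *\<^sub>C a))"
    unfolding G_transform_def alg_inv_eqI[OF i] by (simp add: clinear_scaleC[OF \<phi>(1)] scaleC_complex_def)
qed

lemma tendsto_inverse_K:
  "filterlim K at_infinity F \<Longrightarrow> ((\<lambda>z. 1 / K z :: complex) \<longlongrightarrow> 0) F"
  using filterlim_compose[OF tendsto_inverse_0] by (simp add: inverse_eq_divide)

lemma eventually_G_transform:
  assumes "filterlim K at_infinity F"
  shows "\<forall>\<^sub>F z in F. K z \<noteq> 0 \<and> norm ((1 / K z) *\<^sub>C a) < 1 \<and>
    G_transform \<phi> a (K z) = 1 / K z * \<phi> (alg_inv (1 - (1 / K z) *\<^sub>C a))"
proof -
  have "\<forall>\<^sub>F z in F. K z \<noteq> 0"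
    using assms by (simp add: filterlim_at_infinity_imp_eventually_ne)
  with eventually_norm_scaleC_less[OF tendsto_inverse_K[OF assms], of a] show ?thesis
  proof eventually_elim
    case (elim z)
    then show ?case using resolvent_at_inverse(2)[of "1 / K z"] by simp
  qed
qed

text \<open>K is the reciprocal of a local inverse of s \<mapsto> G(1 / s), whose derivative at 0 is
  \<open>\<phi> 1 = 1\<close>. For uniqueness the reciprocals are compared near 0.\<close>

lemma
  shows K_transform: "filterlim (K_transform \<phi> a) at_infinity (at 0)"
      "\<forall>\<^sub>F z in at 0. G_transform \<phi> a (K_transform \<phi> a z) = z"
    and K_transform_unique: "\<And>K. filterlim K at_infinity (at 0) \<Longrightarrow>
      \<forall>\<^sub>F z in at 0. G_transform \<phi> a (K z) = z \<Longrightarrow> \<forall>\<^sub>F z in at 0. K z = K_transform \<phi> a z"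
proof -
  let ?k = "\<lambda>s. \<phi> (alg_inv (1 - s *\<^sub>C a))"
  let ?g = "\<lambda>s. s * ?k s" and ?B = "ball 0 (1 / (norm a + 1)) :: complex set"
  have k: "?k holomorphic_on ?B"
    using resolvent_functional_holomorphic[OF \<phi>(1,2), of 1 a] by simp
  then have g: "?g holomorphic_on ?B" by (intro holomorphic_intros)
  have 0: "0 \<in> ?B" by (simp add: add_nonneg_pos)
  have "deriv ?g 0 = ?k 0" by (rule deriv_times_ident[OF open_ball 0 k refl])
  then have dg: "deriv ?g 0 \<noteq> 0" by (simp add: alg_inv_one \<phi>(3))
  have g0: "?g 0 = 0" by simp
  obtain r \<gamma> where r: "r > 0" "inj_on ?g (ball 0 r)"
    and \<gamma>: "\<gamma> analytic_on {0}" "\<gamma> 0 = 0" "\<forall>\<^sub>F z in nhds 0. ?g (\<gamma> z) = z"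
    by (rule inverse_germ[OF g open_ball 0 g0 dg])
  have "isCont \<gamma> 0" using \<gamma>(1) by (simp add: analytic_at_imp_isCont)
  then have \<gamma>0: "(\<gamma> \<longlongrightarrow> 0) (at 0)" using \<gamma>(2) by (simp add: isCont_def)
  have "\<forall>\<^sub>F z in at 0. ?g (\<gamma> z) = z"
    using \<gamma>(3) by (simp add: eventually_at_filter eventually_mono)
  moreover have "\<forall>\<^sub>F z in at (0::complex). z \<noteq> 0" by (simp add: eventually_at_filter)
  \<comment> \<open>A zero of \<open>\<gamma>\<close> would force z = 0, so the reciprocal of
    \<open>\<gamma>\<close> does tend to infinity.\<close>
  ultimately have \<gamma>_ne: "\<forall>\<^sub>F z in at 0. \<gamma> z \<noteq> 0 \<and> ?g (\<gamma> z) = z"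
    by eventually_elim auto
  then have "filterlim \<gamma> (at 0) (at 0)"
    using \<gamma>0 by (intro filterlim_atI) (auto elim: eventually_mono)
  then have lim: "filterlim (\<lambda>z. 1 / \<gamma> z) at_infinity (at 0)"
    using filterlim_compose[OF filterlim_inverse_at_infinity] by (simp add: inverse_eq_divide)
  have "\<forall>\<^sub>F z in at 0. G_transform \<phi> a (1 / \<gamma> z) = z"
    using \<gamma>_ne eventually_norm_scaleC_less[OF \<gamma>0, of a]
    by eventually_elim (simp add: resolvent_at_inverse(2))
  with lim have "\<exists>K. (\<forall>\<^sub>F z in at 0. G_transform \<phi> a (K z) = z) \<and> filterlim K at_infinity (at 0)"
    by (intro exI[of _ "\<lambda>z. 1 / \<gamma> z"] conjI)
  from someI_ex[OF this, folded K_transform_def]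
  show K: "filterlim (K_transform \<phi> a) at_infinity (at 0)"
      "\<forall>\<^sub>F z in at 0. G_transform \<phi> a (K_transform \<phi> a z) = z" by simp_all
  fix K assume K': "filterlim K at_infinity (at 0)" "\<forall>\<^sub>F z in at 0. G_transform \<phi> a (K z) = z"
  have "\<forall>\<^sub>F z in at 0. ?g (1 / K z) = ?g (1 / K_transform \<phi> a z)"
    using K'(2) K(2) eventually_G_transform[OF K'(1)] eventually_G_transform[OF K(1)]
    by eventually_elim auto
  from inj_on_eventually_eq[OF r tendsto_inverse_K[OF K'(1)] tendsto_inverse_K[OF K(1)] this]
  show "\<forall>\<^sub>F z in at 0. K z = K_transform \<phi> a z"
    by eventually_elim simp
qed

definition norm_resolvent_K :: "complex \<Rightarrow> 'a"
  where "norm_resolvent_K z = (1 / z) *\<^sub>C alg_inv (K_transform \<phi> a z *\<^sub>C 1 - a)"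

text \<open>With R the inverse of 1 - a / K, the equation G(K) = z reads
  \<open>\<phi> R = z K\<close>. As R tends to 1, so does z K, and the normalized resolvent is R /
  (z K).\<close>

lemma norm_resolvent_K:
  shows "((\<lambda>z. z * K_transform \<phi> a z) \<longlongrightarrow> 1) (at 0)"
    and "(norm_resolvent_K \<longlongrightarrow> 1) (at 0)"
    and "\<forall>\<^sub>F z in at 0. z \<noteq> 0 \<and> norm_resolvent_K z \<in> closure (polys a) \<and>
      \<phi> (norm_resolvent_K z) = 1 \<and>
      inverse_pair (z *\<^sub>C (K_transform \<phi> a z *\<^sub>C 1 - a)) (norm_resolvent_K z)"
proof -
  let ?K = "K_transform \<phi> a"
  let ?R = "\<lambda>z. alg_inv (1 - (1 / ?K z) *\<^sub>C a)"
  have R: "(?R \<longlongrightarrow> 1) (at 0)"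
    by (rule tendsto_alg_inv_scaleC[OF tendsto_inverse_K[OF K_transform(1)]])
  then have "((\<lambda>z. \<phi> (?R z)) \<longlongrightarrow> 1) (at 0)"
    using tendsto_functional[OF \<phi>(2) R] \<phi>(3) by simp
  moreover have ne0: "\<forall>\<^sub>F z in at (0::complex). z \<noteq> 0" by (simp add: eventually_at_filter)
  have ev: "\<forall>\<^sub>F z in at 0. z \<noteq> 0 \<and> ?K z \<noteq> 0 \<and> norm ((1 / ?K z) *\<^sub>C a) < 1 \<and> \<phi> (?R z) = z * ?K z"
    using ne0 eventually_G_transform[OF K_transform(1)] K_transform(2)
    by eventually_elim (auto simp: field_simps)
  then have "\<forall>\<^sub>F z in at 0. \<phi> (?R z) = z * ?K z" by (rule eventually_mono) simp
  ultimately show zK: "((\<lambda>z. z * ?K z) \<longlongrightarrow> 1) (at 0)" by (rule Lim_transform_eventually)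
  have inv: "norm_resolvent_K z = (1 / (z * ?K z)) *\<^sub>C ?R z"
      "inverse_pair (?K z *\<^sub>C 1 - a) (alg_inv (?K z *\<^sub>C 1 - a))"
    if "?K z \<noteq> 0" "norm ((1 / ?K z) *\<^sub>C a) < 1" for z
  proof -
    have i: "inverse_pair (?K z *\<^sub>C 1 - a) ((1 / ?K z) *\<^sub>C ?R z)"
      using resolvent_at_inverse(1)[of "1 / ?K z"] that by simp
    show "norm_resolvent_K z = (1 / (z * ?K z)) *\<^sub>C ?R z"
      unfolding norm_resolvent_K_def alg_inv_eqI[OF i] by (simp add: scaleC_scaleC)
    show "inverse_pair (?K z *\<^sub>C 1 - a) (alg_inv (?K z *\<^sub>C 1 - a))"
      using i alg_inv_eqI[OF i] by simp
  qed
  have "((\<lambda>z. (1 / (z * ?K z)) *\<^sub>C ?R z) \<longlongrightarrow> (1 / 1) *\<^sub>C 1) (at 0)"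
    by (intro tendsto_scaleC tendsto_divide tendsto_const zK R) simp
  moreover have "\<forall>\<^sub>F z in at 0. (1 / (z * ?K z)) *\<^sub>C ?R z = norm_resolvent_K z"
    using ev by eventually_elim (simp add: inv(1))
  ultimately show "(norm_resolvent_K \<longlongrightarrow> 1) (at 0)"
    by (simp add: Lim_transform_eventually scaleC_one)
  show "\<forall>\<^sub>F z in at 0. z \<noteq> 0 \<and> norm_resolvent_K z \<in> closure (polys a) \<and> \<phi> (norm_resolvent_K z) = 1 \<and>
      inverse_pair (z *\<^sub>C (?K z *\<^sub>C 1 - a)) (norm_resolvent_K z)"
    using ev
  proof eventually_elim
    case (elim z)
    then have *: "norm_resolvent_K z = (1 / (z * ?K z)) *\<^sub>C ?R z" by (simp add: inv(1))
    have "norm_resolvent_K z \<in> closure (polys a)" unfolding *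
      using elim by (intro closure_polys_scale closure_polys_alg_inv) simp
    moreover have "\<phi> (norm_resolvent_K z) = 1"
      using elim unfolding * by (simp add: clinear_scaleC[OF \<phi>(1)] scaleC_complex_def)
    moreover have "inverse_pair (z *\<^sub>C (?K z *\<^sub>C 1 - a)) (norm_resolvent_K z)"
      unfolding norm_resolvent_K_def using elim by (intro inverse_pair_scaleC inv(2)) auto
    ultimately show ?case using elim by simp
  qed
qed

end

section \<open>The transforms of sums and products\<close>

text \<open>\<open>A1 * u1 = 1\<close> and \<open>u2 * A2 = 1\<close> cancel at the outer ends, so
  A1 (1 - (u1 - 1) (u2 - 1)) A2 = A1 + A2 - 1. For \<open>A_k = z (K_k - a_k)\<close> the right side
  is z (K - a1 - a2) with K = K1 + K2 - 1 / z; this is the origin of the formula for K.\<close>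

lemma inverse_pair_add:
  fixes u1 u2 :: "'a::ring_1"
  assumes 1: "inverse_pair A1 u1" and 2: "inverse_pair A2 u2"
    and n: "inverse_pair (1 - (u1 - 1) * (u2 - 1)) n"
  shows "inverse_pair (A1 + A2 - 1) (u2 * n * u1)"
proof -
  have c: "A1 * u1 = 1" "u2 * A2 = 1" using 1 2 by (auto simp: inverse_pair_def)
  have "A1 * (1 - (u1 - 1) * (u2 - 1)) * A2 =
      (A1 * u1) * A2 + A1 * (u2 * A2) - (A1 * u1) * (u2 * A2)"
    by (simp add: algebra_simps)
  then have "A1 * (1 - (u1 - 1) * (u2 - 1)) * A2 = A1 + A2 - 1"
    unfolding c by (simp add: algebra_simps)
  then show ?thesis
    using inverse_pair_mult[OF inverse_pair_mult[OF 1 n] 2] by (simp add: mult.assoc)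
qed

text \<open>The same cancellation gives B1 (1 - c (v1 - 1) (v2 - 1)) B2 = B1 B2 - c (1 - B1) (1 -
  B2), to be matched with 1 - c (1 - D B1) (1 - D B2) after scaling by D.\<close>

lemma inverse_pair_product:
  fixes v1 v2 b1 b2 :: "'a::complex_banach_algebra"
  assumes 1: "inverse_pair ((1 + w) *\<^sub>C (1 - s1 *\<^sub>C b1)) v1"
    and 2: "inverse_pair ((1 + w) *\<^sub>C (1 - s2 *\<^sub>C b2)) v2"
    and m: "inverse_pair (1 - c *\<^sub>C ((v1 - 1) * (v2 - 1))) m"
    and c: "c = (w + 1) / w" and w: "w \<noteq> 0" "1 + w \<noteq> 0"
  shows "inverse_pair (1 - (s1 * s2 * c) *\<^sub>C (b1 * b2)) ((1 + w) *\<^sub>C (v2 * m * v1))"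
proof -
  define B1 B2 where "B1 = (1 + w) *\<^sub>C (1 - s1 *\<^sub>C b1)" and "B2 = (1 + w) *\<^sub>C (1 - s2 *\<^sub>C b2)"
  define D where "D = 1 / (1 + w)"
  \<comment> \<open>This equation determines c: it matches the constant terms and the terms with
    \<open>B1 * B2\<close>, while the linear terms agree anyway.\<close>
  have cD: "c * D = c - 1" "D * (1 + w) = 1"
    using w by (simp_all add: c D_def field_simps)
  have s: "s1 *\<^sub>C b1 = 1 - D *\<^sub>C B1" "s2 *\<^sub>C b2 = 1 - D *\<^sub>C B2"
    by (simp_all add: B1_def B2_def scaleC_scaleC cD scaleC_one)
  have q: "B1 * v1 = 1" "v2 * B2 = 1"
    using 1 2 by (auto simp: inverse_pair_def B1_def B2_def)
  have "B1 * ((v1 - 1) * (v2 - 1)) * B2 = (B1 * v1 - B1) * (v2 * B2 - B2)"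
    by (simp add: algebra_simps)
  then have e: "B1 * ((v1 - 1) * (v2 - 1)) * B2 = (1 - B1) * (1 - B2)" by (simp add: q)
  have "B1 * (1 - c *\<^sub>C ((v1 - 1) * (v2 - 1))) * B2 = B1 * B2 - c *\<^sub>C (B1 * ((v1 - 1) * (v2 - 1)) * B2)"
    by (simp add: right_diff_distrib left_diff_distrib mult_scaleC_left mult_scaleC_right)
  also have "\<dots> = B1 * B2 - c *\<^sub>C ((1 - B1) * (1 - B2))" unfolding e ..
  finally have "D *\<^sub>C (B1 * (1 - c *\<^sub>C ((v1 - 1) * (v2 - 1))) * B2) =
      D *\<^sub>C (B1 * B2) - (c * D) *\<^sub>C ((1 - B1) * (1 - B2))"
    by (simp add: complex_vector.scale_right_diff_distrib scaleC_scaleC mult.commute)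
  also have "\<dots> = 1 - c *\<^sub>C ((1 - D *\<^sub>C B1) * (1 - D *\<^sub>C B2))"
  proof -
    have e1: "c *\<^sub>C ((1 - D *\<^sub>C B1) * (1 - D *\<^sub>C B2)) =
        c *\<^sub>C 1 - (c * D) *\<^sub>C B1 - (c * D) *\<^sub>C B2 + (c * D * D) *\<^sub>C (B1 * B2)"
      by (simp add: algebra_simps mult_scaleC_left mult_scaleC_right scaleC_scaleC scaleC_add_right
          complex_vector.scale_right_diff_distrib)
    have e2: "c * D * D = c * D - D" using cD(1) by (simp add: left_diff_distrib)
    have e3: "B1 * B2 + (D * c) *\<^sub>C (B1 * B2) = c *\<^sub>C (B1 * B2)"
      using scaleC_add_left[of 1 "D * c" "B1 * B2"] cD(1) by (simp add: scaleC_one mult.commute)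
    show ?thesis
      unfolding e1 e2 cD(1) using e3 by (simp add: algebra_simps complex_vector.scale_left_diff_distrib
          complex_vector.scale_right_diff_distrib scaleC_add_right scaleC_one)
  qed
  also have "\<dots> = 1 - (s1 * s2 * c) *\<^sub>C (b1 * b2)"
    unfolding s[symmetric] by (simp add: mult_scaleC_left mult_scaleC_right scaleC_scaleC ac_simps)
  finally have "1 - (s1 * s2 * c) *\<^sub>C (b1 * b2) = D *\<^sub>C (B1 * (1 - c *\<^sub>C ((v1 - 1) * (v2 - 1))) * B2)" ..
  moreover have "inverse_pair (B1 * (1 - c *\<^sub>C ((v1 - 1) * (v2 - 1))) * B2) (v2 * m * v1)"
    using inverse_pair_mult[OF inverse_pair_mult[OF 1 m] 2] by (simp add: mult.assoc B1_def B2_def)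
  ultimately show ?thesis
    using inverse_pair_scaleC[OF _ cD(2)] by simp
qed

lemma eventually_norm_product:
  fixes f g :: "'t \<Rightarrow> 'a::real_normed_algebra"
  assumes "(f \<longlongrightarrow> l) F" "(g \<longlongrightarrow> 0) F"
  shows "\<forall>\<^sub>F t in F. norm (f t * g t) < 1"
proof -
  have "((\<lambda>t. f t * g t) \<longlongrightarrow> l * 0) F" by (rule tendsto_mult[OF assms])
  then have "((\<lambda>t. norm (f t * g t)) \<longlongrightarrow> 0) F" by (intro tendsto_norm_zero) simp
  then show ?thesis by (rule order_tendstoD) simp
qed

context
  fixes \<phi> :: "'a::complex_banach_algebra \<Rightarrow> complex" and a1 b1 a2 b2 :: 'a
  assumes \<phi>: "clinear \<phi>" "continuous_on UNIV \<phi>" "\<phi> 1 = 1"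
    and bf: "bi_free TYPE('x::complex_vector) TYPE('y::complex_vector) \<phi> a1 b1 a2 b2"
begin

lemma bi_free_resolvent_series:
  assumes u: "u1 \<in> closure (polys a1)" "u2 \<in> closure (polys a2)" "\<phi> u1 = 1" "\<phi> u2 = 1"
    and v: "v1 \<in> closure (polys b1)" "v2 \<in> closure (polys b2)" "\<phi> v1 = 1" "\<phi> v2 = 1"
    and small: "norm ((u1 - 1) * (u2 - 1)) < 1" "norm (c *\<^sub>C ((v1 - 1) * (v2 - 1))) < 1"
  shows "(\<lambda>n. (c * ((\<phi> (u1 * v1) - 1) * (\<phi> (u2 * v2) - 1))) ^ n * (\<phi> (u1 * v1) * \<phi> (u2 * v2))) sums
    \<phi> ((u2 * alg_inv (1 - (u1 - 1) * (u2 - 1)) * u1) *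
       (v2 * alg_inv (1 - c *\<^sub>C ((v1 - 1) * (v2 - 1))) * v1))"
proof -
  define x where "x k = (if k then u1 else u2) - 1" for k
  define y where "y k = (if k then v1 else v2) - 1" for k
  have one: "1 \<in> closure (polys a)" for a :: 'a
    using polys.one closure_subset by blast
  have x: "x k \<in> closure (polys (if k then a1 else a2))" "\<phi> (x k) = 0"
    and y: "y k \<in> closure (polys (if k then b1 else b2))" "\<phi> (y k) = 0" for k
    using u v by (auto simp: x_def y_def clinear_diff[OF \<phi>(1)] \<phi>(3) intro!: closure_polys_diff one)
  have p: "\<phi> (x True * y True) = \<phi> (u1 * v1) - 1" "\<phi> (x False * y False) = \<phi> (u2 * v2) - 1"
    using u v by (simp_all add: x_def y_def left_diff_distrib right_diff_distrib clinear_diff[OF \<phi>(1)] \<phi>(3))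
  have "norm (x True * x False) < 1" "norm (c *\<^sub>C (y True * y False)) < 1"
    using small by (simp_all add: x_def y_def)
  from resolvent_moment_series[where p = "\<lambda>k. \<phi> (x k * y k)",
      OF \<phi>(1,2) bi_free_closure_moments[OF \<phi> bf x y] this]
  show ?thesis unfolding p by (simp add: x_def y_def)
qed

text \<open>For \<open>v1 = v2 = 1\<close> and \<open>c = 0\<close> the right-hand factor is 1 and
  the series has the single term 1. This becomes the equation G(K) = z for the sum; its right-hand
  counterpart gives the equation for psi.\<close>

lemma bi_free_left_moment:
  assumes "u1 \<in> closure (polys a1)" "u2 \<in> closure (polys a2)" "\<phi> u1 = 1" "\<phi> u2 = 1"
    and "norm ((u1 - 1) * (u2 - 1)) < 1"
  shows "\<phi> (u2 * alg_inv (1 - (u1 - 1) * (u2 - 1)) * u1) = 1"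
proof -
  have one: "1 \<in> closure (polys a)" for a :: 'a
    using polys.one closure_subset by blast
  have "(\<lambda>n. 0 ^ n) sums \<phi> (u2 * alg_inv (1 - (u1 - 1) * (u2 - 1)) * u1)"
    using bi_free_resolvent_series[OF assms(1-4) one one \<phi>(3) \<phi>(3) assms(5), of 0] assms(3,4)
    by (simp add: alg_inv_one)
  then show ?thesis using geometric_sums[of "0::complex"] by (simp add: sums_unique2)
qed

lemma bi_free_right_moment:
  assumes "v1 \<in> closure (polys b1)" "v2 \<in> closure (polys b2)" "\<phi> v1 = 1" "\<phi> v2 = 1"
    and "norm (c *\<^sub>C ((v1 - 1) * (v2 - 1))) < 1"
  shows "\<phi> (v2 * alg_inv (1 - c *\<^sub>C ((v1 - 1) * (v2 - 1))) * v1) = 1"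
proof -
  have one: "1 \<in> closure (polys a)" for a :: 'a
    using polys.one closure_subset by blast
  have "(\<lambda>n. 0 ^ n) sums \<phi> (v2 * alg_inv (1 - c *\<^sub>C ((v1 - 1) * (v2 - 1))) * v1)"
    using bi_free_resolvent_series[OF one one \<phi>(3) \<phi>(3) assms(1-4) _ assms(5)] assms(3,4)
    by (simp add: alg_inv_one)
  then show ?thesis using geometric_sums[of "0::complex"] by (simp add: sums_unique2)
qed

text \<open>The moment formula with the empty left word and the right word
  \<open>[True, False]\<close>. It makes \<open>\<phi> (b1 * b2)\<close> nonzero, so
  \<open>X_transform\<close> of the product is a genuine local inverse.\<close>

lemma bi_free_mult_right: "\<phi> (b1 * b2) = \<phi> b1 * \<phi> b2"
proof -
  define y where "y k = (if k then b1 - \<phi> b1 *\<^sub>C 1 else b2 - \<phi> b2 *\<^sub>C 1)" for k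
  have cl: "y k \<in> closure (polys (if k then b1 else b2))" for k
    unfolding y_def
    by (auto intro!: closure_subset[THEN subsetD] polys_diff polys_self polys.scale polys.one)
  have "\<phi> (y k) = 0" for k
    by (simp add: y_def clinear_diff[OF \<phi>(1)] clinear_scaleC[OF \<phi>(1)] \<phi>(3) scaleC_complex_def)
  moreover have "0 \<in> closure (polys a)" for a :: 'a using zero_polys closure_subset by blast
  ultimately have "\<phi> (y True * y False) = 0"
    using bi_free_closure_moments[OF \<phi> bf, of "\<lambda>_. 0" y "[]" "[True, False]"] cl
    by (simp add: clinear_zero[OF \<phi>(1)])
  then show ?thesis
    by (simp add: y_def left_diff_distrib right_diff_distrib mult_scaleC_left mult_scaleC_right
        clinear_diff[OF \<phi>(1)] clinear_scaleC[OF \<phi>(1)] scaleC_complex_def \<phi>(3))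
qed

lemma eventually_small_left: "\<forall>\<^sub>F z in at 0. norm ((norm_resolvent_K \<phi> a1 z - 1) * (norm_resolvent_K \<phi> a2 z - 1)) < 1"
proof -
  have "((\<lambda>z. norm_resolvent_K \<phi> a1 z - 1) \<longlongrightarrow> 1 - 1) (at 0)" "((\<lambda>z. norm_resolvent_K \<phi> a2 z - 1) \<longlongrightarrow> 1 - 1) (at 0)"
    by (intro tendsto_diff tendsto_const norm_resolvent_K(2)[OF \<phi>])+
  then show ?thesis by (intro eventually_norm_product) auto
qed

text \<open>The candidate tends to infinity since z times it tends to 1 + 1 - 1, and it solves the
  defining equation since the normalized resolvent has expectation 1. The inverse is recorded for
  evaluating F.\<close>

lemma K_transform_add:
  "\<forall>\<^sub>F z in at 0. K_transform \<phi> (a1 + a2) z = K_transform \<phi> a1 z + K_transform \<phi> a2 z - 1 / z \<and>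
    inverse_pair (z *\<^sub>C (K_transform \<phi> (a1 + a2) z *\<^sub>C 1 - (a1 + a2)))
      (norm_resolvent_K \<phi> a2 z * alg_inv (1 - (norm_resolvent_K \<phi> a1 z - 1) * (norm_resolvent_K \<phi> a2 z - 1)) * norm_resolvent_K \<phi> a1 z)"
proof -
  let ?K1 = "K_transform \<phi> a1" and ?K2 = "K_transform \<phi> a2"
  let ?K = "\<lambda>z. ?K1 z + ?K2 z - 1 / z"
  let ?R = "\<lambda>z. norm_resolvent_K \<phi> a2 z * alg_inv (1 - (norm_resolvent_K \<phi> a1 z - 1) * (norm_resolvent_K \<phi> a2 z - 1)) * norm_resolvent_K \<phi> a1 z"
  note n1 = norm_resolvent_K[OF \<phi>, of a1] and n2 = norm_resolvent_K[OF \<phi>, of a2]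
  have inv: "\<forall>\<^sub>F z in at 0. z \<noteq> 0 \<and> inverse_pair (z *\<^sub>C (?K z *\<^sub>C 1 - (a1 + a2))) (?R z) \<and> \<phi> (?R z) = 1"
    using n1(3) n2(3) eventually_small_left
  proof eventually_elim
    case (elim z)
    have "z *\<^sub>C (?K1 z *\<^sub>C 1 - a1) + z *\<^sub>C (?K2 z *\<^sub>C 1 - a2) - 1 = z *\<^sub>C (?K z *\<^sub>C 1 - (a1 + a2))"
      using elim by (simp add: complex_vector.scale_right_diff_distrib scaleC_add_right scaleC_add_left
          complex_vector.scale_left_diff_distrib scaleC_scaleC scaleC_one algebra_simps)
    moreover have "inverse_pair (z *\<^sub>C (?K1 z *\<^sub>C 1 - a1) + z *\<^sub>C (?K2 z *\<^sub>C 1 - a2) - 1) (?R z)"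
      using elim by (intro inverse_pair_add neumann_series(2)) auto
    moreover have "\<phi> (?R z) = 1"
      using elim by (intro bi_free_left_moment) auto
    ultimately show ?case using elim by simp
  qed
  have "((\<lambda>z. z * ?K1 z + z * ?K2 z - 1) \<longlongrightarrow> 1 + 1 - 1) (at 0)"
    by (intro tendsto_diff tendsto_add tendsto_const n1(1) n2(1))
  then have "filterlim (\<lambda>z. (z * ?K1 z + z * ?K2 z - 1) * inverse z) at_infinity (at 0)"
    by (rule tendsto_mult_filterlim_at_infinity) (auto intro: filterlim_inverse_at_infinity)
  moreover have "\<forall>\<^sub>F z in at 0. (z * ?K1 z + z * ?K2 z - 1) * inverse z = ?K z"
    using inv by eventually_elim (auto simp: field_simps)
  ultimately have lim: "filterlim ?K at_infinity (at 0)"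
    by (simp cong: filterlim_cong)
  have "\<forall>\<^sub>F z in at 0. G_transform \<phi> (a1 + a2) (?K z) = z"
    using inv
  proof eventually_elim
    case (elim z)
    have "inverse_pair (?K z *\<^sub>C 1 - (a1 + a2)) (z *\<^sub>C ?R z)"
      using inverse_pair_scaleC[of "z *\<^sub>C (?K z *\<^sub>C 1 - (a1 + a2))" "?R z" "1 / z" z] elim
      by (simp add: scaleC_scaleC scaleC_one)
    from alg_inv_eqI[OF this] show ?case
      using elim by (simp add: G_transform_def clinear_scaleC[OF \<phi>(1)] scaleC_complex_def)
  qed
  from K_transform_unique[OF \<phi> lim this] inv show ?thesis
    by eventually_elim auto
qed

context
  assumes b: "\<phi> b1 \<noteq> 0" "\<phi> b2 \<noteq> 0"
begin

text \<open>The pole is absorbed by the first factor, as (v1 - 1) / w converges; the second factor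
  tends to 0.\<close>

lemma eventually_small_right: "\<forall>\<^sub>F w in at 0. norm (((w + 1) / w) *\<^sub>C ((norm_resolvent_X \<phi> b1 w - 1) * (norm_resolvent_X \<phi> b2 w - 1))) < 1"
proof -
  obtain l where l: "((\<lambda>w. (1 / w) *\<^sub>C (norm_resolvent_X \<phi> b1 w - 1)) \<longlongrightarrow> l) (at 0)"
    using norm_resolvent_X(4)[OF \<phi> b(1)] by blast
  have "((\<lambda>w. w + 1) \<longlongrightarrow> 0 + 1) (at (0::complex))" by (intro tendsto_intros)
  from tendsto_scaleC[OF this l] have 1: "((\<lambda>w. (w + 1) *\<^sub>C (1 / w) *\<^sub>C (norm_resolvent_X \<phi> b1 w - 1)) \<longlongrightarrow> l) (at 0)"
    by (simp add: scaleC_one)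
  have "((\<lambda>w. norm_resolvent_X \<phi> b2 w - 1) \<longlongrightarrow> 1 - 1) (at 0)"
    by (intro tendsto_diff tendsto_const norm_resolvent_X(3)[OF \<phi> b(2)])
  with eventually_norm_product[OF 1] show ?thesis
    by (simp add: scaleC_scaleC mult_scaleC_left)
qed

lemma X_transform_mult:
  "\<forall>\<^sub>F w in at 0. X_transform \<phi> (b1 * b2) w = X_transform \<phi> b1 w * X_transform \<phi> b2 w * ((w + 1) / w) \<and>
    inverse_pair (1 - X_transform \<phi> (b1 * b2) w *\<^sub>C (b1 * b2))
      ((1 + w) *\<^sub>C (norm_resolvent_X \<phi> b2 w * alg_inv (1 - ((w + 1) / w) *\<^sub>C ((norm_resolvent_X \<phi> b1 w - 1) * (norm_resolvent_X \<phi> b2 w - 1))) * norm_resolvent_X \<phi> b1 w))"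
proof -
  let ?X1 = "X_transform \<phi> b1" and ?X2 = "X_transform \<phi> b2"
  let ?X = "\<lambda>w. ?X1 w * ?X2 w * ((w + 1) / w)"
  let ?R = "\<lambda>w. norm_resolvent_X \<phi> b2 w * alg_inv (1 - ((w + 1) / w) *\<^sub>C ((norm_resolvent_X \<phi> b1 w - 1) * (norm_resolvent_X \<phi> b2 w - 1))) * norm_resolvent_X \<phi> b1 w"
  note n1 = norm_resolvent_X[OF \<phi> b(1)] and n2 = norm_resolvent_X[OF \<phi> b(2)]
  have inv: "\<forall>\<^sub>F w in at 0. inverse_pair (1 - ?X w *\<^sub>C (b1 * b2)) ((1 + w) *\<^sub>C ?R w) \<and> \<phi> (?R w) = 1"
    using n1(5) n2(5) eventually_small_right
  proof eventually_elim
    case (elim w)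
    then have "inverse_pair (1 - ?X w *\<^sub>C (b1 * b2)) ((1 + w) *\<^sub>C ?R w)"
      by (intro inverse_pair_product[OF _ _ neumann_series(2)[OF elim(3)] refl]) auto
    moreover have "\<phi> (?R w) = 1"
      using elim by (intro bi_free_right_moment) auto
    ultimately show ?case ..
  qed
  obtain D where D: "((\<lambda>w. ?X1 w / w) \<longlongrightarrow> D) (at 0)" using n1(2) by blast
  \<comment> \<open>Here too the pole is given to the first factor, X1 / w being convergent.\<close>
  have "((\<lambda>w. (?X1 w / w) * ?X2 w * (w + 1)) \<longlongrightarrow> D * 0 * (0 + 1)) (at 0)"
    by (intro tendsto_mult tendsto_add tendsto_ident_at tendsto_const D n2(1))
  then have lim: "(?X \<longlongrightarrow> 0) (at 0)" by (simp add: field_simps)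
  have "\<forall>\<^sub>F w in at 0. psi_transform \<phi> (b1 * b2) (?X w) = w"
    using inv
  proof eventually_elim
    case (elim w)
    then have "alg_inv (1 - ?X w *\<^sub>C (b1 * b2)) = (1 + w) *\<^sub>C ?R w" by (blast intro: alg_inv_eqI)
    then show ?case
      using elim by (simp add: psi_transform_def clinear_scaleC[OF \<phi>(1)] scaleC_complex_def)
  qed
  moreover have "\<phi> (b1 * b2) \<noteq> 0" using b by (simp add: bi_free_mult_right)
  ultimately have "\<forall>\<^sub>F w in at 0. ?X w = X_transform \<phi> (b1 * b2) w"
    using X_transform_unique[OF \<phi> _ lim] by blast
  with inv show ?thesis by eventually_elim auto
qed

end

end

section \<open>Evaluation of F and the identity for T\<close>

lemma F_transform_eq:
  fixes \<phi> :: "'a::complex_banach_algebra \<Rightarrow> complex"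
  assumes "clinear \<phi>" "z \<noteq> 0" "inverse_pair (z *\<^sub>C (t *\<^sub>C 1 - a)) u" "inverse_pair (1 - s *\<^sub>C b) (d *\<^sub>C v)"
  shows "F_transform \<phi> a b t s = z * d * \<phi> (u * v)"
proof -
  have "inverse_pair (t *\<^sub>C 1 - a) (z *\<^sub>C u)"
    using inverse_pair_scaleC[OF assms(3), of "1 / z" z] assms(2) by (simp add: scaleC_scaleC scaleC_one)
  from alg_inv_eqI[OF this] alg_inv_eqI[OF assms(4)] show ?thesis
    by (simp add: F_transform_def mult_scaleC_left mult_scaleC_right clinear_scaleC[OF assms(1)]
        scaleC_complex_def mult.assoc)
qed

text \<open>As \<open>f * g\<close> is nonzero, convergence of the geometric series already forces
  its ratio r into the unit disc; so h = f g / (1 - r), and a rational identity remains.\<close>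

lemma T_identity:
  fixes z w f g h :: complex
  assumes "z \<noteq> 0" "w \<noteq> 0" "1 + w \<noteq> 0" "f \<noteq> 0" "g \<noteq> 0"
    and h: "(\<lambda>n. ((w + 1) / w * ((f - 1) * (g - 1))) ^ n * (f * g)) sums h"
  shows "(w + 1) / w * (1 - z / (z * (1 + w) * f)) * ((w + 1) / w * (1 - z / (z * (1 + w) * g))) =
    (w + 1) / w * (1 - z / (z * (1 + w) * h))"
proof -
  define r where "r = (w + 1) / w * ((f - 1) * (g - 1))"
  have h: "(\<lambda>n. r ^ n * (f * g)) sums h" using h unfolding r_def .
  then have "summable (\<lambda>n. (f * g) * r ^ n)" by (simp add: sums_iff mult.commute)
  then have r: "norm r < 1"
    using assms(4,5) by (simp add: summable_cmult_iff summable_geometric_iff)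
  have "(\<lambda>n. r ^ n * (f * g)) sums (1 / (1 - r) * (f * g))"
    by (rule sums_mult2[OF geometric_sums[OF r]])
  then have hh: "h = f * g / (1 - r)" using h by (simp add: sums_unique2)
  have 1: "z / (z * (1 + w) * q) = 1 / ((1 + w) * q)" for q using assms(1) by simp
  have 2: "1 / ((1 + w) * h) = (1 - r) / ((1 + w) * (f * g))"
    unfolding hh by simp
  show ?thesis unfolding 1 2 r_def
    using assms(2-5) by (simp add: divide_simps) (simp add: algebra_simps)
qed

theorem theorem3p1:
  fixes \<phi> :: "'a::complex_banach_algebra \<Rightarrow> complex"
    and a1 b1 a2 b2 :: 'a
  assumes "clinear \<phi>" and "continuous_on UNIV \<phi>" and "\<phi> 1 = 1"
    and "bi_free TYPE('x::complex_vector) TYPE('y::complex_vector) \<phi> a1 b1 a2 b2"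
    and "\<phi> b1 \<noteq> 0" and "\<phi> b2 \<noteq> 0"
  shows "\<exists>\<delta>>0. \<forall>z w. z \<noteq> 0 \<and> w \<noteq> 0 \<and> cmod z < \<delta> \<and> cmod w < \<delta> \<longrightarrow>
    T_transform \<phi> a1 b1 z w * T_transform \<phi> a2 b2 z w = T_transform \<phi> (a1 + a2) (b1 * b2) z w"
proof -
  note \<phi> = assms(1-3) and bf = assms(4) and b = assms(5,6)
  let ?u1 = "norm_resolvent_K \<phi> a1" and ?u2 = "norm_resolvent_K \<phi> a2"
  let ?v1 = "norm_resolvent_X \<phi> b1" and ?v2 = "norm_resolvent_X \<phi> b2"
  \<comment> \<open>The germ equations each involve z or w alone; the product of the two punctured
    filters joins them.\<close>
  let ?F = "at (0::complex) \<times>\<^sub>F at (0::complex)"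
  let ?T = "\<lambda>z w. T_transform \<phi> a1 b1 z w * T_transform \<phi> a2 b2 z w = T_transform \<phi> (a1 + a2) (b1 * b2) z w"
  have fst: "filterlim fst (at 0) ?F" and snd: "filterlim snd (at 0) ?F"
    by (rule filterlim_fst, rule filterlim_snd)
  \<comment> \<open>Jointly in both variables the expectation tends to \<open>\<phi> 1 = 1\<close>;
    this supplies the nonzero f and g for \<open>T_identity\<close>.\<close>
  have ne: "\<forall>\<^sub>F p in ?F. \<phi> (u (fst p) * v (snd p)) \<noteq> 0"
    if "(u \<longlongrightarrow> 1) (at 0)" "(v \<longlongrightarrow> 1) (at 0)" for u v :: "complex \<Rightarrow> 'a"
  proof -
    have "((\<lambda>p. \<phi> (u (fst p) * v (snd p))) \<longlongrightarrow> \<phi> (1 * 1)) ?F"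
      by (intro tendsto_functional[OF \<phi>(2)] tendsto_mult filterlim_compose[OF that(1) fst]
          filterlim_compose[OF that(2) snd])
    then show ?thesis using \<phi>(3) by (intro tendsto_imp_eventually_ne) auto
  qed
  note left = norm_resolvent_K(3)[OF \<phi>, of a1] norm_resolvent_K(3)[OF \<phi>, of a2]
    eventually_small_left[OF \<phi> bf] K_transform_add[OF \<phi> bf]
  note right = norm_resolvent_X(5)[OF \<phi> b(1)] norm_resolvent_X(5)[OF \<phi> b(2)]
    eventually_small_right[OF \<phi> bf b] X_transform_mult[OF \<phi> bf b]
  note nonzero = ne[OF norm_resolvent_K(2)[OF \<phi>] norm_resolvent_X(3)[OF \<phi> b(1)], of a1]
    ne[OF norm_resolvent_K(2)[OF \<phi>] norm_resolvent_X(3)[OF \<phi> b(2)], of a2]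
  note ev = left[THEN eventually_compose_filterlim, OF fst] right[THEN eventually_compose_filterlim, OF snd]
  have "\<forall>\<^sub>F p in ?F. ?T (fst p) (snd p)"
    using ev nonzero
  proof eventually_elim
    case (elim p)
    obtain z w where p: "p = (z, w)" by (cases p)
    let ?c = "(w + 1) / w"
    let ?L = "?u2 z * alg_inv (1 - (?u1 z - 1) * (?u2 z - 1)) * ?u1 z"
    let ?R = "?v2 w * alg_inv (1 - ?c *\<^sub>C ((?v1 w - 1) * (?v2 w - 1))) * ?v1 w"
    have zw: "z \<noteq> 0" "w \<noteq> 0" "1 + w \<noteq> 0" using elim by (auto simp: p)
    have vi: "inverse_pair (1 - X_transform \<phi> b1 w *\<^sub>C b1) ((1 + w) *\<^sub>C ?v1 w)"
      "inverse_pair (1 - X_transform \<phi> b2 w *\<^sub>C b2) ((1 + w) *\<^sub>C ?v2 w)"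
      using inverse_pair_scaleC[of "(1 + w) *\<^sub>C (1 - X_transform \<phi> b1 w *\<^sub>C b1)" "?v1 w" "1 / (1 + w)" "1 + w"]
        inverse_pair_scaleC[of "(1 + w) *\<^sub>C (1 - X_transform \<phi> b2 w *\<^sub>C b2)" "?v2 w" "1 / (1 + w)" "1 + w"]
        elim by (simp_all add: p scaleC_scaleC scaleC_one)
    have F: "F_transform \<phi> a1 b1 (K_transform \<phi> a1 z) (X_transform \<phi> b1 w) = z * (1 + w) * \<phi> (?u1 z * ?v1 w)"
      "F_transform \<phi> a2 b2 (K_transform \<phi> a2 z) (X_transform \<phi> b2 w) = z * (1 + w) * \<phi> (?u2 z * ?v2 w)"
      "F_transform \<phi> (a1 + a2) (b1 * b2) (K_transform \<phi> (a1 + a2) z) (X_transform \<phi> (b1 * b2) w) =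
        z * (1 + w) * \<phi> (?L * ?R)"
      using elim vi by (auto simp: p intro!: F_transform_eq[OF \<phi>(1) zw(1)])
    have "(\<lambda>n. (?c * ((\<phi> (?u1 z * ?v1 w) - 1) * (\<phi> (?u2 z * ?v2 w) - 1))) ^ n *
        (\<phi> (?u1 z * ?v1 w) * \<phi> (?u2 z * ?v2 w))) sums \<phi> (?L * ?R)"
      using elim by (intro bi_free_resolvent_series[OF \<phi> bf]) (auto simp: p)
    from T_identity[OF zw _ _ this] elim show ?case
      unfolding p fst_conv snd_conv T_transform_def F by (auto simp: p)
  qed
  then obtain P Q where PQ: "eventually P (at 0)" "eventually Q (at 0)" "\<And>z w. P z \<Longrightarrow> Q w \<Longrightarrow> ?T z w"
    unfolding eventually_prod_filter by auto
  obtain d e where "d > 0" "\<And>z. z \<noteq> 0 \<Longrightarrow> cmod z < d \<Longrightarrow> P z" "e > 0" "\<And>w. w \<noteq> 0 \<Longrightarrow> cmod w < e \<Longrightarrow> Q w"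
    using PQ(1,2) unfolding eventually_at by (auto simp: dist_norm)
  then show ?thesis using PQ(3) by (intro exI[of _ "min d e"]) auto
qed

end
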